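(* Let $\mathbf{G}$ be a Carnot group of step $r$ with first layer $V_1$, let $\Omega\subset\mathbf{G}$ be open and H--convex, and let $c:\mathbf{G}\times V_1\to\mathbb{R}$ be such that $c(g,\cdot):V_1\to\mathbb{R}$ is continuous for every $g\in\Omega$ and the following conditions hold: $(\mathbf{c1})$ $c(\cdot,v)\in\Gamma^{1,1}_{\rm loc}(\mathbf{G})$ for every $v\in V_1$, with Lipschitz bound uniform in $v$, i.e., for every open ball $B\subset\Omega$ there exists $K_B>0$ such that $\|\mathbb{X}c(g',v)-\mathbb{X}c(g,v)\|\le 2K_B\,d(g',g)$ for all $g,g'\in B$ and all $v\in V_1$; $(\mathbf{c2})$ for every $g\in\Omega$ and every $\{v_n\}_n\subset V_1$ with $\|v_n\|\to+\infty$, there exists $g'\in H_g\cap\Omega$ such that $\limsup_n(c(g',v_n)-c(g,v_n))=+\infty$; $(\mathbf{c3})$ for every $g\in\Omega$, the function $\mathbb{X}c(g,\cdot):V_1\to V_1$ is one--to--one. Let $u:\Omega\to\mathbb{R}$ be a $c$ H--convex function, measurable if $r>2$. Then, for a.e. $g\in\Omega$, $\partial_H^cu(g)$ is a singleton, and $$\partial_H^cu(g)=\{(\mathbb{X}c(g,\cdot))^{-1}(\mathbb{X}u(g))\}.$$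
   Context: A Carnot group $\mathbf{G}$ of step $r$ is a connected, simply connected, nilpotent Lie group whose Lie algebra $\mathfrak{g}$ of left--invariant vector fields is stratified: $\mathfrak{g}=V_1\oplus\dots\oplus V_r$ with $V_j\ne\{0\}$, $[V_1,V_j]=V_{j+1}$ for $1\le j\le r-1$, $[V_1,V_r]=0$. A scalar product $\langle\cdot,\cdot\rangle$ is fixed on $\mathfrak{g}$ making the layers mutually orthogonal, with Euclidean norm $|\cdot|$; on $V_1$ this norm is also written $\|\cdot\|$. The map $\exp:\mathfrak{g}\to\mathbf{G}$ is a global diffeomorphism with inverse $\xi=(\xi_1,\dots,\xi_r)$, $\xi_j:\mathbf{G}\to V_j$. Dilations: $\delta_\lambda(g)=\exp(\lambda\xi_1(g)+\dots+\lambda^r\xi_r(g))$. Gauge pseudo--norm: $\|g\|_{\mathbf{G}}=\big(\sum_{i=1}^r|\xi_i(g)|^{2r!/i}\big)^{1/(2r!)}$; gauge pseudo--distance: $d(g,g')=\|g^{-1}g'\|_{\mathbf{G}}$. All balls are balls for $d$; by the paper's convention these balls are H--convex sets. Measurability and "a.e." refer to Haar measure on $\mathbf{G}$. Fix an orthonormal basis $X_1,\dots,X_m$ of $V_1$; $X_iu(g)=\lim_{\alpha\to0}\frac{u(g\exp(\alpha X_i))-u(g)}{\alpha}$, and $\mathbb{X}u(g)=\sum_{i=1}^m(X_iu(g))X_i\in V_1$ is the horizontal gradient; $\mathbb{X}c(g,v)$ denotes the horizontal gradient of $c(\cdot,v)$ at $g$. $\Gamma^1$ is the class of functions with continuous derivatives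 along $X_1,\dots,X_m$; $\Gamma^{1,1}_{\rm loc}$ is the class of functions in $\Gamma^1$ whose horizontal derivatives $X_if$ are locally Lipschitz with respect to $d$. The horizontal plane at $g$ is $H_g=\{gh:\ h\in\exp(V_1)\}$. A set $A\subset\mathbf{G}$ is H--convex if $g\delta_\lambda(g^{-1}g')\in A$ for every $g\in A$, $g'\in H_g\cap A$, $\lambda\in[0,1]$. A proper function $u:\Omega\to(-\infty,+\infty]$ (i.e. $u\not\equiv+\infty$) is $c$ H--convex if for every $g\in\Omega$ the set $\mathcal{P}_g=\{(v,\alpha)\in V_1\times\mathbb{R}:\ c(g',v)+\alpha\le u(g')\ \forall g'\in H_g\cap\Omega\}$ is nonempty and $u(g)=\sup_{(v,\alpha)\in\mathcal{P}_g}(c(g,v)+\alpha)$. The $c$ H--subdifferential of $u$ at $g\in\Omega$ is $\partial_H^cu(g)=\{p\in V_1:\ u(g')\ge u(g)+c(g',p)-c(g,p)\ \forall g'\in H_g\cap\Omega\}$. *)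

theory Defs
  imports "HOL-Analysis.Analysis" "HOL-Algebra.Generated_Groups"
begin

section \<open>Smooth maps between manifolds given by atlases\<close>

primrec Ck_on :: "nat \<Rightarrow> ('a::euclidean_space \<Rightarrow> 'b::euclidean_space) \<Rightarrow> 'a set \<Rightarrow> bool" where
  "Ck_on 0 f S \<longleftrightarrow> continuous_on S f"
| "Ck_on (Suc k) f S \<longleftrightarrow>
     (\<forall>x\<in>S. f differentiable (at x)) \<and>
     (\<forall>b\<in>Basis. Ck_on k (\<lambda>x. frechet_derivative f (at x) b) S)"

text \<open>Only used for open sets.\<close>
definition smooth_on :: "'a set \<Rightarrow> ('a::euclidean_space \<Rightarrow> 'b::euclidean_space) \<Rightarrow> bool" where
  "smooth_on S f \<longleftrightarrow> (\<forall>k. Ck_on k f S)"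

text \<open>A chart is a pair of its domain and the coordinate map (whose values off the domain are
  irrelevant). The underlying manifold is always the whole type.\<close>
type_synonym ('a, 'e) chart = "'a set \<times> ('a \<Rightarrow> 'e)"

definition smooth_atlas :: "('a::topological_space, 'e::euclidean_space) chart set \<Rightarrow> bool" where
  "smooth_atlas A \<longleftrightarrow>
     (\<Union>(U, \<phi>)\<in>A. U) = UNIV \<and>
     (\<forall>(U, \<phi>)\<in>A. open U \<and> open (\<phi> ` U) \<and> homeomorphism U (\<phi> ` U) \<phi> (inv_into U \<phi>)) \<and>
     (\<forall>(U, \<phi>)\<in>A. \<forall>(W, \<psi>)\<in>A. smooth_on (\<phi> ` (U \<inter> W)) (\<psi> \<circ> inv_into U \<phi>))"

definition euclidean_atlas :: "('e::euclidean_space, 'e) chart set" where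
  "euclidean_atlas = {(UNIV, id)}"

definition prod_atlas :: "('a, 'e) chart set \<Rightarrow> ('b, 'f) chart set \<Rightarrow> ('a \<times> 'b, 'e \<times> 'f) chart set" where
  "prod_atlas A B = {(U \<times> W, map_prod \<phi> \<psi>) | U \<phi> W \<psi>. (U, \<phi>) \<in> A \<and> (W, \<psi>) \<in> B}"

definition smooth_map ::
  "('a::topological_space, 'e::euclidean_space) chart set \<Rightarrow>
   ('b::topological_space, 'f::euclidean_space) chart set \<Rightarrow> ('a \<Rightarrow> 'b) \<Rightarrow> bool" where
  "smooth_map A B F \<longleftrightarrow> continuous_on UNIV F \<and>
     (\<forall>(U, \<phi>)\<in>A. \<forall>(W, \<psi>)\<in>B. smooth_on (\<phi> ` (U \<inter> F -` W)) (\<psi> \<circ> F \<circ> inv_into U \<phi>))"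

definition diffeo :: 
  "('a::topological_space, 'e::euclidean_space) chart set \<Rightarrow>
   ('b::topological_space, 'f::euclidean_space) chart set \<Rightarrow> ('a \<Rightarrow> 'b) \<Rightarrow> bool" where
  "diffeo A B F \<longleftrightarrow> bij F \<and> smooth_map A B F \<and> smooth_map B A (inv_into UNIV F)"

section \<open>Lie groups, left-invariant vector fields, exponential map\<close>

text \<open>The Euclidean space \<^typ>\<open>'v\<close> plays two roles: it is the model space of the charts, and
  it is the Lie algebra together with its fixed scalar product. The second role is
  realised by the field \<open>vfield\<close>, a linear isomorphism of \<^typ>\<open>'v\<close> onto the space of
  left-invariant vector fields; the scalar product on the Lie algebra is the one transported
  from \<^typ>\<open>'v\<close>, so every choice of scalar product arises.
  Vector fields are derivations of the algebra of smooth functions.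
  The layers are \<open>layer 1, ..., layer step\<close>; other values of \<open>layer\<close> are irrelevant.\<close>
record ('g, 'v) stratified_struct = "'g monoid" +
  atlas :: "('g, 'v) chart set"
  vfield :: "'v \<Rightarrow> ('g \<Rightarrow> real) \<Rightarrow> ('g \<Rightarrow> real)"
  layer :: "nat \<Rightarrow> 'v set"
  step :: nat

locale lie_group = group G
  for G :: "('g::{t2_space, second_countable_topology}, 'v::euclidean_space) stratified_struct" (structure) +
  assumes carrier_UNIV: "carrier G = UNIV"
    and atlas: "smooth_atlas (atlas G)"
    and smooth_mult: "smooth_map (prod_atlas (atlas G) (atlas G)) (atlas G) (\<lambda>(x, y). x \<otimes> y)"
    and smooth_inv: "smooth_map (atlas G) (atlas G) (\<lambda>x. inv x)"

definition smooth_fun ::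
  "('g::topological_space, 'v::euclidean_space) stratified_struct \<Rightarrow> ('g \<Rightarrow> real) \<Rightarrow> bool" where
  "smooth_fun G f \<longleftrightarrow> smooth_map (atlas G) euclidean_atlas f"

text \<open>The value 0 on non-smooth functions is a normalisation: it makes a vector field,
  as a total HOL function, determined by its action on smooth functions.\<close>
definition left_invariant_fields ::
  "('g::topological_space, 'v::euclidean_space) stratified_struct \<Rightarrow> (('g \<Rightarrow> real) \<Rightarrow> ('g \<Rightarrow> real)) set" where
  "left_invariant_fields G = {D.
     (\<forall>f. smooth_fun G f \<longrightarrow> smooth_fun G (D f)) \<and>
     (\<forall>f h a b. smooth_fun G f \<longrightarrow> smooth_fun G h \<longrightarrow>
        D (\<lambda>x. a * f x + b * h x) = (\<lambda>x. a * D f x + b * D h x)) \<and>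
     (\<forall>f h. smooth_fun G f \<longrightarrow> smooth_fun G h \<longrightarrow>
        D (\<lambda>x. f x * h x) = (\<lambda>x. f x * D h x + h x * D f x)) \<and>
     (\<forall>f y. smooth_fun G f \<longrightarrow> D (\<lambda>x. f (y \<otimes>\<^bsub>G\<^esub> x)) = (\<lambda>x. D f (y \<otimes>\<^bsub>G\<^esub> x))) \<and>
     (\<forall>f. \<not> smooth_fun G f \<longrightarrow> D f = (\<lambda>x. 0))}"

definition lie_bracket ::
  "('g::topological_space, 'v::euclidean_space) stratified_struct \<Rightarrow> 'v \<Rightarrow> 'v \<Rightarrow> 'v" where
  "lie_bracket G X Y = (THE Z. \<forall>f. smooth_fun G f \<longrightarrow>
     vfield G Z f = (\<lambda>x. vfield G X (vfield G Y f) x - vfield G Y (vfield G X f) x))"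

definition lie_exp ::
  "('g::topological_space, 'v::euclidean_space) stratified_struct \<Rightarrow> 'v \<Rightarrow> 'g" where
  "lie_exp G X = (THE \<gamma>. \<gamma> 0 = \<one>\<^bsub>G\<^esub> \<and>
     (\<forall>f t. smooth_fun G f \<longrightarrow>
        ((\<lambda>s. f (\<gamma> s)) has_real_derivative vfield G X f (\<gamma> t)) (at t))) 1"

primrec lower_central :: "('g, 'b) monoid_scheme \<Rightarrow> nat \<Rightarrow> 'g set" where
  "lower_central G 0 = carrier G"
| "lower_central G (Suc n) = generate G
     {x \<otimes>\<^bsub>G\<^esub> y \<otimes>\<^bsub>G\<^esub> inv\<^bsub>G\<^esub> x \<otimes>\<^bsub>G\<^esub> inv\<^bsub>G\<^esub> y | x y. x \<in> carrier G \<and> y \<in> lower_central G n}"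

section \<open>Carnot groups\<close>

text \<open>For connected, simply connected, nilpotent Lie groups \<open>exp_diffeo\<close> is a classical theorem;
  it is recorded here as part of the standing setting and excludes no group.\<close>
locale carnot_group = lie_group G
  for G :: "('g::{t2_space, second_countable_topology}, 'v::euclidean_space) stratified_struct" (structure) +
  assumes connected: "connected (UNIV :: 'g set)"
    and simply_connected: "simply_connected (UNIV :: 'g set)"
    and nilpotent: "\<exists>n. lower_central G n = {\<one>}"
    and vfield_linear: "\<And>a b X Y. vfield G (a *\<^sub>R X + b *\<^sub>R Y) =
          (\<lambda>f x. a * vfield G X f x + b * vfield G Y f x)"
    and vfield_bij: "bij_betw (vfield G) UNIV (left_invariant_fields G)"
    and step_pos: "1 \<le> step G"
    and layer_subspace: "\<And>j. j \<in> {1..step G} \<Longrightarrow> subspace (layer G j) \<and> layer G j \<noteq> {0}"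
    and direct_sum: "\<And>X. \<exists>!x. (\<forall>j\<in>{1..step G}. x j \<in> layer G j) \<and> (\<forall>j. j \<notin> {1..step G} \<longrightarrow> x j = 0) \<and>
          X = (\<Sum>j=1..step G. x j)"
    and layer_bracket: "\<And>j. 1 \<le> j \<Longrightarrow> j < step G \<Longrightarrow>
          span {lie_bracket G X Y | X Y. X \<in> layer G 1 \<and> Y \<in> layer G j} = layer G (j + 1)"
    and top_bracket: "\<And>X Y. X \<in> layer G 1 \<Longrightarrow> Y \<in> layer G (step G) \<Longrightarrow> lie_bracket G X Y = 0"
    and layer_orthogonal: "\<And>i j X Y. i \<in> {1..step G} \<Longrightarrow> j \<in> {1..step G} \<Longrightarrow> i \<noteq> j \<Longrightarrow>
          X \<in> layer G i \<Longrightarrow> Y \<in> layer G j \<Longrightarrow> X \<bullet> Y = 0"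
    and exp_diffeo: "diffeo euclidean_atlas (atlas G) (lie_exp G)"

text \<open>\<open>xi G j\<close> is the \<open>j\<close>-th layer component of the logarithm.\<close>
definition xi ::
  "('g::topological_space, 'v::euclidean_space) stratified_struct \<Rightarrow> nat \<Rightarrow> 'g \<Rightarrow> 'v" where
  "xi G j g = (THE x. (\<forall>i\<in>{1..step G}. x i \<in> layer G i) \<and> (\<forall>i. i \<notin> {1..step G} \<longrightarrow> x i = 0) \<and>
     inv_into UNIV (lie_exp G) g = (\<Sum>i=1..step G. x i)) j"

definition dilation ::
  "('g::topological_space, 'v::euclidean_space) stratified_struct \<Rightarrow> real \<Rightarrow> 'g \<Rightarrow> 'g" where
  "dilation G l g = lie_exp G (\<Sum>j=1..step G. l ^ j *\<^sub>R xi G j g)"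

definition gauge ::
  "('g::topological_space, 'v::euclidean_space) stratified_struct \<Rightarrow> 'g \<Rightarrow> real" where
  "gauge G g = (\<Sum>i=1..step G. norm (xi G i g) powr (2 * fact (step G) / real i))
     powr (1 / (2 * fact (step G)))"

definition gdist ::
  "('g::topological_space, 'v::euclidean_space) stratified_struct \<Rightarrow> 'g \<Rightarrow> 'g \<Rightarrow> real" where
  "gdist G g g' = gauge G (inv\<^bsub>G\<^esub> g \<otimes>\<^bsub>G\<^esub> g')"

definition gball ::
  "('g::topological_space, 'v::euclidean_space) stratified_struct \<Rightarrow> 'g \<Rightarrow> real \<Rightarrow> 'g set" where
  "gball G g \<rho> = {h. gdist G g h < \<rho>}"

definition haar_measure ::
  "('g::topological_space, 'v::euclidean_space) stratified_struct \<Rightarrow> 'g measure \<Rightarrow> bool" where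
  "haar_measure G \<mu> \<longleftrightarrow> sets \<mu> = sets borel \<and>
     (\<forall>K. compact K \<longrightarrow> emeasure \<mu> K < \<infinity>) \<and>
     (\<forall>U. open U \<longrightarrow> U \<noteq> {} \<longrightarrow> 0 < emeasure \<mu> U) \<and>
     (\<forall>g. \<forall>A\<in>sets borel. emeasure \<mu> ((\<lambda>x. g \<otimes>\<^bsub>G\<^esub> x) ` A) = emeasure \<mu> A)"

section \<open>Horizontal calculus and convexity\<close>

definition horizontal_basis ::
  "('g::topological_space, 'v::euclidean_space) stratified_struct \<Rightarrow> 'v set \<Rightarrow> bool" where
  "horizontal_basis G B \<longleftrightarrow> B \<subseteq> layer G 1 \<and> pairwise orthogonal B \<and>
     (\<forall>X\<in>B. norm X = 1) \<and> span B = layer G 1"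

definition has_hderiv ::
  "('g::topological_space, 'v::euclidean_space) stratified_struct \<Rightarrow> 'v \<Rightarrow> ('g \<Rightarrow> real) \<Rightarrow> 'g \<Rightarrow> real \<Rightarrow> bool" where
  "has_hderiv G X u g D \<longleftrightarrow>
     ((\<lambda>\<alpha>. (u (g \<otimes>\<^bsub>G\<^esub> lie_exp G (\<alpha> *\<^sub>R X)) - u g) / \<alpha>) \<longlongrightarrow> D) (at 0)"

definition hderiv ::
  "('g::topological_space, 'v::euclidean_space) stratified_struct \<Rightarrow> 'v \<Rightarrow> ('g \<Rightarrow> real) \<Rightarrow> 'g \<Rightarrow> real" where
  "hderiv G X u g = (THE D. has_hderiv G X u g D)"

text \<open>Meaningful only where all derivatives along \<open>B\<close> exist.\<close>
definition hgrad ::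
  "('g::topological_space, 'v::euclidean_space) stratified_struct \<Rightarrow> 'v set \<Rightarrow> ('g \<Rightarrow> real) \<Rightarrow> 'g \<Rightarrow> 'v" where
  "hgrad G B u g = (\<Sum>X\<in>B. hderiv G X u g *\<^sub>R X)"

definition Gamma1 ::
  "('g::topological_space, 'v::euclidean_space) stratified_struct \<Rightarrow> 'v set \<Rightarrow> ('g \<Rightarrow> real) set" where
  "Gamma1 G B = {f. \<forall>X\<in>B. (\<forall>g. \<exists>D. has_hderiv G X f g D) \<and> continuous_on UNIV (hderiv G X f)}"

definition Gamma11_loc ::
  "('g::topological_space, 'v::euclidean_space) stratified_struct \<Rightarrow> 'v set \<Rightarrow> ('g \<Rightarrow> real) set" where
  "Gamma11_loc G B = {f \<in> Gamma1 G B. \<forall>X\<in>B. \<forall>g. \<exists>\<rho>>0. \<exists>L. \<forall>h\<in>gball G g \<rho>. \<forall>h'\<in>gball G g \<rho>.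
     \<bar>hderiv G X f h - hderiv G X f h'\<bar> \<le> L * gdist G h h'}"

definition hplane ::
  "('g::topological_space, 'v::euclidean_space) stratified_struct \<Rightarrow> 'g \<Rightarrow> 'g set" where
  "hplane G g = {g \<otimes>\<^bsub>G\<^esub> h | h. h \<in> lie_exp G ` layer G 1}"

definition H_convex ::
  "('g::topological_space, 'v::euclidean_space) stratified_struct \<Rightarrow> 'g set \<Rightarrow> bool" where
  "H_convex G A \<longleftrightarrow> (\<forall>g\<in>A. \<forall>g'\<in>hplane G g \<inter> A. \<forall>l\<in>{0..1}.
     g \<otimes>\<^bsub>G\<^esub> dilation G l (inv\<^bsub>G\<^esub> g \<otimes>\<^bsub>G\<^esub> g') \<in> A)"

text \<open>Functions on \<open>\<Omega>\<close> are represented by total functions whose values off \<open>\<Omega>\<close> are never used;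
  likewise only second arguments of \<open>c\<close> in the first layer matter.\<close>
definition cH_minorants ::
  "('g::topological_space, 'v::euclidean_space) stratified_struct \<Rightarrow> ('g \<Rightarrow> 'v \<Rightarrow> real) \<Rightarrow> 'g set \<Rightarrow>
   ('g \<Rightarrow> ereal) \<Rightarrow> 'g \<Rightarrow> ('v \<times> real) set" where
  "cH_minorants G c \<Omega> u g = {(v, \<alpha>). v \<in> layer G 1 \<and>
     (\<forall>g'\<in>hplane G g \<inter> \<Omega>. ereal (c g' v + \<alpha>) \<le> u g')}"

definition cH_convex ::
  "('g::topological_space, 'v::euclidean_space) stratified_struct \<Rightarrow> ('g \<Rightarrow> 'v \<Rightarrow> real) \<Rightarrow> 'g set \<Rightarrow>
   ('g \<Rightarrow> ereal) \<Rightarrow> bool" where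
  "cH_convex G c \<Omega> u \<longleftrightarrow>
     (\<forall>g\<in>\<Omega>. u g \<noteq> -\<infinity>) \<and> (\<exists>g\<in>\<Omega>. u g \<noteq> \<infinity>) \<and>
     (\<forall>g\<in>\<Omega>. cH_minorants G c \<Omega> u g \<noteq> {} \<and>
        u g = (SUP (v, \<alpha>)\<in>cH_minorants G c \<Omega> u g. ereal (c g v + \<alpha>)))"

definition cH_subdiff ::
  "('g::topological_space, 'v::euclidean_space) stratified_struct \<Rightarrow> ('g \<Rightarrow> 'v \<Rightarrow> real) \<Rightarrow> 'g set \<Rightarrow>
   ('g \<Rightarrow> ereal) \<Rightarrow> 'g \<Rightarrow> 'v set" where
  "cH_subdiff G c \<Omega> u g = {p \<in> layer G 1.
     \<forall>g'\<in>hplane G g \<inter> \<Omega>. u g' \<ge> u g + ereal (c g' p) - ereal (c g p)}"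

end

theory Submission
  imports Defs
begin

text \<open>
  The subdifferential is nonempty at every point of \<open>\<Omega>\<close>: the slopes of a maximising sequence of
  minorants stay bounded by (c2), and continuity of the cost in the slope lets one pass to the limit
  (\<open>subdiff_nonempty\<close>). If \<open>u\<close> has a derivative along a horizontal direction at \<open>g\<close>, then for \<open>p\<close> in the
  subdifferential the function \<open>u - c(\<cdot>, p)\<close> has a minimum at \<open>g\<close> along that direction, so the derivatives
  of \<open>u\<close> and of \<open>c(\<cdot>, p)\<close> agree (\<open>subdiff_hderiv\<close>); by (c3) this determines \<open>p\<close>. What has to be proved is
  that the derivatives of \<open>u\<close> along the elements of \<open>B\<close> exist almost everywhere.

  By (c1) the cost is quadratically close to its linearisation along a horizontal line, uniformly in the
  slope. A subgradient at each point of the line therefore gives a supporting parabola of fixed opening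
  there (\<open>line_support\<close>), so \<open>u\<close> is semiconvex on the line and fails to be
  differentiable on a countable set of parameters only (\<open>countable_nondifferentiable_line\<close>). Fubini's
  theorem for Haar measure times Lebesgue measure then shows that a Borel set with countable sections
  along the lines \<open>t \<mapsto> g exp(tX)\<close> is null up to a right translation, and right translations preserve null
  sets (\<open>null_of_countable_line_sections\<close>). As \<open>u\<close> agrees off a null set with a Borel function, the
  exceptional set is Borel up to a null set (\<open>AE_has_hderiv\<close>).

  In step larger than two, measurability of \<open>u\<close> is a hypothesis; in step at most two it has to be proved
  (\<open>borel_measurable_u\<close>). There the restriction of \<open>u\<close> to a coset of the subgroup generated by \<open>X, Y \<in> B\<close> is
  a horizontally semiconvex function on the Heisenberg group. Finitely many points generate a
  neighbourhood of the identity by three generations of horizontal segments, so such a function is locally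
  bounded above, and this forces continuity in the direction of the commutator \<open>[X, Y]\<close>
  (\<open>heisenberg_semiconvex.vertical_continuous\<close>). Since \<open>B\<close> and the commutators span the Lie algebra, \<open>u\<close> is
  continuous along enough one-parameter subgroups for Lebesgue's argument on separately continuous
  functions (\<open>measurable_of_continuous_along_flows\<close>).

  The facts on Lie groups used in this argument are derived from the definitions. Injectivity of the
  exponential map yields the existence of all integral curves without solving a differential equation
  (\<open>icurve_exists\<close>) and the linearity of the adjoint action; the commutator of two one-parameter subgroups,
  expanded to second order in two ways, identifies the infinitesimal adjoint action with the Lie bracket
  (\<open>lie_bracket_eq_ad\<close>), and the product formula in step two follows (\<open>Exp_mult\<close>).
\<close>

section \<open>Smooth maps\<close>

lemma Ck_on_cong:
  assumes "open S" "\<And>x. x \<in> S \<Longrightarrow> f x = g x" "Ck_on k f S"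
  shows "Ck_on k g S"
  using assms(2,3)
proof (induction k arbitrary: f g)
  case 0
  then show ?case by (simp cong: continuous_on_cong)
next
  case (Suc k)
  have d: "(g has_derivative frechet_derivative f (at x)) (at x)" if "x \<in> S" for x
    using has_derivative_transform_within_open[OF _ assms(1) that, where f = f and g = g] Suc.prems that
    by (auto simp: frechet_derivative_works)
  have "frechet_derivative g (at x) = frechet_derivative f (at x)" if "x \<in> S" for x
    by (rule frechet_derivative_at[OF d[OF that], symmetric])
  then show ?case
    using Suc.prems d Suc.IH by (auto simp: differentiable_def)
qed

lemma Ck_on_SucD:
  "Ck_on (Suc k) f S \<Longrightarrow> Ck_on k f S"
proof (induction k arbitrary: f)
  case 0
  then show ?case
    by (auto intro!: continuous_at_imp_continuous_on differentiable_imp_continuous_within)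
qed (auto simp: Ck_on.simps(2))

lemma Ck_on_subset: "T \<subseteq> S \<Longrightarrow> Ck_on k f S \<Longrightarrow> Ck_on k f T"
  by (induction k arbitrary: f) (auto intro: continuous_on_subset)

lemma Ck_on_local:
  assumes "\<And>x. x \<in> S \<Longrightarrow> \<exists>T. open T \<and> x \<in> T \<and> Ck_on k f T"
  shows "Ck_on k f S"
  using assms
proof (induction k arbitrary: f)
  case 0
  have "isCont f x" if x: "x \<in> S" for x
  proof -
    obtain T where "open T" "x \<in> T" "continuous_on T f" using 0[OF x] by auto
    then show ?thesis by (simp add: continuous_on_eq_continuous_at)
  qed
  then show ?case
    by (simp add: continuous_at_imp_continuous_on)
next
  case (Suc k)
  have "f differentiable (at x)" if x: "x \<in> S" for x
    using Suc.prems[OF x] by auto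
  moreover have "Ck_on k (\<lambda>x. frechet_derivative f (at x) b) S" if b: "b \<in> Basis" for b
  proof (rule Suc.IH)
    fix x assume x: "x \<in> S"
    obtain T where "open T" "x \<in> T" "Ck_on (Suc k) f T" using Suc.prems[OF x] by blast
    then show "\<exists>T. open T \<and> x \<in> T \<and> Ck_on k (\<lambda>x. frechet_derivative f (at x) b) T"
      using b by auto
  qed
  ultimately show ?case by simp
qed

lemma Ck_on_const: "Ck_on k (\<lambda>x. c) S"
  by (induction k arbitrary: c) auto

lemma Ck_on_linear:
  assumes "linear f" shows "Ck_on k f S"
proof (cases k)
  case 0
  then show ?thesis using assms by (simp add: linear_continuous_on linear_conv_bounded_linear)
next
  case (Suc j)
  have "(f has_derivative f) (at x)" for x
    using assms by (simp add: bounded_linear_imp_has_derivative linear_conv_bounded_linear)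
  then have "frechet_derivative f (at x) = f" "f differentiable (at x)" for x
    using frechet_derivative_at[symmetric] by (blast, auto simp: differentiable_def)
  then show ?thesis using Suc by (simp add: Ck_on_const)
qed

lemma Ck_on_linear_comp:
  assumes "open S" "linear L" "Ck_on k f S"
  shows "Ck_on k (\<lambda>x. L (f x)) S"
  using assms(3)
proof (induction k arbitrary: f)
  case 0
  then show ?case
    using continuous_on_compose2[OF linear_continuous_on[of L UNIV], of S f] assms(2)
    by (simp add: linear_conv_bounded_linear)
next
  case (Suc k)
  have d: "((\<lambda>x. L (f x)) has_derivative (\<lambda>b. L (frechet_derivative f (at x) b))) (at x)"
    if "x \<in> S" for x
    using Suc.prems that assms(2)
    by (intro bounded_linear.has_derivative[of L]) (auto simp: frechet_derivative_works linear_conv_bounded_linear)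
  have e: "frechet_derivative (\<lambda>x. L (f x)) (at x) = (\<lambda>b. L (frechet_derivative f (at x) b))"
    if "x \<in> S" for x
    by (rule frechet_derivative_at[OF d[OF that], symmetric])
  have "Ck_on k (\<lambda>x. frechet_derivative (\<lambda>x. L (f x)) (at x) b) S" if "b \<in> Basis" for b
    by (rule Ck_on_cong[OF assms(1) _ Suc.IH[of "\<lambda>x. frechet_derivative f (at x) b"]])
       (use e Suc.prems that in auto)
  then show ?case
    using d by (auto simp: differentiable_def)
qed

lemma Ck_on_add:
  assumes "open S" "Ck_on k f S" "Ck_on k g S"
  shows "Ck_on k (\<lambda>x. f x + g x) S"
  using assms(2,3)
proof (induction k arbitrary: f g)
  case 0
  then show ?case by (simp add: continuous_on_add)
next
  case (Suc k)
  have d: "((\<lambda>x. f x + g x) has_derivative (\<lambda>b. frechet_derivative f (at x) b + frechet_derivative g (at x) b)) (at x)"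
    if "x \<in> S" for x
    using Suc.prems that by (auto simp: frechet_derivative_works intro!: has_derivative_add)
  have e: "frechet_derivative (\<lambda>x. f x + g x) (at x) = (\<lambda>b. frechet_derivative f (at x) b + frechet_derivative g (at x) b)"
    if "x \<in> S" for x
    by (rule frechet_derivative_at[OF d[OF that], symmetric])
  have "Ck_on k (\<lambda>x. frechet_derivative (\<lambda>x. f x + g x) (at x) b) S" if "b \<in> Basis" for b
    by (rule Ck_on_cong[OF assms(1) _ Suc.IH[of "\<lambda>x. frechet_derivative f (at x) b" "\<lambda>x. frechet_derivative g (at x) b"]])
       (use e Suc.prems that in auto)
  then show ?case
    using d by (auto simp: differentiable_def)
qed

lemma Ck_on_sum:
  assumes "open S" "\<And>i. i \<in> I \<Longrightarrow> Ck_on k (f i) S"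
  shows "Ck_on k (\<lambda>x. \<Sum>i\<in>I. f i x) S"
  using assms(2)
proof (induction I rule: infinite_finite_induct)
  case (insert i I)
  have "Ck_on k (\<lambda>x. f i x + (\<Sum>i\<in>I. f i x)) S"
    by (rule Ck_on_add[OF assms(1)]) (use insert in auto)
  then show ?case using insert by simp
qed (simp_all add: Ck_on_const)

lemma Ck_on_scaleR:
  assumes "open S" "Ck_on k f S" "Ck_on k g S"
  shows "Ck_on k (\<lambda>x. f x *\<^sub>R g x) S"
  using assms(2,3)
proof (induction k arbitrary: f g)
  case 0
  then show ?case by (simp add: continuous_on_scaleR)
next
  case (Suc k)
  have d: "((\<lambda>x. f x *\<^sub>R g x) has_derivative (\<lambda>b. f x *\<^sub>R frechet_derivative g (at x) b + frechet_derivative f (at x) b *\<^sub>R g x)) (at x)"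
    if "x \<in> S" for x
    using Suc.prems that by (auto simp: frechet_derivative_works intro!: has_derivative_scaleR)
  have e: "frechet_derivative (\<lambda>x. f x *\<^sub>R g x) (at x) = (\<lambda>b. f x *\<^sub>R frechet_derivative g (at x) b + frechet_derivative f (at x) b *\<^sub>R g x)"
    if "x \<in> S" for x
    by (rule frechet_derivative_at[OF d[OF that], symmetric])
  have "Ck_on k (\<lambda>x. frechet_derivative (\<lambda>x. f x *\<^sub>R g x) (at x) b) S" if "b \<in> Basis" for b
  proof (rule Ck_on_cong[OF assms(1)])
    show "Ck_on k (\<lambda>x. f x *\<^sub>R frechet_derivative g (at x) b + frechet_derivative f (at x) b *\<^sub>R g x) S"
      using Suc.prems that Ck_on_SucD[OF Suc.prems(1)] Ck_on_SucD[OF Suc.prems(2)]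
      by (intro Ck_on_add[OF assms(1)] Suc.IH) auto
  qed (use e in auto)
  then show ?case
    using d by (auto simp: differentiable_def)
qed

text \<open>The derivative of the composition is written in coordinates, as a sum of products, so that the
  induction hypothesis applies to each factor.\<close>
lemma Ck_on_compose:
  assumes "open S" "open T" "f ` S \<subseteq> T" "Ck_on k f S" "Ck_on k g T"
  shows "Ck_on k (\<lambda>x. g (f x)) S"
  using assms(4,5)
proof (induction k arbitrary: g)
  case 0
  then show ?case using assms(3) by (auto intro: continuous_on_compose2)
next
  case (Suc k)
  have fT: "f x \<in> T" if "x \<in> S" for x using assms(3) that by auto
  have df: "(f has_derivative frechet_derivative f (at x)) (at x)" if "x \<in> S" for x
    using Suc.prems that by (auto simp: frechet_derivative_works)
  have dg: "(g has_derivative frechet_derivative g (at (f x))) (at (f x))" if "x \<in> S" for x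
    using Suc.prems fT that by (auto simp: frechet_derivative_works)
  have d: "((\<lambda>x. g (f x)) has_derivative (\<lambda>b. frechet_derivative g (at (f x)) (frechet_derivative f (at x) b))) (at x)"
    if "x \<in> S" for x
    using diff_chain_at[OF df[OF that] dg[OF that]] by (simp add: o_def)
  have e: "frechet_derivative (\<lambda>x. g (f x)) (at x) b =
      (\<Sum>i\<in>Basis. (frechet_derivative f (at x) b \<bullet> i) *\<^sub>R frechet_derivative g (at (f x)) i)"
    if "x \<in> S" for x b
  proof -
    have "frechet_derivative (\<lambda>x. g (f x)) (at x) b = frechet_derivative g (at (f x)) (frechet_derivative f (at x) b)"
      using frechet_derivative_at[OF d[OF that]] by metis
    also have "frechet_derivative f (at x) b = (\<Sum>i\<in>Basis. (frechet_derivative f (at x) b \<bullet> i) *\<^sub>R i)"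
      by (simp add: euclidean_representation)
    also have "frechet_derivative g (at (f x)) \<dots> = (\<Sum>i\<in>Basis. (frechet_derivative f (at x) b \<bullet> i) *\<^sub>R frechet_derivative g (at (f x)) i)"
      using has_derivative_linear[OF dg[OF that]] by (simp add: linear_sum linear_scale)
    finally show ?thesis .
  qed
  have "Ck_on k (\<lambda>x. frechet_derivative (\<lambda>x. g (f x)) (at x) b) S" if "b \<in> Basis" for b
  proof (rule Ck_on_cong[OF assms(1)])
    show "Ck_on k (\<lambda>x. \<Sum>i\<in>Basis. (frechet_derivative f (at x) b \<bullet> i) *\<^sub>R frechet_derivative g (at (f x)) i) S"
    proof (intro Ck_on_sum Ck_on_scaleR assms(1))
      fix i :: 'b assume i: "i \<in> Basis"
      have 1: "Ck_on k (\<lambda>x. frechet_derivative f (at x) b) S"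
        using Suc.prems that by auto
      show "Ck_on k (\<lambda>x. frechet_derivative f (at x) b \<bullet> i) S"
        by (rule Ck_on_linear_comp[OF assms(1) _ 1])
           (simp add: bounded_linear.linear bounded_linear_inner_left)
      show "Ck_on k (\<lambda>x. frechet_derivative g (at (f x)) i) S"
        using Suc.prems i Ck_on_SucD[OF Suc.prems(1)] by (intro Suc.IH) auto
    qed
  qed (use e in auto)
  then show ?case
    using d by (auto simp: differentiable_def)
qed

lemma Ck_on_Pair:
  assumes "open S" "Ck_on k f S" "Ck_on k g S"
  shows "Ck_on k (\<lambda>x. (f x, g x)) S"
proof -
  have "Ck_on k (\<lambda>x. (f x, 0) + (0, g x)) S"
    using assms by (intro Ck_on_add Ck_on_linear_comp[where L = "\<lambda>y. (y, 0)"] Ck_on_linear_comp[where L = "\<lambda>y. (0, y)"])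
       (auto intro!: linearI)
  then show ?thesis by simp
qed

lemma smooth_on_Pair: "open S \<Longrightarrow> smooth_on S f \<Longrightarrow> smooth_on S g \<Longrightarrow> smooth_on S (\<lambda>x. (f x, g x))"
  unfolding smooth_on_def using Ck_on_Pair[of S _ f g] by simp

lemma smooth_on_compose:
  assumes "open S" "open T" "f ` S \<subseteq> T" "smooth_on S f" "smooth_on T g"
  shows "smooth_on S (\<lambda>x. g (f x))"
  unfolding smooth_on_def
proof
  fix k show "Ck_on k (\<lambda>x. g (f x)) S"
    by (rule Ck_on_compose[OF assms(1-3)]) (use assms(4,5) in \<open>auto simp: smooth_on_def\<close>)
qed

lemma smooth_on_cong:
  "open S \<Longrightarrow> (\<And>x. x \<in> S \<Longrightarrow> f x = g x) \<Longrightarrow> smooth_on S f \<Longrightarrow> smooth_on S g"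
  unfolding smooth_on_def by (metis Ck_on_cong)

lemma smooth_on_subset: "T \<subseteq> S \<Longrightarrow> smooth_on S f \<Longrightarrow> smooth_on T f"
  unfolding smooth_on_def by (simp add: Ck_on_subset)

lemma smooth_on_local:
  "(\<And>x. x \<in> S \<Longrightarrow> \<exists>T. open T \<and> x \<in> T \<and> smooth_on T f) \<Longrightarrow> smooth_on S f"
  unfolding smooth_on_def
proof (intro allI Ck_on_local)
  fix k x
  assume *: "\<And>x. x \<in> S \<Longrightarrow> \<exists>T. open T \<and> x \<in> T \<and> (\<forall>k. Ck_on k f T)" and "x \<in> S"
  then show "\<exists>T. open T \<and> x \<in> T \<and> Ck_on k f T" using *[of x] by auto
qed

text \<open>The properties of an atlas that composition of smooth maps uses; a product of atlases inherits them
  from its factors without an inspection of transition maps.\<close>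
definition open_charts :: "('a::topological_space, 'e::euclidean_space) chart set \<Rightarrow> bool" where
  "open_charts A \<longleftrightarrow> (\<Union>(U, \<phi>)\<in>A. U) = UNIV \<and>
     (\<forall>(U, \<phi>)\<in>A. open U \<and> inj_on \<phi> U \<and> (\<forall>W. open W \<longrightarrow> W \<subseteq> U \<longrightarrow> open (\<phi> ` W)))"

lemma open_charts_cover: "open_charts A \<Longrightarrow> (\<And>U \<phi>. (U, \<phi>) \<in> A \<Longrightarrow> x \<in> U \<Longrightarrow> P) \<Longrightarrow> P"
proof -
  assume "open_charts A" and P: "\<And>U \<phi>. (U, \<phi>) \<in> A \<Longrightarrow> x \<in> U \<Longrightarrow> P"
  then have "x \<in> (\<Union>(U, \<phi>)\<in>A. U)" by (simp add: open_charts_def)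
  then show P using P by auto
qed

lemma open_chartsD:
  assumes "open_charts A" "(U, \<phi>) \<in> A"
  shows "open U" "inj_on \<phi> U" "\<And>T. open T \<Longrightarrow> T \<subseteq> U \<Longrightarrow> open (\<phi> ` T)"
  using assms by (auto simp: open_charts_def)

lemma smooth_mapD:
  assumes "smooth_map A B F"
  shows "continuous_on UNIV F" "open T \<Longrightarrow> open (F -` T)"
    "(U, \<phi>) \<in> A \<Longrightarrow> (W, \<psi>) \<in> B \<Longrightarrow> smooth_on (\<phi> ` (U \<inter> F -` W)) (\<lambda>z. \<psi> (F (inv_into U \<phi> z)))"
  using assms by (auto simp: smooth_map_def o_def continuous_on_open_vimage)

lemma smooth_mapI:
  assumes "continuous_on UNIV F"
    "\<And>U \<phi> W \<psi>. (U, \<phi>) \<in> A \<Longrightarrow> (W, \<psi>) \<in> B \<Longrightarrow>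
      smooth_on (\<phi> ` (U \<inter> F -` W)) (\<lambda>z. \<psi> (F (inv_into U \<phi> z)))"
  shows "smooth_map A B F"
  using assms by (auto simp: smooth_map_def o_def)

lemma smooth_map_compose:
  assumes A: "open_charts A" and B: "open_charts B" and C: "open_charts C"
    and F: "smooth_map A B F" and H: "smooth_map B C H"
  shows "smooth_map A C (\<lambda>x. H (F x))"
proof (rule smooth_mapI)
  have cF: "continuous_on UNIV F" and cH: "continuous_on UNIV H"
    using F H by (auto simp: smooth_map_def)
  then show "continuous_on UNIV (\<lambda>x. H (F x))"
    by (auto intro: continuous_on_compose2)
  have oF: "open (F -` T)" if "open T" for T
    using cF that by (simp add: continuous_on_open_vimage)
  have oH: "open (H -` T)" if "open T" for T
    using cH that by (simp add: continuous_on_open_vimage)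
  fix U \<phi> W \<psi> assume U: "(U, \<phi>) \<in> A" and W: "(W, \<psi>) \<in> C"
  have oU: "open U" "inj_on \<phi> U" and im: "\<And>T. open T \<Longrightarrow> T \<subseteq> U \<Longrightarrow> open (\<phi> ` T)"
    using A U by (auto simp: open_charts_def)
  have oW: "open W" using C W by (auto simp: open_charts_def)
  show "smooth_on (\<phi> ` (U \<inter> (\<lambda>x. H (F x)) -` W)) (\<lambda>z. \<psi> (H (F (inv_into U \<phi> z))))"
  proof (rule smooth_on_local)
    fix y assume "y \<in> \<phi> ` (U \<inter> (\<lambda>x. H (F x)) -` W)"
    then obtain x where x: "x \<in> U" "H (F x) \<in> W" "y = \<phi> x" by auto
    obtain V \<kappa> where V: "(V, \<kappa>) \<in> B" "F x \<in> V"
      using open_charts_cover[OF B] by blast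
    note oV = open_chartsD(1,2)[OF B V(1)] and imV = open_chartsD(3)[OF B V(1)]
    define S where "S = U \<inter> F -` (V \<inter> H -` W)"
    have oS: "open S" unfolding S_def using oU oV oW by (intro open_Int oF oH) auto
    have 1: "smooth_on (\<phi> ` S) (\<lambda>z. \<kappa> (F (inv_into U \<phi> z)))"
      by (rule smooth_on_subset[OF _ smooth_mapD(3)[OF F U V(1)]]) (auto simp: S_def)
    note 2 = smooth_mapD(3)[OF H V(1) W]
    have "smooth_on (\<phi> ` S) (\<lambda>z. \<psi> (H (inv_into V \<kappa> (\<kappa> (F (inv_into U \<phi> z))))))"
    proof (rule smooth_on_compose[OF _ _ _ 1 2])
      show "open (\<phi> ` S)" using oS by (intro im) (auto simp: S_def)
      show "open (\<kappa> ` (V \<inter> H -` W))" using oV oW by (intro imV open_Int oH) auto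
      show "(\<lambda>z. \<kappa> (F (inv_into U \<phi> z))) ` \<phi> ` S \<subseteq> \<kappa> ` (V \<inter> H -` W)"
        using oU by (auto simp: S_def)
    qed
    then have "smooth_on (\<phi> ` S) (\<lambda>z. \<psi> (H (F (inv_into U \<phi> z))))"
    proof (rule smooth_on_cong[rotated 2])
      show "open (\<phi> ` S)" using oS by (intro im) (auto simp: S_def)
      fix z assume "z \<in> \<phi> ` S"
      then obtain v where v: "z = \<phi> v" "v \<in> U" "F v \<in> V" by (auto simp: S_def)
      then show "\<psi> (H (inv_into V \<kappa> (\<kappa> (F (inv_into U \<phi> z))))) = \<psi> (H (F (inv_into U \<phi> z)))"
        using oU oV by simp
    qed
    moreover have "open (\<phi> ` S)" using oS by (intro im) (auto simp: S_def)
    moreover have "y \<in> \<phi> ` S" using x V by (auto simp: S_def)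
    ultimately show "\<exists>T. open T \<and> y \<in> T \<and> smooth_on T (\<lambda>z. \<psi> (H (F (inv_into U \<phi> z))))"
      by blast
  qed
qed

lemma open_charts_smooth_atlas:
  assumes "smooth_atlas A" shows "open_charts A"
proof -
  have "inj_on \<phi> U \<and> open (\<phi> ` T)" if "(U, \<phi>) \<in> A" "open T" "T \<subseteq> U" for U \<phi> T
  proof -
    have h: "homeomorphism U (\<phi> ` U) \<phi> (inv_into U \<phi>)" "open (\<phi> ` U)"
      using assms that by (auto simp: smooth_atlas_def)
    have "openin (top_of_set (\<phi> ` U)) (\<phi> ` T)"
      using homeomorphism_imp_open_map[OF h(1)] that(2,3) by (metis openin_open_eq openin_subset open_subset)
    then have "open (\<phi> ` T)" using h(2) openin_open_trans by blast
    moreover have "inj_on \<phi> U" using h(1) by (metis homeomorphism_def inj_on_inverseI)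
    ultimately show ?thesis by simp
  qed
  then show ?thesis
    using assms unfolding open_charts_def by (auto simp: smooth_atlas_def)
qed

lemma open_charts_prod:
  assumes A: "open_charts A" and B: "open_charts B"
  shows "open_charts (prod_atlas A B)"
proof -
  have "(\<Union>(U, \<phi>)\<in>prod_atlas A B. U) = UNIV"
  proof safe
    fix x :: 'a and y :: 'c
    obtain U \<phi> W \<psi> where "(U, \<phi>) \<in> A" "x \<in> U" "(W, \<psi>) \<in> B" "y \<in> W"
      using open_charts_cover[OF A] open_charts_cover[OF B] by metis
    then have "(U \<times> W, map_prod \<phi> \<psi>) \<in> prod_atlas A B" "(x, y) \<in> U \<times> W"
      by (auto simp: prod_atlas_def)
    then show "(x, y) \<in> (\<Union>(U, \<phi>)\<in>prod_atlas A B. U)" by blast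
  qed auto
  moreover have "open (U \<times> W) \<and> inj_on (map_prod \<phi> \<psi>) (U \<times> W) \<and> (\<forall>T. open T \<longrightarrow> T \<subseteq> U \<times> W \<longrightarrow> open (map_prod \<phi> \<psi> ` T))"
    if "(U, \<phi>) \<in> A" "(W, \<psi>) \<in> B" for U \<phi> W \<psi>
  proof (intro conjI allI impI)
    note U = open_chartsD[OF A that(1)] and W = open_chartsD[OF B that(2)]
    show "open (U \<times> W)" using U W by (simp add: open_Times)
    show "inj_on (map_prod \<phi> \<psi>) (U \<times> W)" using U W by (simp add: map_prod_inj_on)
    fix T assume T: "open T" "T \<subseteq> U \<times> W"
    show "open (map_prod \<phi> \<psi> ` T)"
      unfolding open_prod_def
    proof
      fix z assume "z \<in> map_prod \<phi> \<psi> ` T"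
      then obtain x y where z: "z = map_prod \<phi> \<psi> (x, y)" and "(x, y) \<in> T" by auto
      then obtain P Q where PQ: "open P" "open Q" "x \<in> P" "y \<in> Q" "P \<times> Q \<subseteq> T"
        using T(1) unfolding open_prod_def by (metis mem_Sigma_iff)
      then have "P \<subseteq> U" "Q \<subseteq> W" using T(2) by auto
      then have "open (\<phi> ` P)" "open (\<psi> ` Q)" using PQ U W by auto
      moreover have "\<phi> ` P \<times> \<psi> ` Q \<subseteq> map_prod \<phi> \<psi> ` T"
      proof -
        have "\<phi> ` P \<times> \<psi> ` Q = map_prod \<phi> \<psi> ` (P \<times> Q)" by auto
        then show ?thesis using PQ(5) by (simp only: image_mono)
      qed
      moreover have "z \<in> \<phi> ` P \<times> \<psi> ` Q" using PQ z by simp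
      ultimately show "\<exists>A B. open A \<and> open B \<and> z \<in> A \<times> B \<and> A \<times> B \<subseteq> map_prod \<phi> \<psi> ` T"
        by - (intro exI[of _ "\<phi> ` P"] exI[of _ "\<psi> ` Q"] conjI)
    qed
  qed
  ultimately show ?thesis
    unfolding open_charts_def prod_atlas_def by auto
qed

lemma open_charts_euclidean: "open_charts euclidean_atlas"
  by (auto simp: open_charts_def euclidean_atlas_def)

lemma smooth_map_Pair:
  assumes A: "open_charts A" and B: "open_charts B" and C: "open_charts C"
    and F: "smooth_map A B F" and H: "smooth_map A C H"
  shows "smooth_map A (prod_atlas B C) (\<lambda>x. (F x, H x))"
proof (rule smooth_mapI)
  show "continuous_on UNIV (\<lambda>x. (F x, H x))"
    using smooth_mapD(1)[OF F] smooth_mapD(1)[OF H] by (intro continuous_on_Pair)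
next
  fix U \<phi> Q \<theta> assume U: "(U, \<phi>) \<in> A" and Q: "(Q, \<theta>) \<in> prod_atlas B C"
  obtain V \<kappa> W \<psi> where q: "Q = V \<times> W" "\<theta> = map_prod \<kappa> \<psi>" "(V, \<kappa>) \<in> B" "(W, \<psi>) \<in> C"
    using Q by (auto simp: prod_atlas_def)
  define S where "S = \<phi> ` (U \<inter> (F -` V \<inter> H -` W))"
  have "open (U \<inter> (F -` V \<inter> H -` W))"
    using open_chartsD(1)[OF A U] open_chartsD(1)[OF B q(3)] open_chartsD(1)[OF C q(4)]
      smooth_mapD(2)[OF F] smooth_mapD(2)[OF H] by (simp add: open_Int)
  then have oS: "open S" using A U unfolding S_def open_charts_def by auto
  have "smooth_on S (\<lambda>z. \<kappa> (F (inv_into U \<phi> z)))" "smooth_on S (\<lambda>z. \<psi> (H (inv_into U \<phi> z)))"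
    by (rule smooth_on_subset[OF _ smooth_mapD(3)[OF F U q(3)]], auto simp: S_def)
       (rule smooth_on_subset[OF _ smooth_mapD(3)[OF H U q(4)]], auto simp: S_def)
  then have "smooth_on S (\<lambda>z. (\<kappa> (F (inv_into U \<phi> z)), \<psi> (H (inv_into U \<phi> z))))"
    by (rule smooth_on_Pair[OF oS])
  moreover have "U \<inter> (\<lambda>x. (F x, H x)) -` (V \<times> W) = U \<inter> (F -` V \<inter> H -` W)" by auto
  ultimately show "smooth_on (\<phi> ` (U \<inter> (\<lambda>x. (F x, H x)) -` Q)) (\<lambda>z. \<theta> (F (inv_into U \<phi> z), H (inv_into U \<phi> z)))"
    using q by (simp add: S_def)
qed

lemma smooth_map_id: "smooth_atlas A \<Longrightarrow> smooth_map A A (\<lambda>x. x)"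
  by (auto simp: smooth_map_def smooth_atlas_def o_def)

lemma smooth_map_const:
  assumes A: "open_charts A" shows "smooth_map A B (\<lambda>x. y)"
proof -
  have "smooth_on S (\<psi> \<circ> (\<lambda>x. y) \<circ> inv_into U \<phi>)" for S U \<phi> \<psi>
    by (simp add: o_def smooth_on_def Ck_on_const)
  then show ?thesis by (auto simp: smooth_map_def)
qed

lemma smooth_map_euclidean: "smooth_map euclidean_atlas euclidean_atlas f \<longleftrightarrow> smooth_on UNIV f"
proof -
  have "smooth_on UNIV f \<Longrightarrow> continuous_on UNIV f"
    unfolding smooth_on_def using Ck_on.simps(1) by metis
  then show ?thesis
    by (auto simp: smooth_map_def euclidean_atlas_def)
qed

lemma smooth_on_linear: "linear f \<Longrightarrow> smooth_on S f"
  by (simp add: smooth_on_def Ck_on_linear)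

lemma smooth_on_const: "smooth_on S (\<lambda>x. c)"
  by (simp add: smooth_on_def Ck_on_const)

lemma smooth_on_imp_differentiable: "smooth_on S f \<Longrightarrow> x \<in> S \<Longrightarrow> f differentiable (at x)"
  unfolding smooth_on_def using Ck_on.simps(2)[of 0 f S] by metis

lemma smooth_on_imp_continuous: "smooth_on S f \<Longrightarrow> continuous_on S f"
  unfolding smooth_on_def using Ck_on.simps(1)[of f S] by metis

section \<open>Integral curves and the exponential map\<close>

lemma Ck_on_Suc0_lipschitz:
  fixes F :: "'a::euclidean_space \<Rightarrow> 'b::euclidean_space"
  assumes "Ck_on (Suc 0) F UNIV"
  obtains K where "K \<ge> 0" "\<And>x y. x \<in> cball 0 R \<Longrightarrow> y \<in> cball 0 R \<Longrightarrow> norm (F x - F y) \<le> K * norm (x - y)"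
proof -
  define N where "N x = (\<Sum>b\<in>Basis. norm (frechet_derivative F (at x) b))" for x
  have d: "(F has_derivative frechet_derivative F (at x)) (at x)" for x
    using assms by (simp add: frechet_derivative_works)
  have "continuous_on UNIV N"
    unfolding N_def using assms by (intro continuous_on_sum continuous_on_norm) simp
  then have "compact (N ` cball 0 R)"
    using compact_continuous_image continuous_on_subset by (metis compact_cball subset_UNIV)
  then obtain K where K: "\<And>x. x \<in> cball 0 R \<Longrightarrow> N x \<le> K"
    using compact_imp_bounded bounded_real by (metis (mono_tags, lifting) abs_le_D1 imageI)
  have bnd: "onorm (frechet_derivative F (at x)) \<le> max K 0" if "x \<in> cball 0 R" for x
  proof (rule onorm_le)
    fix h
    let ?f = "frechet_derivative F (at x)"
    have "?f h = ?f (\<Sum>b\<in>Basis. (h \<bullet> b) *\<^sub>R b)" by (simp add: euclidean_representation)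
    also have "\<dots> = (\<Sum>b\<in>Basis. (h \<bullet> b) *\<^sub>R ?f b)"
      using has_derivative_linear[OF d] by (simp add: linear_sum linear_scale)
    also have "norm \<dots> \<le> (\<Sum>b\<in>Basis. norm h * norm (?f b))"
      by (rule sum_norm_le) (simp add: Basis_le_norm mult_right_mono)
    also have "\<dots> = N x * norm h" by (simp add: N_def sum_distrib_left mult.commute)
    also have "\<dots> \<le> max K 0 * norm h" using K[OF that] by (intro mult_right_mono) auto
    finally show "norm (?f h) \<le> max K 0 * norm h" .
  qed
  have "norm (F x - F y) \<le> max K 0 * norm (x - y)" if "x \<in> cball 0 R" "y \<in> cball 0 R" for x y
    using differentiable_bound[OF convex_cball has_derivative_at_withinI[OF d] bnd that(2,1)]
    by (simp add: norm_minus_commute)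
  then show ?thesis by (intro that[of "max K 0"]) auto
qed

text \<open>Gronwall's argument: with a Lipschitz constant \<open>K\<close> on a ball containing both paths, \<open>exp (- 2 K t)\<close> times the
  squared distance is nonincreasing.\<close>
lemma ode_unique_forward:
  fixes y z :: "real \<Rightarrow> 'a::euclidean_space"
  assumes F: "Ck_on (Suc 0) F UNIV"
    and y: "\<And>t. (y has_vector_derivative F (y t)) (at t)"
    and z: "\<And>t. (z has_vector_derivative F (z t)) (at t)"
    and 0: "y 0 = z 0" and T: "0 \<le> T"
  shows "y T = z T"
proof -
  have cy: "continuous_on S y" and cz: "continuous_on S z" for S
    using y z by (auto intro!: continuous_at_imp_continuous_on has_vector_derivative_continuous)
  have "bounded (y ` {0..T} \<union> z ` {0..T})"
    using compact_continuous_image[OF cy, of "{0..T}"] compact_continuous_image[OF cz, of "{0..T}"]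
    by (simp add: compact_imp_bounded)
  then obtain R where "\<forall>x\<in>y ` {0..T} \<union> z ` {0..T}. norm x \<le> R"
    by (auto simp only: bounded_iff)
  then have R: "y t \<in> cball 0 R \<and> z t \<in> cball 0 R" if "t \<in> {0..T}" for t
    using that by auto
  obtain K where K: "\<And>x y. x \<in> cball 0 R \<Longrightarrow> y \<in> cball 0 R \<Longrightarrow> norm (F x - F y) \<le> K * norm (x - y)"
    using Ck_on_Suc0_lipschitz[OF F] by metis
  define e where "e t = exp (- 2 * K * t) * ((y t - z t) \<bullet> (y t - z t))" for t
  have de: "(e has_real_derivative
      exp (- 2 * K * t) * (2 * ((y t - z t) \<bullet> (F (y t) - F (z t))))
      + exp (- 2 * K * t) * (- 2 * K) * ((y t - z t) \<bullet> (y t - z t))) (at t)" for t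
  proof -
    have i: "((\<lambda>t. (y t - z t) \<bullet> (y t - z t)) has_real_derivative 2 * ((y t - z t) \<bullet> (F (y t) - F (z t)))) (at t)"
      unfolding has_real_derivative_iff_has_vector_derivative has_vector_derivative_def
      by (rule has_derivative_eq_rhs, rule has_derivative_inner)
         (use has_vector_derivative_diff[OF y z] in \<open>auto simp: has_vector_derivative_def inner_commute algebra_simps\<close>)
    show ?thesis unfolding e_def
      by (rule DERIV_cong, rule DERIV_mult[OF _ i]) (auto intro!: derivative_eq_intros)
  qed
  have "e T \<le> e 0"
  proof (rule DERIV_nonpos_imp_nonincreasing[OF T])
    fix t assume t: "0 \<le> t" "t \<le> T"
    have "(y t - z t) \<bullet> (F (y t) - F (z t)) \<le> norm (y t - z t) * norm (F (y t) - F (z t))"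
      by (rule norm_cauchy_schwarz)
    also have "\<dots> \<le> norm (y t - z t) * (K * norm (y t - z t))"
      using R K t by (intro mult_left_mono) auto
    also have "\<dots> = K * ((y t - z t) \<bullet> (y t - z t))"
      by (simp add: dot_square_norm power2_eq_square)
    finally have "exp (- 2 * K * t) * (2 * ((y t - z t) \<bullet> (F (y t) - F (z t))))
        \<le> exp (- 2 * K * t) * (2 * (K * ((y t - z t) \<bullet> (y t - z t))))"
      by (intro mult_left_mono) auto
    then show "\<exists>D. (e has_real_derivative D) (at t) \<and> D \<le> 0"
      using de by (intro exI conjI, blast) (simp add: algebra_simps)
  qed
  then have "(y T - z T) \<bullet> (y T - z T) \<le> 0"
    by (simp add: e_def 0 mult_le_0_iff not_le)
  then have "(y T - z T) \<bullet> (y T - z T) = 0"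
    by (intro antisym inner_ge_zero)
  then show ?thesis by simp
qed

lemma ode_unique:
  fixes y z :: "real \<Rightarrow> 'a::euclidean_space"
  assumes F: "Ck_on (Suc 0) F UNIV"
    and y: "\<And>t. (y has_vector_derivative F (y t)) (at t)"
    and z: "\<And>t. (z has_vector_derivative F (z t)) (at t)"
    and 0: "y 0 = z 0"
  shows "y = z"
proof
  fix t
  have r: "((\<lambda>t. x (- t)) has_vector_derivative - F (x (- t))) (at t)"
    if "\<And>t. (x has_vector_derivative F (x t)) (at t)" for x t
    using vector_diff_chain_at[of uminus "-1" t x, OF _ that]
    by (simp add: o_def has_vector_derivative_minus)
  show "y t = z t"
  proof (cases "0 \<le> t")
    case True
    then show ?thesis using ode_unique_forward[OF F y z 0] by simp
  next
    case False
    have "Ck_on (Suc 0) (\<lambda>x. - F x) UNIV"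
      by (rule Ck_on_linear_comp[OF open_UNIV _ F]) (simp add: linear_uminus)
    from ode_unique_forward[OF this r[OF y] r[OF z], of "-t"] 0 False show ?thesis by simp
  qed
qed

context carnot_group
begin

abbreviation Exp :: "'v \<Rightarrow> 'g" where "Exp \<equiv> lie_exp G"
abbreviation Log :: "'g \<Rightarrow> 'v" where "Log \<equiv> inv_into UNIV (lie_exp G)"

lemma bij_Exp: "bij Exp" using exp_diffeo by (simp add: diffeo_def)
lemma Log_Exp [simp]: "Log (Exp x) = x" using bij_Exp by (simp add: bij_is_inj)
lemma Exp_Log [simp]: "Exp (Log g) = g" using bij_Exp by (simp add: bij_is_surj surj_f_inv_f)
lemma Exp_eq_iff [simp]: "Exp x = Exp y \<longleftrightarrow> x = y" using Log_Exp by metis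

lemma carrier [simp]: "x \<in> carrier G" by (simp add: carrier_UNIV)

lemma charts: "open_charts (atlas G)" by (rule open_charts_smooth_atlas[OF atlas])

lemma smooth_Exp: "smooth_map euclidean_atlas (atlas G) Exp"
  and smooth_Log: "smooth_map (atlas G) euclidean_atlas Log"
  using exp_diffeo by (simp_all add: diffeo_def)

lemma continuous_Exp: "continuous_on S Exp" and continuous_Log: "continuous_on T Log"
  using smooth_mapD(1)[OF smooth_Exp] smooth_mapD(1)[OF smooth_Log] continuous_on_subset subset_UNIV by blast+

lemma smooth_map_mult:
  assumes "open_charts C" "smooth_map C (atlas G) F" "smooth_map C (atlas G) H"
  shows "smooth_map C (atlas G) (\<lambda>x. F x \<otimes> H x)"
  using smooth_map_compose[OF assms(1) open_charts_prod[OF charts charts] charts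
      smooth_map_Pair[OF assms(1) charts charts assms(2,3)] smooth_mult] by simp

lemma continuous_mult:
  assumes "continuous_on S f" "continuous_on S h"
  shows "continuous_on S (\<lambda>x. f x \<otimes> h x)"
proof -
  have "continuous_on UNIV (\<lambda>(x, y). x \<otimes> y)" using smooth_mapD(1)[OF smooth_mult] .
  from continuous_on_compose2[OF this continuous_on_Pair[OF assms]] show ?thesis by simp
qed

lemma smooth_fun_left:
  assumes "smooth_fun G f" shows "smooth_fun G (\<lambda>x. f (y \<otimes> x))"
  using assms smooth_map_compose[OF charts charts open_charts_euclidean
      smooth_map_mult[OF charts smooth_map_const[OF charts] smooth_map_id[OF atlas]]]
  by (simp add: smooth_fun_def)

lemma smooth_fun_Log: "smooth_fun G (\<lambda>g. Log g \<bullet> b)"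
proof -
  have "smooth_map euclidean_atlas euclidean_atlas (\<lambda>x::'v. x \<bullet> b)"
    unfolding smooth_map_euclidean
    by (intro smooth_on_linear) (simp add: bounded_linear.linear bounded_linear_inner_left)
  from smooth_map_compose[OF charts open_charts_euclidean open_charts_euclidean smooth_Log this]
  show ?thesis by (simp add: smooth_fun_def)
qed

text \<open>The logarithm is a global chart, so smoothness of maps between Euclidean spaces through the group can be
  expressed without charts.\<close>
lemma smooth_on_chart:
  fixes F :: "'e::euclidean_space \<Rightarrow> 'g"
  assumes "smooth_map euclidean_atlas (atlas G) F" "smooth_fun G f"
  shows "smooth_on UNIV (\<lambda>x. f (F x))"
  using smooth_map_compose[OF open_charts_euclidean charts open_charts_euclidean assms(1) assms(2)[unfolded smooth_fun_def]]
  by (simp add: smooth_map_euclidean)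

lemma smooth_on_Log_chart:
  fixes F :: "'e::euclidean_space \<Rightarrow> 'g"
  assumes "smooth_map euclidean_atlas (atlas G) F"
  shows "smooth_on UNIV (\<lambda>x. Log (F x))"
  using smooth_map_compose[OF open_charts_euclidean charts open_charts_euclidean assms smooth_Log]
  by (simp add: smooth_map_euclidean)

lemma smooth_Exp_comp:
  fixes h :: "'e::euclidean_space \<Rightarrow> 'v"
  assumes "smooth_on UNIV h"
  shows "smooth_map euclidean_atlas (atlas G) (\<lambda>x. Exp (h x))"
  using smooth_map_compose[OF open_charts_euclidean open_charts_euclidean charts _ smooth_Exp] assms
  by (simp add: smooth_map_euclidean)

lemma vfield_left_invariant: "vfield G X \<in> left_invariant_fields G"
  using vfield_bij by (auto simp: bij_betw_def)

lemma smooth_vfield: "smooth_fun G f \<Longrightarrow> smooth_fun G (vfield G X f)"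
  and vfield_left: "smooth_fun G f \<Longrightarrow> vfield G X (\<lambda>x. f (y \<otimes> x)) = (\<lambda>x. vfield G X f (y \<otimes> x))"
  and vfield_nonsmooth: "\<not> smooth_fun G f \<Longrightarrow> vfield G X f = (\<lambda>x. 0)"
  using vfield_left_invariant[of X] by (auto simp: left_invariant_fields_def)

lemma vfield_scale: "vfield G (a *\<^sub>R X) f x = a * vfield G X f x"
  using vfield_linear[of a X 0 0] by simp

definition icurve :: "'v \<Rightarrow> (real \<Rightarrow> 'g) \<Rightarrow> bool" where
  "icurve X \<gamma> \<longleftrightarrow> (\<forall>f t. smooth_fun G f \<longrightarrow>
     ((\<lambda>s. f (\<gamma> s)) has_real_derivative vfield G X f (\<gamma> t)) (at t))"

text \<open>In the chart \<open>Log\<close> an integral curve solves an autonomous differential equation with \<open>C\<^sup>1\<close> right-hand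
  side.\<close>
lemma icurve_unique:
  assumes "icurve X \<gamma>" "icurve X \<eta>" "\<gamma> 0 = \<eta> 0"
  shows "\<gamma> = \<eta>"
proof -
  define F where "F y = (\<Sum>b\<in>Basis. vfield G X (\<lambda>g. Log g \<bullet> b) (Exp y) *\<^sub>R b)" for y
  have "Ck_on (Suc 0) F UNIV"
    unfolding F_def
  proof (intro Ck_on_sum Ck_on_scaleR Ck_on_const open_UNIV)
    fix b :: 'v
    show "Ck_on (Suc 0) (\<lambda>x. vfield G X (\<lambda>g. Log g \<bullet> b) (Exp x)) UNIV"
      using smooth_on_chart[OF smooth_Exp smooth_vfield[OF smooth_fun_Log]] by (simp add: smooth_on_def del: Ck_on.simps)
  qed
  moreover have "((\<lambda>t. Log (c t)) has_vector_derivative F (Log (c t))) (at t)" if "icurve X c" for c t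
  proof -
    have "((\<lambda>t. Log (c t) \<bullet> b) has_real_derivative vfield G X (\<lambda>g. Log g \<bullet> b) (c t)) (at t)" for b
      using that smooth_fun_Log unfolding icurve_def by blast
    then have "((\<lambda>t. \<Sum>b\<in>Basis. (Log (c t) \<bullet> b) *\<^sub>R b) has_vector_derivative F (Log (c t))) (at t)"
      unfolding F_def Exp_Log
      by (intro has_vector_derivative_sum has_vector_derivative_scaleR[where g' = 0, simplified]) (auto)
    then show ?thesis by (simp add: euclidean_representation)
  qed
  ultimately have "(\<lambda>t. Log (\<gamma> t)) = (\<lambda>t. Log (\<eta> t))"
    using assms by (intro ode_unique[of F]) auto
  then show ?thesis by (metis Exp_Log ext)
qed

lemma icurve_scale:
  assumes "icurve X \<gamma>" shows "icurve (a *\<^sub>R X) (\<lambda>t. \<gamma> (a * t))"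
  unfolding icurve_def
proof (intro allI impI)
  fix f t assume "smooth_fun G f"
  then have "((\<lambda>s. f (\<gamma> s)) has_real_derivative vfield G X f (\<gamma> (a * t))) (at (a * t))"
    using assms by (simp add: icurve_def)
  moreover have "((\<lambda>t. a * t) has_real_derivative a) (at t)"
    by (auto intro!: derivative_eq_intros)
  ultimately have "((\<lambda>s. f (\<gamma> (a * s))) has_real_derivative vfield G X f (\<gamma> (a * t)) * a) (at t)"
    by (rule DERIV_chain2)
  then show "((\<lambda>s. f (\<gamma> (a * s))) has_real_derivative vfield G (a *\<^sub>R X) f (\<gamma> (a * t))) (at t)"
    by (simp add: vfield_scale mult.commute)
qed

lemma icurve_left:
  assumes "icurve X \<gamma>" shows "icurve X (\<lambda>t. y \<otimes> \<gamma> t)"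
  unfolding icurve_def
proof (intro allI impI)
  fix f t assume f: "smooth_fun G f"
  have "((\<lambda>s. f (y \<otimes> \<gamma> s)) has_real_derivative vfield G X (\<lambda>x. f (y \<otimes> x)) (\<gamma> t)) (at t)"
    using assms smooth_fun_left[OF f, of y] unfolding icurve_def by blast
  then show "((\<lambda>s. f (y \<otimes> \<gamma> s)) has_real_derivative vfield G X f (y \<otimes> \<gamma> t)) (at t)"
    by (simp add: vfield_left[OF f])
qed

lemma icurve_shift:
  assumes "icurve X \<gamma>" shows "icurve X (\<lambda>t. \<gamma> (s + t))"
  unfolding icurve_def
proof (intro allI impI)
  fix f t assume "smooth_fun G f"
  then have "((\<lambda>s. f (\<gamma> s)) has_real_derivative vfield G X f (\<gamma> (t + s))) (at (t + s))"
    using assms by (simp add: icurve_def)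
  then show "((\<lambda>t. f (\<gamma> (s + t))) has_real_derivative vfield G X f (\<gamma> (s + t))) (at t)"
    unfolding DERIV_shift by (simp add: add.commute)
qed

lemma Exp_icurve_eq:
  assumes "icurve X \<gamma>" "\<gamma> 0 = \<one>" shows "Exp X = \<gamma> 1"
proof -
  have "(THE \<gamma>. \<gamma> 0 = \<one> \<and> icurve X \<gamma>) = \<gamma>"
    using assms icurve_unique by (intro the_equality) auto
  then show ?thesis by (simp add: lie_exp_def icurve_def)
qed

text \<open>The definite description in \<open>lie_exp\<close> takes the same value for all vectors without an integral curve.
  If \<open>X\<close> were such a vector, so would be \<open>2X\<close>, and the two would have the same exponential, contrary to
  injectivity.\<close>
lemma icurve_exists: "\<exists>\<gamma>. \<gamma> 0 = \<one> \<and> icurve X \<gamma>"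
proof (rule ccontr)
  assume no: "\<not> ?thesis"
  have "icurve 0 (\<lambda>t. \<one>)"
    unfolding icurve_def using vfield_scale[of 0 0] by simp
  with no have "X \<noteq> 0" by auto
  have no2: "\<not> (\<exists>\<gamma>. \<gamma> 0 = \<one> \<and> icurve (2 *\<^sub>R X) \<gamma>)"
  proof safe
    fix \<gamma> :: "real \<Rightarrow> 'g" assume "\<gamma> 0 = \<one>" "icurve (2 *\<^sub>R X) \<gamma>"
    with icurve_scale[OF this(2), of "1/2"] no show False by auto
  qed
  have "(\<lambda>\<gamma>. \<gamma> 0 = \<one> \<and> icurve X \<gamma>) = (\<lambda>\<gamma>. \<gamma> 0 = \<one> \<and> icurve (2 *\<^sub>R X) \<gamma>)"
    using no no2 by auto
  then have "Exp X = Exp (2 *\<^sub>R X)"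
    by (simp add: lie_exp_def icurve_def)
  with \<open>X \<noteq> 0\<close> show False using scaleR_cancel_right[of 1 X 2] by simp
qed

lemma icurve_Exp: "icurve X (\<lambda>t. Exp (t *\<^sub>R X))" and Exp_0 [simp]: "Exp 0 = \<one>"
proof -
  obtain \<gamma> where g: "\<gamma> 0 = \<one>" "icurve X \<gamma>" using icurve_exists by auto
  have "Exp (t *\<^sub>R X) = \<gamma> t" for t
    using Exp_icurve_eq[OF icurve_scale[OF g(2), of t]] g(1) by simp
  then show "icurve X (\<lambda>t. Exp (t *\<^sub>R X))" using g by simp
  have "icurve 0 (\<lambda>t. \<one>)"
    unfolding icurve_def using vfield_scale[of 0 0] by simp
  then show "Exp 0 = \<one>" using Exp_icurve_eq by auto
qed

lemma Exp_add: "Exp ((s + t) *\<^sub>R X) = Exp (s *\<^sub>R X) \<otimes> Exp (t *\<^sub>R X)"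
  using icurve_unique[OF icurve_shift[OF icurve_Exp] icurve_left[OF icurve_Exp], of s X "Exp (s *\<^sub>R X)"]
  by (simp add: fun_eq_iff)

lemma inv_Exp: "inv (Exp x) = Exp (- x)"
  using Exp_add[of "-1" 1 x] by (intro inv_equality) auto

lemma Exp_deriv:
  assumes "smooth_fun G f"
  shows "((\<lambda>s. f (y \<otimes> Exp (s *\<^sub>R X))) has_real_derivative vfield G X f (y \<otimes> Exp (t *\<^sub>R X))) (at t)"
  using icurve_left[OF icurve_Exp] assms unfolding icurve_def by blast

end

section \<open>The adjoint representation\<close>

text \<open>By homogeneity the map equals its derivative at the origin.\<close>
lemma homogeneous_imp_linear:
  fixes a :: "'a::euclidean_space \<Rightarrow> 'b::euclidean_space"
  assumes hom: "\<And>t x. a (t *\<^sub>R x) = t *\<^sub>R a x" and d: "a differentiable (at 0)"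
  shows "linear a"
proof -
  obtain A where A: "(a has_derivative A) (at 0)" using d by (auto simp: differentiable_def)
  have "a x = A x" for x
  proof -
    have lA: "linear A" using A by (rule has_derivative_linear)
    have "((\<lambda>t. t *\<^sub>R x) has_derivative (\<lambda>t. t *\<^sub>R x)) (at 0)"
      by (auto intro!: derivative_eq_intros)
    then have "((\<lambda>t::real. a (t *\<^sub>R x)) has_derivative (\<lambda>t. A (t *\<^sub>R x))) (at 0)"
      using diff_chain_at[of "\<lambda>t. t *\<^sub>R x" "\<lambda>t. t *\<^sub>R x" 0 a A] A by (simp add: o_def)
    then have "((\<lambda>t::real. t *\<^sub>R a x) has_derivative (\<lambda>t. t *\<^sub>R A x)) (at 0)"
      by (simp add: hom linear_scale[OF lA])
    moreover have "((\<lambda>t::real. t *\<^sub>R a x) has_derivative (\<lambda>t. t *\<^sub>R a x)) (at 0)"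
      by (auto intro!: derivative_eq_intros)
    ultimately have "(\<lambda>t::real. t *\<^sub>R A x) = (\<lambda>t. t *\<^sub>R a x)"
      by (rule has_derivative_unique)
    from fun_cong[OF this, of 1] show ?thesis by simp
  qed
  then have "a = A" by auto
  then show ?thesis using A has_derivative_linear by blast
qed

context carnot_group
begin

lemma Exp_pow: "Exp (real n *\<^sub>R x) = Exp x [^] n"
proof (induction n)
  case (Suc n)
  then show ?case using Exp_add[of "real n" 1 x] by (simp add: add.commute)
qed simp

text \<open>Roots are unique because the exponential map is injective, so a continuous one-parameter subgroup
  agrees with an exponential at rational times, hence everywhere.\<close>
lemma one_parameter_subgroup:
  assumes add: "\<And>s t. h (s + t) = h s \<otimes> h t" and cont: "continuous_on UNIV h"
  shows "h t = Exp (t *\<^sub>R Log (h 1))"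
proof -
  define w where "w = Log (h 1)"
  have h0: "h 0 = \<one>" using add[of 0 0] by (metis add_0 carrier l_cancel_one')
  have pow: "h (real n * t) = h t [^] n" for n t
  proof (induction n)
    case (Suc n)
    have "h (real (Suc n) * t) = h (real n * t) \<otimes> h t"
      using add[of "real n * t" t] by (simp add: algebra_simps)
    then show ?case using Suc by simp
  qed (simp add: h0)
  have rt: "h (t / real n) = Exp ((1 / real n) *\<^sub>R Log (h t))" if "n > 0" for n t
  proof -
    have "Exp (real n *\<^sub>R Log (h (t / real n))) = h t"
      using pow[of n "t / real n"] that by (simp add: Exp_pow)
    then have "real n *\<^sub>R Log (h (t / real n)) = Log (h t)" by (metis Log_Exp)
    then have "Log (h (t / real n)) = (1 / real n) *\<^sub>R Log (h t)" using that by (metis inverse_eq_divide less_numeral_extra(3) of_nat_eq_0_iff pth_5 scaleR_one left_inverse)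
    then show ?thesis by (metis Exp_Log)
  qed
  have nat: "h (real m) = Exp (real m *\<^sub>R w)" for m
    using pow[of m 1] by (simp add: Exp_pow w_def)
  have frac: "h (real m / real n) = Exp ((real m / real n) *\<^sub>R w)" if "n > 0" for m n
    using rt[OF that, of "real m"] by (simp add: nat)
  have neg: "h (- t) = inv (h t)" for t
    using add[of "-t" t] h0 by (intro inv_equality[symmetric]) auto
  have rat: "h q = Exp (q *\<^sub>R w)" if q: "q \<in> \<rat>" for q
  proof -
    obtain m n where mn: "n \<noteq> 0" "\<bar>q\<bar> = real m / real n"
      by (rule Rats_abs_nat_div_natE[OF q])
    then have *: "h \<bar>q\<bar> = Exp (\<bar>q\<bar> *\<^sub>R w)" using frac by simp
    show ?thesis
    proof (cases "q \<ge> 0")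
      case True
      then show ?thesis using * by simp
    next
      case False
      then show ?thesis using * neg[of "-q"] by (simp add: inv_Exp)
    qed
  qed
  have "closed {t. Log (h t) = t *\<^sub>R w}"
    by (intro closed_Collect_eq continuous_on_compose2[OF continuous_Log cont] continuous_intros) auto
  then have "closure \<rat> \<subseteq> {t. Log (h t) = t *\<^sub>R w}"
    using rat by (intro closure_minimal) auto
  then have "Log (h t) = t *\<^sub>R w" using Rats_closure_real by auto
  then have "h t = Exp (t *\<^sub>R w)" by (metis Exp_Log)
  then show ?thesis by (simp add: w_def)
qed

text \<open>Conjugation by \<open>exp x\<close>, in exponential coordinates.\<close>
definition Ad :: "'v \<Rightarrow> 'v \<Rightarrow> 'v" where
  "Ad x y = Log (Exp x \<otimes> Exp y \<otimes> Exp (- x))"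

lemma Exp_Ad: "Exp (Ad x y) = Exp x \<otimes> Exp y \<otimes> Exp (- x)"
  by (simp add: Ad_def)

lemma Exp_minus [simp]: "Exp (- x) \<otimes> Exp x = \<one>" "Exp x \<otimes> Exp (- x) = \<one>"
  using inv_Exp[of x] l_inv[of "Exp x"] r_inv[of "Exp x"] by simp_all

lemma Exp_minus_cancel [simp]: "Exp (- x) \<otimes> (Exp x \<otimes> g) = g" "Exp x \<otimes> (Exp (- x) \<otimes> g) = g"
  by (simp_all add: m_assoc[symmetric])

lemma Exp_Ad_commute: "Exp x \<otimes> Exp y = Exp (Ad x y) \<otimes> Exp x"
  by (simp add: Exp_Ad m_assoc)

lemma smooth_Ad: "smooth_on UNIV (\<lambda>p. Ad (fst p) (snd p))"
  unfolding Ad_def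
proof (intro smooth_on_Log_chart smooth_map_mult open_charts_euclidean smooth_Exp_comp smooth_on_linear)
  show "linear (\<lambda>x. - fst x)" by (intro linearI) auto
qed (simp_all add: linear_fst linear_snd)

lemma smooth_Ad_comp:
  assumes "smooth_on UNIV f" "smooth_on UNIV h"
  shows "smooth_on UNIV (\<lambda>x. Ad (f x) (h x))"
  using smooth_on_compose[OF open_UNIV open_UNIV _ smooth_on_Pair[OF open_UNIV assms] smooth_Ad] by simp

text \<open>Conjugation maps one-parameter subgroups to one-parameter subgroups, which are rays in exponential
  coordinates; so \<open>Ad x\<close> is homogeneous, and it is smooth.\<close>
lemma linear_Ad: "linear (Ad x)"
proof (rule homogeneous_imp_linear)
  have sm: "smooth_on UNIV (Ad x)"
    by (intro smooth_Ad_comp smooth_on_const smooth_on_linear) (simp add: linear_ident)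
  then show "Ad x differentiable (at 0)" by (rule smooth_on_imp_differentiable) simp
  fix t y
  have "Exp (Ad x (t *\<^sub>R y)) = Exp (t *\<^sub>R Log (Exp (Ad x (1 *\<^sub>R y))))"
  proof (rule one_parameter_subgroup[of "\<lambda>t. Exp (Ad x (t *\<^sub>R y))"])
    show "Exp (Ad x ((s + t) *\<^sub>R y)) = Exp (Ad x (s *\<^sub>R y)) \<otimes> Exp (Ad x (t *\<^sub>R y))" for s t
      by (simp add: Exp_Ad Exp_add m_assoc)
    show "continuous_on UNIV (\<lambda>t. Exp (Ad x (t *\<^sub>R y)))"
      by (intro continuous_on_compose2[OF continuous_Exp] continuous_on_compose2[OF smooth_on_imp_continuous[OF sm]]
          continuous_intros) auto
  qed
  then show "Ad x (t *\<^sub>R y) = t *\<^sub>R Ad x y" by simp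
qed

lemma Ad_add: "Ad ((s + t) *\<^sub>R x) y = Ad (s *\<^sub>R x) (Ad (t *\<^sub>R x) y)"
proof -
  have "Exp (Ad ((s + t) *\<^sub>R x) y) = Exp (s *\<^sub>R x) \<otimes> Exp (t *\<^sub>R x) \<otimes> Exp y \<otimes> Exp ((- t) *\<^sub>R x) \<otimes> Exp ((- s) *\<^sub>R x)"
    using Exp_add[of s t x] Exp_add[of "-t" "-s" x] by (simp add: Exp_Ad m_assoc algebra_simps)
  also have "\<dots> = Exp (Ad (s *\<^sub>R x) (Ad (t *\<^sub>R x) y))"
    by (simp add: Exp_Ad m_assoc)
  finally show ?thesis by simp
qed

lemma Ad_0 [simp]: "Ad 0 y = y" by (simp add: Ad_def)

text \<open>This turns out to be the Lie bracket; a definition by conjugation gives access to one-parameter groups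
  of linear maps.\<close>
definition ad :: "'v \<Rightarrow> 'v \<Rightarrow> 'v" where
  "ad x y = vector_derivative (\<lambda>s. Ad (s *\<^sub>R x) y) (at 0)"

lemma Ad_vector_derivative_0: "((\<lambda>s. Ad (s *\<^sub>R x) y) has_vector_derivative ad x y) (at 0)"
proof -
  have "smooth_on UNIV (\<lambda>s. Ad (s *\<^sub>R x) y)"
    by (intro smooth_Ad_comp smooth_on_const smooth_on_linear linearI) (auto simp: algebra_simps)
  then have "(\<lambda>s. Ad (s *\<^sub>R x) y) differentiable (at 0)"
    by (rule smooth_on_imp_differentiable) simp
  then show ?thesis unfolding ad_def by (simp add: vector_derivative_works)
qed

lemma Ad_vector_derivative: "((\<lambda>s. Ad (s *\<^sub>R x) y) has_vector_derivative Ad (t *\<^sub>R x) (ad x y)) (at t)"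
proof -
  have "bounded_linear (Ad (t *\<^sub>R x))" using linear_Ad linear_conv_bounded_linear by blast
  from bounded_linear.has_vector_derivative[OF this Ad_vector_derivative_0]
  have "((\<lambda>s. Ad (t *\<^sub>R x) (Ad (s *\<^sub>R x) y)) has_vector_derivative Ad (t *\<^sub>R x) (ad x y)) (at 0)" .
  then have "((\<lambda>s. Ad ((t + s) *\<^sub>R x) y) has_vector_derivative Ad (t *\<^sub>R x) (ad x y)) (at (t - t))"
    by (simp add: Ad_add)
  from this[unfolded has_vector_derivative_def]
  have "((\<lambda>s. Ad ((t + s) *\<^sub>R x) y) \<circ> (\<lambda>s. s - t) has_derivative (\<lambda>r. r *\<^sub>R Ad (t *\<^sub>R x) (ad x y)) \<circ> (\<lambda>r. r)) (at t)"
    by (intro diff_chain_at[rotated]) (auto intro!: derivative_eq_intros)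
  then show ?thesis by (simp add: has_vector_derivative_def o_def)
qed

lemma Ad_eq_self: assumes "ad x y = 0" shows "Ad (t *\<^sub>R x) y = y"
proof -
  have 0: "Ad (s *\<^sub>R x) 0 = 0" for s using linear_Ad linear_0 by blast
  have "((\<lambda>s. Ad (s *\<^sub>R x) y) has_derivative (\<lambda>h. 0)) (at s within UNIV)" for s
    using Ad_vector_derivative[of x y s] assms by (simp add: has_vector_derivative_def 0)
  then have "Ad (t *\<^sub>R x) y = Ad (0 *\<^sub>R x) y"
    by (intro has_derivative_zero_unique[of UNIV]) auto
  then show ?thesis by simp
qed

text \<open>The derivative of \<open>s \<mapsto> Ad(sx) y\<close> is \<open>Ad(sx) [x, y]\<close>, which is constant when \<open>[x, [x, y]] = 0\<close>.\<close>
lemma Ad_eq_affine: assumes "ad x (ad x y) = 0" shows "Ad (t *\<^sub>R x) y = y + t *\<^sub>R ad x y"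
proof -
  have "((\<lambda>s. Ad (s *\<^sub>R x) y - s *\<^sub>R ad x y) has_derivative (\<lambda>h. 0)) (at s within UNIV)" for s
  proof -
    have "((\<lambda>s. Ad (s *\<^sub>R x) y - s *\<^sub>R ad x y) has_vector_derivative ad x y - ad x y) (at s)"
      using Ad_vector_derivative[of x y s] Ad_eq_self[OF assms]
      by (intro has_vector_derivative_diff) (auto intro!: derivative_eq_intros)
    then show ?thesis by (simp add: has_vector_derivative_def)
  qed
  then have "Ad (t *\<^sub>R x) y - t *\<^sub>R ad x y = Ad (0 *\<^sub>R x) y - 0 *\<^sub>R ad x y"
    by (intro has_derivative_zero_unique[of UNIV "\<lambda>s. Ad (s *\<^sub>R x) y - s *\<^sub>R ad x y"]) auto
  then show ?thesis by (simp add: algebra_simps)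
qed

end

section \<open>The Lie bracket as infinitesimal adjoint action\<close>

text \<open>The mean value theorem, applied in \<open>t\<close> and then in \<open>s\<close>.\<close>
lemma mixed_difference_tendsto:
  fixes \<Phi> :: "real \<Rightarrow> real \<Rightarrow> real"
  assumes 1: "\<And>s t. ((\<lambda>t. \<Phi> s t) has_real_derivative \<phi> s t) (at t)"
    and 2: "\<And>s t. ((\<lambda>s. \<phi> s t) has_real_derivative \<phi>' s t) (at s)"
    and c: "continuous_on UNIV (\<lambda>p. \<phi>' (fst p) (snd p))"
  shows "((\<lambda>s. (\<Phi> s s - \<Phi> s 0 - \<Phi> 0 s + \<Phi> 0 0) / s\<^sup>2) \<longlongrightarrow> \<phi>' 0 0) (at_right 0)"
proof -
  have "\<exists>\<sigma> \<tau>. 0 < \<sigma> \<and> \<sigma> < s \<and> 0 < \<tau> \<and> \<tau> < s \<and> (\<Phi> s s - \<Phi> s 0 - \<Phi> 0 s + \<Phi> 0 0) / s\<^sup>2 = \<phi>' \<sigma> \<tau>"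
    if s: "0 < s" for s
  proof -
    have "((\<lambda>t. \<Phi> s t - \<Phi> 0 t) has_real_derivative \<phi> s t - \<phi> 0 t) (at t)" for t
      by (intro DERIV_diff 1)
    from MVT2[of 0 s, OF s this] obtain \<tau> where \<tau>: "0 < \<tau>" "\<tau> < s"
      "(\<Phi> s s - \<Phi> 0 s) - (\<Phi> s 0 - \<Phi> 0 0) = (s - 0) * (\<phi> s \<tau> - \<phi> 0 \<tau>)" by blast
    from MVT2[of 0 s "\<lambda>s. \<phi> s \<tau>", OF s 2] obtain \<sigma> where \<sigma>: "0 < \<sigma>" "\<sigma> < s"
      "\<phi> s \<tau> - \<phi> 0 \<tau> = (s - 0) * \<phi>' \<sigma> \<tau>" by blast
    have "\<Phi> s s - \<Phi> s 0 - \<Phi> 0 s + \<Phi> 0 0 = s\<^sup>2 * \<phi>' \<sigma> \<tau>"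
      using \<tau>(3) \<sigma>(3) by (simp add: power2_eq_square)
    then show ?thesis using s \<tau> \<sigma> by (intro exI[of _ \<sigma>] exI[of _ \<tau>]) simp
  qed
  then obtain \<sigma> \<tau> where st: "\<And>s. 0 < s \<Longrightarrow> 0 < \<sigma> s \<and> \<sigma> s < s \<and> 0 < \<tau> s \<and> \<tau> s < s \<and>
      (\<Phi> s s - \<Phi> s 0 - \<Phi> 0 s + \<Phi> 0 0) / s\<^sup>2 = \<phi>' (\<sigma> s) (\<tau> s)"
    by metis
  have id: "((\<lambda>s::real. s) \<longlongrightarrow> 0) (at_right 0)" by (rule tendsto_ident_at)
  have ev: "eventually (\<lambda>s::real. 0 < s) (at_right 0)" by (simp add: eventually_at_right_less)
  have "(\<sigma> \<longlongrightarrow> 0) (at_right 0)" "(\<tau> \<longlongrightarrow> 0) (at_right 0)"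
    by (rule tendsto_sandwich[OF _ _ tendsto_const id]; rule eventually_mono[OF ev]; use st less_imp_le in blast)+
  then have "((\<lambda>s. (\<sigma> s, \<tau> s)) \<longlongrightarrow> (0, 0)) (at_right 0)" by (rule tendsto_Pair)
  then have "((\<lambda>s. \<phi>' (\<sigma> s) (\<tau> s)) \<longlongrightarrow> \<phi>' 0 0) (at_right 0)"
    using continuous_on_tendsto_compose[OF c] by fastforce
  then show ?thesis
    by (rule Lim_transform_eventually) (rule eventually_mono[OF ev], use st in auto)
qed

context carnot_group
begin

text \<open>The order of the two derivations on the right is the order of the two factors on the left, so the
  difference of this limit and the one with \<open>x\<close> and \<open>z\<close> exchanged is the bracket of the two fields.\<close>
lemma mult_Exp_difference_tendsto:
  assumes f: "smooth_fun G f"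
  shows "((\<lambda>s. (f (Exp (s *\<^sub>R x) \<otimes> Exp (s *\<^sub>R z)) - f (Exp (s *\<^sub>R x)) - f (Exp (s *\<^sub>R z)) + f \<one>) / s\<^sup>2)
    \<longlongrightarrow> vfield G x (vfield G z f) \<one>) (at_right 0)"
proof -
  define k where "k = vfield G z f"
  have k: "smooth_fun G k" unfolding k_def by (rule smooth_vfield[OF f])
  define K where "K p = k (Exp (fst p *\<^sub>R x) \<otimes> Exp (snd p *\<^sub>R z))" for p :: "real \<times> real"
  have sK: "smooth_on UNIV K"
    unfolding K_def
    by (intro smooth_on_chart[OF _ k] smooth_map_mult open_charts_euclidean smooth_Exp_comp smooth_on_linear linearI)
       (auto simp: algebra_simps)
  then have dK: "(K has_derivative frechet_derivative K (at p)) (at p)" for p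
    using smooth_on_imp_differentiable frechet_derivative_works by blast
  define \<phi>' where "\<phi>' s t = frechet_derivative K (at (s, t)) (1, 0)" for s t
  have d1: "((\<lambda>s. k (Exp (s *\<^sub>R x) \<otimes> Exp (t *\<^sub>R z))) has_real_derivative \<phi>' s t) (at s)" for s t
  proof -
    have l: "linear (frechet_derivative K (at (s, t)))" by (rule has_derivative_linear[OF dK])
    have "((\<lambda>s. (s, t)) has_derivative (\<lambda>h. (h, 0))) (at s)" by (auto intro!: derivative_eq_intros)
    from diff_chain_at[OF this dK]
    have "((\<lambda>s. K (s, t)) has_derivative (\<lambda>h. frechet_derivative K (at (s, t)) (h, 0))) (at s)" by (simp add: o_def)
    moreover have "frechet_derivative K (at (s, t)) (h, 0) = \<phi>' s t * h" for h
      using linear_scale[OF l, of h "(1, 0)"] by (simp add: \<phi>'_def)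
    ultimately show ?thesis by (simp add: has_field_derivative_def K_def)
  qed
  have "((\<lambda>s. (f (Exp (s *\<^sub>R x) \<otimes> Exp (s *\<^sub>R z)) - f (Exp (s *\<^sub>R x) \<otimes> Exp (0 *\<^sub>R z))
      - f (Exp (0 *\<^sub>R x) \<otimes> Exp (s *\<^sub>R z)) + f (Exp (0 *\<^sub>R x) \<otimes> Exp (0 *\<^sub>R z))) / s\<^sup>2) \<longlongrightarrow> \<phi>' 0 0) (at_right 0)"
  proof (rule mixed_difference_tendsto[of "\<lambda>s t. f (Exp (s *\<^sub>R x) \<otimes> Exp (t *\<^sub>R z))" _ \<phi>', OF Exp_deriv[OF f]])
    show "((\<lambda>s. vfield G z f (Exp (s *\<^sub>R x) \<otimes> Exp (t *\<^sub>R z))) has_real_derivative \<phi>' s t) (at s)" for s t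
      using d1 by (simp add: k_def)
    have "(1, 0) \<in> (Basis :: (real \<times> real) set)" by (simp add: Basis_prod_def)
    moreover have "Ck_on (Suc 0) K UNIV" using sK unfolding smooth_on_def by blast
    ultimately show "continuous_on UNIV (\<lambda>p. \<phi>' (fst p) (snd p))"
      unfolding \<phi>'_def by simp
  qed
  moreover have "\<phi>' 0 0 = vfield G x k \<one>"
    using d1[of 0 0] Exp_deriv[OF k, of \<one> x 0] by (intro DERIV_unique[of "\<lambda>s. k (Exp (s *\<^sub>R x))" _ 0]) simp_all
  ultimately show ?thesis by (simp add: k_def)
qed

text \<open>The same difference seen through conjugation: \<open>exp(sx)exp(sz) = exp(s Ad(sx) z)exp(sx)\<close>, where
  \<open>s Ad(sx) z - sz\<close> is \<open>s\<^sup>2 ad x z\<close> to second order.\<close>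
lemma commutator_difference_tendsto:
  assumes f: "smooth_fun G f"
  shows "((\<lambda>s. (f (Exp (s *\<^sub>R x) \<otimes> Exp (s *\<^sub>R z)) - f (Exp (s *\<^sub>R z) \<otimes> Exp (s *\<^sub>R x))) / s\<^sup>2)
    \<longlongrightarrow> vfield G (ad x z) f \<one>) (at_right 0)"
proof -
  define N where "N p = f (Exp (fst p) \<otimes> Exp (snd p *\<^sub>R x))" for p :: "'v \<times> real"
  have sN: "smooth_on UNIV N"
    unfolding N_def
    by (intro smooth_on_chart[OF _ f] smooth_map_mult open_charts_euclidean smooth_Exp_comp smooth_on_linear linearI)
       (auto simp: algebra_simps)
  then have dN: "(N has_derivative frechet_derivative N (at p)) (at p)" for p
    using smooth_on_imp_differentiable frechet_derivative_works by blast
  define Q where "Q q = (\<Sum>b\<in>Basis. (snd q \<bullet> b) * frechet_derivative N (at (fst q)) (b, 0))"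
    for q :: "('v \<times> real) \<times> 'v"
  have Q: "frechet_derivative N (at p) (w, 0) = Q (p, w)" for p w
  proof -
    have l: "linear (\<lambda>w. frechet_derivative N (at p) (w, 0))"
      by (rule linear_compose[of "\<lambda>w. (w, 0)", OF _ has_derivative_linear[OF dN], unfolded o_def]) (auto intro: linearI)
    have "frechet_derivative N (at p) (w, 0) = frechet_derivative N (at p) (\<Sum>b\<in>Basis. (w \<bullet> b) *\<^sub>R b, 0)"
      by (simp add: euclidean_representation)
    also have "\<dots> = (\<Sum>b\<in>Basis. (w \<bullet> b) *\<^sub>R frechet_derivative N (at p) (b, 0))"
      by (subst linear_sum[OF l]) (simp add: linear_scale[OF l])
    finally show ?thesis by (simp add: Q_def)
  qed
  have cQ: "continuous_on UNIV Q"
    unfolding Q_def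
  proof (intro continuous_on_sum continuous_on_mult)
    fix b :: 'v assume "b \<in> Basis"
    then have "(b, 0) \<in> (Basis :: ('v \<times> real) set)" by (simp add: Basis_prod_def)
    moreover have "Ck_on (Suc 0) N UNIV" using sN unfolding smooth_on_def by blast
    ultimately have "continuous_on UNIV (\<lambda>p. frechet_derivative N (at p) (b, 0))" by simp
    then show "continuous_on UNIV (\<lambda>q::('v \<times> real) \<times> 'v. frechet_derivative N (at (fst q)) (b, 0))"
      by (rule continuous_on_compose2) (auto intro: continuous_intros)
  qed (intro continuous_intros)
  \<comment> \<open>The quotient \<open>W s\<close> tends to \<open>ad x z\<close>, and \<open>s Ad(sx) z = sz + s\<^sup>2 W s\<close>.\<close>
  define W where "W s = (1 / s) *\<^sub>R (Ad (s *\<^sub>R x) z - z)" for s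
  have mvt: "\<exists>\<zeta>. norm \<zeta> \<le> s * (norm z + s * norm (W s)) \<and>
      (f (Exp (s *\<^sub>R x) \<otimes> Exp (s *\<^sub>R z)) - f (Exp (s *\<^sub>R z) \<otimes> Exp (s *\<^sub>R x))) / s\<^sup>2 = Q ((\<zeta>, s), W s)"
    if s: "0 < s" for s
  proof -
    have AW: "Ad (s *\<^sub>R x) z = z + s *\<^sub>R W s" using s by (simp add: W_def)
    define q where "q r = N (s *\<^sub>R z + r *\<^sub>R (s\<^sup>2 *\<^sub>R W s), s)" for r
    have dq: "(q has_real_derivative s\<^sup>2 * Q ((s *\<^sub>R z + r *\<^sub>R (s\<^sup>2 *\<^sub>R W s), s), W s)) (at r)" for r
    proof -
      let ?p = "(s *\<^sub>R z + r *\<^sub>R (s\<^sup>2 *\<^sub>R W s), s)"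
      have l: "linear (frechet_derivative N (at ?p))" by (rule has_derivative_linear[OF dN])
      have "((\<lambda>r. (s *\<^sub>R z + r *\<^sub>R (s\<^sup>2 *\<^sub>R W s), s)) has_derivative (\<lambda>h. (h *\<^sub>R (s\<^sup>2 *\<^sub>R W s), 0))) (at r)"
        by (auto intro!: derivative_eq_intros)
      from diff_chain_at[OF this dN]
      have "(q has_derivative (\<lambda>h. frechet_derivative N (at ?p) (h *\<^sub>R (s\<^sup>2 *\<^sub>R W s), 0))) (at r)"
        by (simp add: o_def q_def[abs_def])
      moreover have "frechet_derivative N (at ?p) (h *\<^sub>R (s\<^sup>2 *\<^sub>R W s), 0) = s\<^sup>2 * Q (?p, W s) * h" for h
        using linear_scale[OF l, of "h * s\<^sup>2" "(W s, 0)"] by (simp add: Q mult.commute)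
      ultimately show ?thesis by (simp add: has_field_derivative_def)
    qed
    obtain r where r: "0 < r" "r < 1" "q 1 - q 0 = (1 - 0) * (s\<^sup>2 * Q ((s *\<^sub>R z + r *\<^sub>R (s\<^sup>2 *\<^sub>R W s), s), W s))"
      using MVT2[of 0 1 q, OF _ dq] by auto
    have "s *\<^sub>R z + s\<^sup>2 *\<^sub>R W s = Ad (s *\<^sub>R x) (s *\<^sub>R z)"
      by (simp add: linear_scale[OF linear_Ad] AW scaleR_add_right power2_eq_square)
    then have "q 1 = f (Exp (s *\<^sub>R x) \<otimes> Exp (s *\<^sub>R z))"
      unfolding Exp_Ad_commute[of "s *\<^sub>R x" "s *\<^sub>R z"] by (simp add: q_def N_def)
    moreover have "q 0 = f (Exp (s *\<^sub>R z) \<otimes> Exp (s *\<^sub>R x))" by (simp add: q_def N_def)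
    moreover have "norm (s *\<^sub>R z + r *\<^sub>R (s\<^sup>2 *\<^sub>R W s)) \<le> s * (norm z + s * norm (W s))"
    proof -
      have "norm (s *\<^sub>R z + r *\<^sub>R (s\<^sup>2 *\<^sub>R W s)) \<le> s * norm z + r * (s\<^sup>2 * norm (W s))"
        using norm_triangle_ineq[of "s *\<^sub>R z" "r *\<^sub>R (s\<^sup>2 *\<^sub>R W s)"] s r by simp
      also have "\<dots> \<le> s * norm z + 1 * (s\<^sup>2 * norm (W s))"
        using r by (intro add_left_mono mult_right_mono) auto
      finally show ?thesis by (simp add: algebra_simps power2_eq_square)
    qed
    ultimately show ?thesis using r s by (intro exI[of _ "s *\<^sub>R z + r *\<^sub>R (s\<^sup>2 *\<^sub>R W s)"]) simp
  qed
  then obtain \<zeta> where \<zeta>: "\<And>s. 0 < s \<Longrightarrow> norm (\<zeta> s) \<le> s * (norm z + s * norm (W s)) \<and>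
      (f (Exp (s *\<^sub>R x) \<otimes> Exp (s *\<^sub>R z)) - f (Exp (s *\<^sub>R z) \<otimes> Exp (s *\<^sub>R x))) / s\<^sup>2 = Q ((\<zeta> s, s), W s)"
    by metis
  have ev: "eventually (\<lambda>s::real. 0 < s) (at_right 0)" by (simp add: eventually_at_right_less)
  have id: "((\<lambda>s::real. s) \<longlongrightarrow> 0) (at_right 0)" by (rule tendsto_ident_at)
  have "((\<lambda>h. norm (Ad (h *\<^sub>R x) z - z - h *\<^sub>R ad x z) / norm h) \<longlongrightarrow> 0) (at 0)"
    using Ad_vector_derivative_0[of x z] by (simp add: has_vector_derivative_def has_derivative_at)
  then have "((\<lambda>s. norm (W s - ad x z)) \<longlongrightarrow> 0) (at 0)"
  proof (rule Lim_transform_eventually)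
    show "eventually (\<lambda>h. norm (Ad (h *\<^sub>R x) z - z - h *\<^sub>R ad x z) / norm h = norm (W h - ad x z)) (at 0)"
    proof (rule eventually_at_topological[THEN iffD2], intro exI[of _ UNIV] conjI ballI impI)
      fix h :: real assume h: "h \<noteq> 0"
      have "W h - ad x z = (1 / h) *\<^sub>R (Ad (h *\<^sub>R x) z - z - h *\<^sub>R ad x z)"
        using h by (simp add: W_def scaleR_diff_right)
      then show "norm (Ad (h *\<^sub>R x) z - z - h *\<^sub>R ad x z) / norm h = norm (W h - ad x z)"
        by simp
    qed auto
  qed
  then have "(W \<longlongrightarrow> ad x z) (at 0)"
    by (rule LIM_zero_cancel[OF tendsto_norm_zero_cancel])
  then have W: "(W \<longlongrightarrow> ad x z) (at_right 0)" by (rule tendsto_within_subset) simp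
  have "((\<lambda>s. s * (norm z + s * norm (W s))) \<longlongrightarrow> 0 * (norm z + 0 * norm (ad x z))) (at_right 0)"
    by (intro tendsto_intros id W)
  then have "(\<zeta> \<longlongrightarrow> 0) (at_right 0)"
    by (intro Lim_null_comparison[of \<zeta> "\<lambda>s. s * (norm z + s * norm (W s))"] eventually_mono[OF ev]) (use \<zeta> in auto)
  then have "((\<lambda>s. ((\<zeta> s, s), W s)) \<longlongrightarrow> ((0, 0), ad x z)) (at_right 0)"
    by (intro tendsto_Pair id W)
  then have "((\<lambda>s. Q ((\<zeta> s, s), W s)) \<longlongrightarrow> Q ((0, 0), ad x z)) (at_right 0)"
    using continuous_on_tendsto_compose[OF cQ] by fastforce
  then have lim: "((\<lambda>s. (f (Exp (s *\<^sub>R x) \<otimes> Exp (s *\<^sub>R z)) - f (Exp (s *\<^sub>R z) \<otimes> Exp (s *\<^sub>R x))) / s\<^sup>2)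
    \<longlongrightarrow> Q ((0, 0), ad x z)) (at_right 0)"
    by (rule Lim_transform_eventually) (rule eventually_mono[OF ev], use \<zeta> in auto)
  have "Q ((0, 0), w) = vfield G w f \<one>" for w
  proof -
    have l: "linear (frechet_derivative N (at 0))" by (rule has_derivative_linear[OF dN])
    have "((\<lambda>t. (t *\<^sub>R w, 0::real)) has_derivative (\<lambda>t. (t *\<^sub>R w, 0))) (at 0)"
      by (auto intro!: derivative_eq_intros)
    then have "((\<lambda>t. N (t *\<^sub>R w, 0)) has_derivative (\<lambda>t. frechet_derivative N (at 0) (t *\<^sub>R w, 0))) (at 0)"
      using diff_chain_at[of "\<lambda>t. (t *\<^sub>R w, 0)" "\<lambda>t. (t *\<^sub>R w, 0)" 0 N] dN[of 0] by (simp add: o_def zero_prod_def)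
    moreover have "frechet_derivative N (at 0) (t *\<^sub>R w, 0) = Q ((0, 0), w) * t" for t
      using linear_scale[OF l, of t "(w, 0)"] Q[of 0 w] by (simp add: mult.commute zero_prod_def)
    ultimately have "((\<lambda>t. f (Exp (t *\<^sub>R w))) has_real_derivative Q ((0, 0), w)) (at 0)"
      by (simp add: has_field_derivative_def N_def)
    then show ?thesis
      using Exp_deriv[OF f, of \<one> w 0] by (intro DERIV_unique[of "\<lambda>s. f (Exp (s *\<^sub>R w))" _ 0]) simp_all
  qed
  with lim show ?thesis by simp
qed

lemma vfield_ad_one:
  assumes f: "smooth_fun G f"
  shows "vfield G (ad x z) f \<one> = vfield G x (vfield G z f) \<one> - vfield G z (vfield G x f) \<one>"
proof (rule tendsto_unique[OF _ commutator_difference_tendsto[OF f]])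
  from tendsto_diff[OF mult_Exp_difference_tendsto[OF f, of x z] mult_Exp_difference_tendsto[OF f, of z x]]
  show "((\<lambda>s. (f (Exp (s *\<^sub>R x) \<otimes> Exp (s *\<^sub>R z)) - f (Exp (s *\<^sub>R z) \<otimes> Exp (s *\<^sub>R x))) / s\<^sup>2)
    \<longlongrightarrow> vfield G x (vfield G z f) \<one> - vfield G z (vfield G x f) \<one>) (at_right 0)"
    by (simp add: diff_divide_distrib[symmetric] algebra_simps)
qed simp

text \<open>Both sides commute with left translations, so the identity at the unit suffices.\<close>
lemma vfield_ad:
  assumes f: "smooth_fun G f"
  shows "vfield G (ad x z) f = (\<lambda>g. vfield G x (vfield G z f) g - vfield G z (vfield G x f) g)"
proof
  fix y
  have "vfield G (ad x z) f (y \<otimes> \<one>) = vfield G x (vfield G z f) (y \<otimes> \<one>) - vfield G z (vfield G x f) (y \<otimes> \<one>)"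
    using vfield_ad_one[OF smooth_fun_left[OF f, of y], of x z]
    by (simp add: vfield_left f smooth_vfield)
  then show "vfield G (ad x z) f y = vfield G x (vfield G z f) y - vfield G z (vfield G x f) y" by simp
qed

lemma vfield_eqI:
  assumes "\<And>f. smooth_fun G f \<Longrightarrow> vfield G X f = vfield G Y f" shows "X = Y"
proof -
  have "vfield G X f = vfield G Y f" for f
    using assms vfield_nonsmooth by (cases "smooth_fun G f") auto
  then have "vfield G X = vfield G Y" by (rule ext)
  moreover have "inj (vfield G)" using vfield_bij by (simp add: bij_betw_def)
  ultimately show ?thesis by (simp add: inj_eq)
qed

lemma lie_bracket_eq_ad: "lie_bracket G x z = ad x z"
  unfolding lie_bracket_def
proof (rule the_equality)
  fix Z assume "\<forall>f. smooth_fun G f \<longrightarrow> vfield G Z f = (\<lambda>g. vfield G x (vfield G z f) g - vfield G z (vfield G x f) g)"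
  then show "Z = ad x z" by (intro vfield_eqI) (simp add: vfield_ad)
qed (simp add: vfield_ad)

lemma ad_skew: "ad z x = - ad x z"
proof (rule vfield_eqI)
  fix f assume "smooth_fun G f"
  then show "vfield G (ad z x) f = vfield G (- ad x z) f"
    using vfield_scale[of "-1" "ad x z" f] by (auto simp: vfield_ad)
qed

lemma linear_ad: "linear (ad x)"
proof (rule linearI)
  have "((\<lambda>s. Ad (s *\<^sub>R x) y + Ad (s *\<^sub>R x) z) has_vector_derivative ad x y + ad x z) (at 0)" for y z
    by (intro has_vector_derivative_add Ad_vector_derivative_0)
  then have "((\<lambda>s. Ad (s *\<^sub>R x) (y + z)) has_vector_derivative ad x y + ad x z) (at 0)" for y z
    by (simp add: linear_add[OF linear_Ad])
  then show "ad x (y + z) = ad x y + ad x z" for y z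
    using vector_derivative_at unfolding ad_def by blast
  have "((\<lambda>s. a *\<^sub>R Ad (s *\<^sub>R x) y) has_vector_derivative a *\<^sub>R ad x y) (at 0)" for a y
    using Ad_vector_derivative_0 by (auto intro!: derivative_eq_intros)
  then have "((\<lambda>s. Ad (s *\<^sub>R x) (a *\<^sub>R y)) has_vector_derivative a *\<^sub>R ad x y) (at 0)" for a y
    by (simp add: linear_scale[OF linear_Ad])
  then show "ad x (a *\<^sub>R y) = a *\<^sub>R ad x y" for a y
    using vector_derivative_at unfolding ad_def by blast
qed

lemma linear_ad_left: "linear (\<lambda>x. ad x y)"
proof -
  have "linear (\<lambda>x. - ad y x)" using linear_ad linear_compose_neg by blast
  then show ?thesis by (simp add: ad_skew[of _ y])
qed

lemma subspace_V1: "subspace (layer G 1)"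
  using layer_subspace[of 1] step_pos by simp

text \<open>The product of two elements near the identity is, to first order, the sum of their logarithms.\<close>
lemma Log_mult_derivative:
  assumes a: "(a has_vector_derivative a') (at 0)" "a 0 = 0" and b: "(b has_vector_derivative b') (at 0)" "b 0 = 0"
  shows "((\<lambda>t. Log (Exp (a t) \<otimes> Exp (b t))) has_vector_derivative a' + b') (at 0)"
proof -
  define M where "M p = Log (Exp (fst p) \<otimes> Exp (snd p))" for p
  have "smooth_on UNIV M"
    unfolding M_def
    by (intro smooth_on_Log_chart smooth_map_mult open_charts_euclidean smooth_Exp_comp smooth_on_linear)
       (simp_all add: linear_fst linear_snd)
  then obtain A where A: "(M has_derivative A) (at 0)"
    using smooth_on_imp_differentiable unfolding differentiable_def by blast
  have l: "linear A" by (rule has_derivative_linear[OF A])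
  have A1: "A (h, 0) = h" for h
  proof -
    have "((\<lambda>h. (h, 0)) has_derivative (\<lambda>h. (h, 0))) (at (0::'v))" by (auto intro!: derivative_eq_intros)
    from diff_chain_at[OF this, of M A] A have "((\<lambda>h. M (h, 0)) has_derivative (\<lambda>h. A (h, 0))) (at 0)"
      by (simp add: o_def zero_prod_def)
    then have "((\<lambda>h. h) has_derivative (\<lambda>h. A (h, 0))) (at 0)" by (simp add: M_def)
    from has_derivative_unique[OF this has_derivative_ident] show ?thesis by metis
  qed
  have A2: "A (0, h) = h" for h
  proof -
    have "((\<lambda>h. (0, h)) has_derivative (\<lambda>h. (0, h))) (at (0::'v))" by (auto intro!: derivative_eq_intros)
    from diff_chain_at[OF this, of M A] A have "((\<lambda>h. M (0, h)) has_derivative (\<lambda>h. A (0, h))) (at 0)"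
      by (simp add: o_def zero_prod_def)
    then have "((\<lambda>h. h) has_derivative (\<lambda>h. A (0, h))) (at 0)" by (simp add: M_def)
    from has_derivative_unique[OF this has_derivative_ident] show ?thesis by metis
  qed
  have A12: "A (h, k) = h + k" for h k
    using linear_add[OF l, of "(h, 0)" "(0, k)"] A1 A2 by simp
  have "((\<lambda>t. (a t, b t)) has_derivative (\<lambda>h. (h *\<^sub>R a', h *\<^sub>R b'))) (at 0)"
    using a b unfolding has_vector_derivative_def by (intro has_derivative_Pair)
  from diff_chain_at[OF this, of M A] A a b
  have "((\<lambda>t. M (a t, b t)) has_derivative (\<lambda>h. A (h *\<^sub>R a', h *\<^sub>R b'))) (at 0)"
    by (simp add: o_def zero_prod_def)
  then show ?thesis by (simp add: has_vector_derivative_def A12 M_def scaleR_add_right)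
qed

end

section \<open>Carnot groups of step at most two\<close>

locale carnot_group_step_le_2 = carnot_group G
  for G :: "('g::{t2_space, second_countable_topology}, 'v::euclidean_space) stratified_struct" (structure) +
  assumes step_le_2: "step G \<le> 2"
begin

lemma Log_one [simp]: "Log \<one> = 0"
  using Log_Exp[of 0] by simp

text \<open>This is the second layer in step two and \<open>{0}\<close> in step one, so both cases can be treated together.\<close>
definition V2 :: "'v set" where
  "V2 = span {ad x y | x y. x \<in> layer G 1 \<and> y \<in> layer G 1}"

lemma ad_V2: "x \<in> layer G 1 \<Longrightarrow> y \<in> layer G 1 \<Longrightarrow> ad x y \<in> V2"
  unfolding V2_def by (rule span_base) blast

lemma subspace_V2: "subspace V2" by (simp add: V2_def)

lemma step_cases: obtains "step G = 1" | "step G = 2"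
  using step_pos step_le_2 by linarith

lemma V2_step1: "step G = 1 \<Longrightarrow> V2 = {0}"
proof -
  assume s: "step G = 1"
  have "{ad x y | x y. x \<in> layer G 1 \<and> y \<in> layer G 1} \<subseteq> {0}"
    using top_bracket s by (auto simp: lie_bracket_eq_ad)
  then have "V2 \<subseteq> {0}" unfolding V2_def by (intro span_minimal subspace_single_0)
  then show ?thesis using subspace_0[OF subspace_V2] by auto
qed

lemma V2_step2: "step G = 2 \<Longrightarrow> V2 = layer G 2"
  using layer_bracket[of 1] by (simp add: V2_def lie_bracket_eq_ad numeral_2_eq_2)

lemma ad_central: assumes "x \<in> layer G 1" "z \<in> V2" shows "ad x z = 0"
proof (cases rule: step_cases)
  case 1
  then show ?thesis using assms V2_step1 linear_0[OF linear_ad] by auto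
next
  case 2
  then show ?thesis using assms V2_step2 top_bracket[of x z] by (simp add: lie_bracket_eq_ad)
qed

lemma V1_orth_V2: assumes "x \<in> layer G 1" "z \<in> V2" shows "x \<bullet> z = 0"
proof (cases rule: step_cases)
  case 1
  then show ?thesis using assms V2_step1 by auto
next
  case 2
  then show ?thesis using assms V2_step2 layer_orthogonal[of 1 2 x z] by simp
qed

lemma decomp: obtains x z where "x \<in> layer G 1" "z \<in> V2" "v = x + z"
proof -
  obtain w where w: "\<forall>j\<in>{1..step G}. w j \<in> layer G j" "v = (\<Sum>j=1..step G. w j)"
    using direct_sum[of v] by blast
  show ?thesis
  proof (cases rule: step_cases)
    case 1
    then show ?thesis using w that[of "w 1" 0] subspace_0[OF subspace_V2] by simp
  next
    case 2
    have "{1..2::nat} = {1, 2}" by auto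
    then show ?thesis using 2 w that[of "w 1" "w 2"] V2_step2 by simp
  qed
qed

lemma Exp_commute_iff: "Exp x \<otimes> Exp y = Exp y \<otimes> Exp x \<longleftrightarrow> Ad x y = y"
proof -
  have "Exp x \<otimes> Exp y = Exp y \<otimes> Exp x \<longleftrightarrow> Exp (Ad x y) \<otimes> Exp x = Exp y \<otimes> Exp x"
    by (subst Exp_Ad_commute) simp
  also have "\<dots> \<longleftrightarrow> Ad x y = y" by simp
  finally show ?thesis .
qed

lemma V1_V2_commute:
  assumes "x \<in> layer G 1" "z \<in> V2" shows "Exp x \<otimes> Exp z = Exp z \<otimes> Exp x"
  using Ad_eq_self[OF ad_central[OF assms], of 1] by (simp add: Exp_commute_iff)

text \<open>The product of two commuting one-parameter subgroups is one, with initial velocity \<open>x + y\<close>.\<close>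
lemma Exp_add_of_commute:
  assumes cc: "\<And>s t. Exp (s *\<^sub>R x) \<otimes> Exp (t *\<^sub>R y) = Exp (t *\<^sub>R y) \<otimes> Exp (s *\<^sub>R x)"
  shows "Exp (x + y) = Exp x \<otimes> Exp y"
proof -
  define w where "w = Log (Exp x \<otimes> Exp y)"
  have w: "Exp (t *\<^sub>R x) \<otimes> Exp (t *\<^sub>R y) = Exp (t *\<^sub>R w)" for t
  proof -
    have "Exp (t *\<^sub>R x) \<otimes> Exp (t *\<^sub>R y) = Exp (t *\<^sub>R Log (Exp (1 *\<^sub>R x) \<otimes> Exp (1 *\<^sub>R y)))"
    proof (rule one_parameter_subgroup[of "\<lambda>t. Exp (t *\<^sub>R x) \<otimes> Exp (t *\<^sub>R y)"])
      fix s t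
      have "Exp (s *\<^sub>R x) \<otimes> Exp (t *\<^sub>R x) \<otimes> (Exp (s *\<^sub>R y) \<otimes> Exp (t *\<^sub>R y)) =
        Exp (s *\<^sub>R x) \<otimes> (Exp (t *\<^sub>R x) \<otimes> Exp (s *\<^sub>R y)) \<otimes> Exp (t *\<^sub>R y)"
        by (simp add: m_assoc)
      then show "Exp ((s + t) *\<^sub>R x) \<otimes> Exp ((s + t) *\<^sub>R y) = Exp (s *\<^sub>R x) \<otimes> Exp (s *\<^sub>R y) \<otimes> (Exp (t *\<^sub>R x) \<otimes> Exp (t *\<^sub>R y))"
        unfolding cc[of t s] by (simp add: Exp_add m_assoc)
      show "continuous_on UNIV (\<lambda>t. Exp (t *\<^sub>R x) \<otimes> Exp (t *\<^sub>R y))"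
        by (intro continuous_mult continuous_on_compose2[OF continuous_Exp] continuous_intros) auto
    qed
    then show ?thesis by (simp add: w_def)
  qed
  have "((\<lambda>t. Log (Exp (t *\<^sub>R x) \<otimes> Exp (t *\<^sub>R y))) has_vector_derivative x + y) (at 0)"
    by (intro Log_mult_derivative) (auto intro!: derivative_eq_intros)
  then have "((\<lambda>t. t *\<^sub>R w) has_vector_derivative x + y) (at 0)" by (simp add: w)
  moreover have "((\<lambda>t. t *\<^sub>R w) has_vector_derivative w) (at 0)" by (auto intro!: derivative_eq_intros)
  ultimately have "w = x + y" by (rule vector_derivative_unique_at[symmetric])
  then show ?thesis using w[of 1] by simp
qed

lemma V2_scale: "z \<in> V2 \<Longrightarrow> t *\<^sub>R z \<in> V2" and V1_scale: "x \<in> layer G 1 \<Longrightarrow> t *\<^sub>R x \<in> layer G 1"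
  and V2_add: "z \<in> V2 \<Longrightarrow> z' \<in> V2 \<Longrightarrow> z + z' \<in> V2"
  and V1_add: "x \<in> layer G 1 \<Longrightarrow> x' \<in> layer G 1 \<Longrightarrow> x + x' \<in> layer G 1"
  using subspace_V2 subspace_V1 by (auto simp: subspace_def)

lemma Exp_V1_V2: "x \<in> layer G 1 \<Longrightarrow> z \<in> V2 \<Longrightarrow> Exp (x + z) = Exp x \<otimes> Exp z"
  by (intro Exp_add_of_commute V1_V2_commute V1_scale V2_scale)

lemma Exp_ad:
  assumes "x \<in> layer G 1" "y \<in> layer G 1"
  shows "Exp x \<otimes> Exp y = Exp y \<otimes> Exp (ad x y) \<otimes> Exp x"
proof -
  have "Ad x y = y + ad x y"
    using Ad_eq_affine[of x y 1] ad_central[OF assms(1) ad_V2[OF assms]] by simp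
  then show ?thesis
    by (subst Exp_Ad_commute) (simp add: Exp_V1_V2[OF assms(2) ad_V2[OF assms]])
qed

lemma Ad_mult:
  "Exp z \<otimes> (g \<otimes> h) \<otimes> Exp (- z) = (Exp z \<otimes> g \<otimes> Exp (- z)) \<otimes> (Exp z \<otimes> h \<otimes> Exp (- z))"
  by (simp add: m_assoc)

text \<open>The exponential of a bracket of two elements of the first layer is a group commutator of elements that
  commute with \<open>exp z\<close>. Linearity of \<open>Ad z\<close> extends this from the brackets to their span.\<close>
lemma V2_V2_commute:
  assumes z: "z \<in> V2" and z': "z' \<in> V2" shows "Exp z \<otimes> Exp z' = Exp z' \<otimes> Exp z"
proof -
  have "Ad z z' = z'" using z'[unfolded V2_def]
  proof (rule linear_eq_on_span[OF linear_Ad linear_ident, rotated])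
    fix w assume "w \<in> {ad x y | x y. x \<in> layer G 1 \<and> y \<in> layer G 1}"
    then obtain x y where xy: "w = ad x y" "x \<in> layer G 1" "y \<in> layer G 1" by auto
    have fix1: "Exp z \<otimes> Exp v \<otimes> Exp (- z) = Exp v" if "v \<in> layer G 1" for v
      using V1_V2_commute[OF that z, symmetric] by (simp add: m_assoc)
    have my: "- y \<in> layer G 1" "- x \<in> layer G 1" using xy V1_scale[of _ "-1"] by auto
    have e: "Exp w = Exp (- y) \<otimes> (Exp x \<otimes> (Exp y \<otimes> Exp (- x)))"
    proof -
      have "Exp (- y) \<otimes> (Exp x \<otimes> (Exp y \<otimes> Exp (- x))) = Exp (- y) \<otimes> ((Exp x \<otimes> Exp y) \<otimes> Exp (- x))"
        by (simp add: m_assoc)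
      also have "\<dots> = Exp w" unfolding Exp_ad[OF xy(2,3)] xy(1) by (simp add: m_assoc)
      finally show ?thesis by simp
    qed
    have "Exp z \<otimes> Exp w \<otimes> Exp (- z) = Exp w"
      unfolding e Ad_mult by (simp only: fix1 my xy)
    then show "Ad z w = w" by (simp add: Ad_def)
  qed
  then show ?thesis by (simp add: Exp_commute_iff)
qed

lemma Exp_V2_V2: "z \<in> V2 \<Longrightarrow> z' \<in> V2 \<Longrightarrow> Exp (z + z') = Exp z \<otimes> Exp z'"
  by (intro Exp_add_of_commute V2_V2_commute V2_scale)

lemma V2_central:
  assumes "z \<in> V2" shows "Exp z \<otimes> g = g \<otimes> Exp z"
proof -
  obtain x z' where v: "x \<in> layer G 1" "z' \<in> V2" "Log g = x + z'" using decomp by blast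
  then have g: "g = Exp x \<otimes> Exp z'" using Exp_V1_V2 by (metis Exp_Log)
  have "Exp z \<otimes> (Exp x \<otimes> Exp z') = (Exp x \<otimes> Exp z) \<otimes> Exp z'"
    using V1_V2_commute[OF v(1) assms] by (simp add: m_assoc[symmetric])
  also have "\<dots> = Exp x \<otimes> Exp z' \<otimes> Exp z"
    using V2_V2_commute[OF v(2) assms] by (simp add: m_assoc)
  finally show ?thesis unfolding g .
qed

lemma ad_scale: "ad (s *\<^sub>R x) y = s *\<^sub>R ad x y" "ad x (t *\<^sub>R y) = t *\<^sub>R ad x y"
  using linear_scale[OF linear_ad] linear_scale[OF linear_ad_left] by auto

lemma ad_self [simp]: "ad x x = 0"
proof -
  have "2 *\<^sub>R ad x x = 0"
    using ad_skew[of x x] by (simp add: scaleR_2 eq_neg_iff_add_eq_0)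
  then show ?thesis by simp
qed

text \<open>The Baker-Campbell-Hausdorff formula in step two. The correction by \<open>- r\<^sup>2/2 [x, y]\<close> turns the product of
  \<open>exp(rx)\<close> and \<open>exp(ry)\<close> into a one-parameter subgroup \<open>\<eta>\<close>, which is read off from its initial velocity.\<close>
lemma Exp_mult_V1:
  assumes x: "x \<in> layer G 1" and y: "y \<in> layer G 1"
  shows "Exp x \<otimes> Exp y = Exp (x + y + (1/2) *\<^sub>R ad x y)"
proof -
  define Z where "Z = ad x y"
  have Z: "Z \<in> V2" unfolding Z_def by (rule ad_V2[OF x y])
  define \<eta> where "\<eta> r = Exp (r *\<^sub>R x) \<otimes> Exp (r *\<^sub>R y) \<otimes> Exp ((- (r\<^sup>2) / 2) *\<^sub>R Z)" for r
  have swap: "Exp (r *\<^sub>R y) \<otimes> Exp (s *\<^sub>R x) = Exp (s *\<^sub>R x) \<otimes> Exp (r *\<^sub>R y) \<otimes> Exp (- (r * s) *\<^sub>R Z)" for r s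
  proof -
    have "ad (r *\<^sub>R y) (s *\<^sub>R x) = - (r * s) *\<^sub>R Z"
      using ad_skew[of y x] by (simp add: ad_scale Z_def)
    then have "Exp (r *\<^sub>R y) \<otimes> Exp (s *\<^sub>R x) = Exp (s *\<^sub>R x) \<otimes> Exp (- (r * s) *\<^sub>R Z) \<otimes> Exp (r *\<^sub>R y)"
      using Exp_ad[OF V1_scale[OF y, of r] V1_scale[OF x, of s]] by simp
    then show ?thesis using V2_central[OF V2_scale[OF Z], of "- (r * s)" "Exp (r *\<^sub>R y)"] by (simp add: m_assoc)
  qed
  have "\<eta> t = Exp (t *\<^sub>R Log (\<eta> 1))" for t
  proof (rule one_parameter_subgroup)
    fix s t
    have c: "Exp (a *\<^sub>R Z) \<otimes> g = g \<otimes> Exp (a *\<^sub>R Z)" for a g by (rule V2_central[OF V2_scale[OF Z]])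
    have cz: "Exp (a *\<^sub>R Z) \<otimes> (Exp (b *\<^sub>R Z) \<otimes> g) = Exp ((a + b) *\<^sub>R Z) \<otimes> g" for a b g
      by (simp add: Exp_add m_assoc)
    have "\<eta> s \<otimes> \<eta> t = Exp (s *\<^sub>R x) \<otimes> (Exp (s *\<^sub>R y) \<otimes> (Exp ((- (s\<^sup>2) / 2) *\<^sub>R Z) \<otimes> (Exp (t *\<^sub>R x) \<otimes> (Exp (t *\<^sub>R y) \<otimes> Exp ((- (t\<^sup>2) / 2) *\<^sub>R Z)))))"
      by (simp add: \<eta>_def m_assoc)
    also have "\<dots> = Exp (s *\<^sub>R x) \<otimes> ((Exp (s *\<^sub>R y) \<otimes> Exp (t *\<^sub>R x)) \<otimes> (Exp (t *\<^sub>R y) \<otimes> (Exp ((- (t\<^sup>2) / 2) *\<^sub>R Z) \<otimes> Exp ((- (s\<^sup>2) / 2) *\<^sub>R Z))))"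
      unfolding c[of "- (s\<^sup>2) / 2"] by (simp add: m_assoc)
    also have "\<dots> = Exp (s *\<^sub>R x) \<otimes> (Exp (t *\<^sub>R x) \<otimes> (Exp (s *\<^sub>R y) \<otimes> (Exp (- (s * t) *\<^sub>R Z) \<otimes> (Exp (t *\<^sub>R y) \<otimes> (Exp ((- (t\<^sup>2) / 2) *\<^sub>R Z) \<otimes> Exp ((- (s\<^sup>2) / 2) *\<^sub>R Z))))))"
      unfolding swap by (simp add: m_assoc)
    also have "\<dots> = Exp (s *\<^sub>R x) \<otimes> (Exp (t *\<^sub>R x) \<otimes> (Exp (s *\<^sub>R y) \<otimes> (Exp (t *\<^sub>R y) \<otimes> (Exp ((- (t\<^sup>2) / 2) *\<^sub>R Z) \<otimes> (Exp ((- (s\<^sup>2) / 2) *\<^sub>R Z) \<otimes> Exp (- (s * t) *\<^sub>R Z))))))"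
      unfolding c[of "- (s * t)"] by (simp add: m_assoc)
    also have "\<dots> = Exp ((s + t) *\<^sub>R x) \<otimes> (Exp ((s + t) *\<^sub>R y) \<otimes> Exp ((- (t\<^sup>2) / 2 + (- (s\<^sup>2) / 2 + - (s * t))) *\<^sub>R Z))"
      unfolding Exp_add by (simp add: m_assoc)
    also have "- (t\<^sup>2) / 2 + (- (s\<^sup>2) / 2 + - (s * t)) = - ((s + t)\<^sup>2) / 2"
      by (simp add: power2_eq_square field_simps)
    finally show "\<eta> (s + t) = \<eta> s \<otimes> \<eta> t" by (simp add: \<eta>_def m_assoc)
  next
    show "continuous_on UNIV \<eta>" unfolding \<eta>_def
      by (intro continuous_mult continuous_on_compose2[OF continuous_Exp] continuous_intros) auto
  qed
  then have L: "Log (\<eta> t) = t *\<^sub>R Log (\<eta> 1)" for t by (metis Log_Exp)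
  have "((\<lambda>t. Log (Exp (Log (Exp (t *\<^sub>R x) \<otimes> Exp (t *\<^sub>R y))) \<otimes> Exp ((- (t\<^sup>2) / 2) *\<^sub>R Z))) has_vector_derivative (x + y) + 0) (at 0)"
  proof (rule Log_mult_derivative)
    show "((\<lambda>t. Log (Exp (t *\<^sub>R x) \<otimes> Exp (t *\<^sub>R y))) has_vector_derivative x + y) (at 0)"
      by (intro Log_mult_derivative) (auto intro!: derivative_eq_intros)
    show "((\<lambda>t. (- (t\<^sup>2) / 2) *\<^sub>R Z) has_vector_derivative 0) (at 0)"
      by (auto intro!: derivative_eq_intros)
  qed auto
  then have "((\<lambda>t. Log (\<eta> t)) has_vector_derivative x + y) (at 0)" by (simp add: \<eta>_def)
  then have "((\<lambda>t. t *\<^sub>R Log (\<eta> 1)) has_vector_derivative x + y) (at 0)" by (subst (asm) L)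
  moreover have "((\<lambda>t. t *\<^sub>R Log (\<eta> 1)) has_vector_derivative Log (\<eta> 1)) (at 0)" by (auto intro!: derivative_eq_intros)
  ultimately have "Log (\<eta> 1) = x + y" by (rule vector_derivative_unique_at[symmetric])
  then have "Exp (x + y) = Exp x \<otimes> Exp y \<otimes> Exp ((- 1 / 2) *\<^sub>R Z)"
    by (metis Exp_Log \<eta>_def power_one scaleR_one)
  then have "Exp (x + y) \<otimes> Exp ((1/2) *\<^sub>R Z) = Exp x \<otimes> Exp y \<otimes> (Exp ((- 1 / 2) *\<^sub>R Z) \<otimes> Exp ((1/2) *\<^sub>R Z))"
    by (simp add: m_assoc)
  also have "Exp ((- 1 / 2) *\<^sub>R Z) \<otimes> Exp ((1/2) *\<^sub>R Z) = \<one>"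
    using Exp_add[of "-1/2" "1/2" Z] by simp
  finally show ?thesis
    using Exp_V1_V2[OF V1_add[OF x y] V2_scale[OF Z, of "1/2"]] by (simp add: Z_def)
qed

lemma Exp_mult:
  assumes "x \<in> layer G 1" "y \<in> layer G 1" "z \<in> V2" "w \<in> V2"
  shows "Exp (x + z) \<otimes> Exp (y + w) = Exp (x + y + (z + w + (1/2) *\<^sub>R ad x y))"
proof -
  have "Exp (x + z) \<otimes> Exp (y + w) = Exp x \<otimes> (Exp z \<otimes> Exp y) \<otimes> Exp w"
    using assms by (simp add: Exp_V1_V2 m_assoc)
  also have "\<dots> = (Exp x \<otimes> Exp y) \<otimes> (Exp z \<otimes> Exp w)"
    using V2_central[OF assms(3), of "Exp y"] by (simp add: m_assoc)
  also have "\<dots> = Exp (x + y) \<otimes> (Exp ((1/2) *\<^sub>R ad x y) \<otimes> Exp (z + w))"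
    using assms Exp_V1_V2[OF V1_add[OF assms(1,2)] V2_scale[OF ad_V2[OF assms(1,2)], of "1/2"]]
    by (simp add: Exp_mult_V1 Exp_V2_V2 m_assoc)
  also have "\<dots> = Exp (x + y) \<otimes> Exp ((1/2) *\<^sub>R ad x y + (z + w))"
    using assms by (simp add: Exp_V2_V2[OF V2_scale[OF ad_V2]] V2_add)
  also have "\<dots> = Exp (x + y + ((1/2) *\<^sub>R ad x y + (z + w)))"
    using assms by (intro Exp_V1_V2[symmetric] V1_add V2_add V2_scale ad_V2)
  finally show ?thesis by (simp add: algebra_simps)
qed

end

section \<open>Functions with supporting parabolas\<close>

text \<open>Adding \<open>\<kappa> t\<^sup>2\<close> turns the supporting parabolas into supporting lines.\<close>
lemma supporting_parabola_convex:
  fixes \<phi> m :: "real \<Rightarrow> real"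
  assumes I: "convex I"
    and sp: "\<And>s t. s \<in> I \<Longrightarrow> t \<in> I \<Longrightarrow> \<phi> t \<ge> \<phi> s + m s * (t - s) - \<kappa> * (t - s)\<^sup>2"
  shows "convex_on I (\<lambda>t. \<phi> t + \<kappa> * t\<^sup>2)"
proof (rule convex_onI)
  fix u x y :: real assume u: "u > 0" "u < 1" and xy: "x \<in> I" "y \<in> I"
  define z where "z = (1 - u) * x + u * y"
  have z: "z \<in> I" using convexD_alt[OF I xy, of u] u by (simp add: z_def)
  have "(1 - u) * (\<phi> z + m z * (x - z) - \<kappa> * (x - z)\<^sup>2) \<le> (1 - u) * \<phi> x"
    "u * (\<phi> z + m z * (y - z) - \<kappa> * (y - z)\<^sup>2) \<le> u * \<phi> y"
    using sp[OF z xy(1)] sp[OF z xy(2)] u by (auto intro!: mult_left_mono)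
  moreover have "(1 - u) * (\<phi> z + m z * (x - z) - \<kappa> * (x - z)\<^sup>2) + u * (\<phi> z + m z * (y - z) - \<kappa> * (y - z)\<^sup>2)
    = \<phi> z + \<kappa> * z\<^sup>2 - (1 - u) * (\<kappa> * x\<^sup>2) - u * (\<kappa> * y\<^sup>2)"
    unfolding z_def by (simp add: power2_eq_square algebra_simps)
  moreover have "(1 - u) *\<^sub>R x + u *\<^sub>R y = z" by (simp add: z_def)
  ultimately show "\<phi> ((1 - u) *\<^sub>R x + u *\<^sub>R y) + \<kappa> * ((1 - u) *\<^sub>R x + u *\<^sub>R y)\<^sup>2
      \<le> (1 - u) * (\<phi> x + \<kappa> * x\<^sup>2) + u * (\<phi> y + \<kappa> * y\<^sup>2)"
    unfolding distrib_left by simp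
qed (rule I)

lemma supporting_parabola_continuous:
  fixes \<phi> m :: "real \<Rightarrow> real"
  assumes I: "convex I" "open I" "s \<in> I"
    and sp: "\<And>s t. s \<in> I \<Longrightarrow> t \<in> I \<Longrightarrow> \<phi> t \<ge> \<phi> s + m s * (t - s) - \<kappa> * (t - s)\<^sup>2"
  shows "isCont \<phi> s"
proof -
  have "continuous_on I (\<lambda>t. \<phi> t + \<kappa> * t\<^sup>2)"
    by (rule convex_on_continuous[OF I(2) supporting_parabola_convex[OF I(1) sp]])
  then have "continuous_on I (\<lambda>t. (\<phi> t + \<kappa> * t\<^sup>2) - \<kappa> * t\<^sup>2)"
    by (rule continuous_on_diff) (intro continuous_intros)
  then show ?thesis using I by (simp add: continuous_on_eq_continuous_at)
qed

text \<open>The slopes of the supporting lines are monotone, and the derivative exists wherever they are continuous.\<close>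
lemma supporting_parabola_differentiable:
  fixes \<phi> m :: "real \<Rightarrow> real"
  assumes I: "open I"
    and sp: "\<And>s t. s \<in> I \<Longrightarrow> t \<in> I \<Longrightarrow> \<phi> t \<ge> \<phi> s + m s * (t - s) - \<kappa> * (t - s)\<^sup>2"
  shows "countable {s \<in> I. \<not> (\<exists>D. (\<phi> has_real_derivative D) (at s))}"
proof -
  define \<psi> where "\<psi> t = \<phi> t + \<kappa> * t\<^sup>2" for t
  define M where "M s = m s + 2 * \<kappa> * s" for s
  have supp: "\<psi> t \<ge> \<psi> s + M s * (t - s)" if "s \<in> I" "t \<in> I" for s t
    using sp[OF that] by (simp add: \<psi>_def M_def power2_eq_square algebra_simps)
  have "mono_on I M"
  proof (rule mono_onI)
    fix r s assume rs: "r \<in> I" "s \<in> I" "r \<le> s"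
    have "M r * (s - r) \<le> M s * (s - r)"
      using supp[OF rs(1,2)] supp[OF rs(2,1)] by (simp add: algebra_simps)
    then show "M r \<le> M s" using rs(3) by (cases "r = s") auto
  qed
  then have c: "countable {s \<in> I. \<not> isCont M s}" by (rule mono_on_ctble_discont_open[OF I])
  have "\<exists>D. (\<phi> has_real_derivative D) (at s)" if s: "s \<in> I" "isCont M s" for s
  proof -
    have "((\<lambda>t. (\<psi> t - \<psi> s) / (t - s) - M s) \<longlongrightarrow> 0) (at s)"
    proof (rule Lim_null_comparison[of _ "\<lambda>t. \<bar>M t - M s\<bar>"])
      have "eventually (\<lambda>t. t \<in> I \<and> t \<noteq> s) (at s)"
        using I s by (simp add: eventually_at_topological) blast
      then show "eventually (\<lambda>t. norm ((\<psi> t - \<psi> s) / (t - s) - M s) \<le> \<bar>M t - M s\<bar>) (at s)"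
      proof (rule eventually_mono)
        fix t assume t: "t \<in> I \<and> t \<noteq> s"
        have 1: "0 \<le> \<psi> t - \<psi> s - M s * (t - s)" "\<psi> t - \<psi> s - M s * (t - s) \<le> (M t - M s) * (t - s)"
          using supp[of s t] supp[of t s] s t by (auto simp: algebra_simps)
        have "norm ((\<psi> t - \<psi> s) / (t - s) - M s) = \<bar>\<psi> t - \<psi> s - M s * (t - s)\<bar> / \<bar>t - s\<bar>"
          using t by (simp add: field_simps flip: abs_divide)
        also have "\<dots> \<le> (\<bar>M t - M s\<bar> * \<bar>t - s\<bar>) / \<bar>t - s\<bar>"
          using 1 by (intro divide_right_mono) (auto simp flip: abs_mult)
        finally show "norm ((\<psi> t - \<psi> s) / (t - s) - M s) \<le> \<bar>M t - M s\<bar>" using t by simp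
      qed
      have "(M \<longlongrightarrow> M s) (at s)" using s by (simp add: isCont_def)
      then show "((\<lambda>t. \<bar>M t - M s\<bar>) \<longlongrightarrow> 0) (at s)"
        by (intro tendsto_rabs_zero LIM_zero)
    qed
    then have "(\<psi> has_real_derivative M s) (at s)"
      unfolding has_field_derivative_iff by (rule LIM_zero_cancel)
    then have "((\<lambda>t. \<psi> t - \<kappa> * t\<^sup>2) has_real_derivative M s - 2 * \<kappa> * s) (at s)"
      by (auto intro!: derivative_eq_intros)
    then show ?thesis by (auto simp: \<psi>_def)
  qed
  then show ?thesis by (intro countable_subset[OF _ c]) auto
qed

section \<open>Semiconvexity along horizontal lines of the Heisenberg group\<close>

text \<open>The point in the conclusion of \<open>support\<close> is the product \<open>(x, y, z)(a, b, 0)\<close> in the Heisenberg group. The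
  box has to contain the three generations of segments in \<open>bounded_above\<close>; its size is normalised by
  the dilations of the group.\<close>
locale heisenberg_semiconvex =
  fixes w :: "real \<Rightarrow> real \<Rightarrow> real \<Rightarrow> real" and \<kappa> :: real
  assumes kappa: "0 \<le> \<kappa>"
    and support: "\<And>x y z. \<bar>x\<bar> \<le> 4 \<Longrightarrow> \<bar>y\<bar> \<le> 4 \<Longrightarrow> \<bar>z\<bar> \<le> 4 \<Longrightarrow> \<exists>q\<^sub>1 q\<^sub>2. \<forall>a b.
      \<bar>x + a\<bar> \<le> 4 \<longrightarrow> \<bar>y + b\<bar> \<le> 4 \<longrightarrow> \<bar>z + (x * b - y * a) / 2\<bar> \<le> 4 \<longrightarrow>
      w x y z + q\<^sub>1 * a + q\<^sub>2 * b - \<kappa> * (a\<^sup>2 + b\<^sup>2) \<le> w (x + a) (y + b) (z + (x * b - y * a) / 2)"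
begin

text \<open>Convexity up to a quadratic along the horizontal segment through \<open>(x, y, z)\<close> in direction \<open>(a, b)\<close>:
  the linear terms of the support cancel in the weighted sum.\<close>
lemma segment:
  assumes "\<bar>x\<bar> \<le> 4" "\<bar>y\<bar> \<le> 4" "\<bar>z\<bar> \<le> 4"
    and st: "0 \<le> \<sigma>" "0 \<le> \<tau>"
    and P: "\<bar>x + \<tau> * a\<bar> \<le> 4" "\<bar>y + \<tau> * b\<bar> \<le> 4" "\<bar>z + \<tau> * ((x * b - y * a) / 2)\<bar> \<le> 4"
    and M: "\<bar>x - \<sigma> * a\<bar> \<le> 4" "\<bar>y - \<sigma> * b\<bar> \<le> 4" "\<bar>z - \<sigma> * ((x * b - y * a) / 2)\<bar> \<le> 4"
    and P_le: "w (x + \<tau> * a) (y + \<tau> * b) (z + \<tau> * ((x * b - y * a) / 2)) \<le> A"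
    and M_le: "w (x - \<sigma> * a) (y - \<sigma> * b) (z - \<sigma> * ((x * b - y * a) / 2)) \<le> B"
  shows "(\<sigma> + \<tau>) * w x y z \<le> \<sigma> * A + \<tau> * B + \<kappa> * (a\<^sup>2 + b\<^sup>2) * (\<sigma> * \<tau>) * (\<sigma> + \<tau>)"
proof -
  obtain q\<^sub>1 q\<^sub>2 where q: "\<And>a b. \<bar>x + a\<bar> \<le> 4 \<Longrightarrow> \<bar>y + b\<bar> \<le> 4 \<Longrightarrow> \<bar>z + (x * b - y * a) / 2\<bar> \<le> 4 \<Longrightarrow>
      w x y z + q\<^sub>1 * a + q\<^sub>2 * b - \<kappa> * (a\<^sup>2 + b\<^sup>2) \<le> w (x + a) (y + b) (z + (x * b - y * a) / 2)"
    using support[OF assms(1-3)] by blast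
  have e: "(x * (\<tau> * b) - y * (\<tau> * a)) / 2 = \<tau> * ((x * b - y * a) / 2)" for \<tau>
    by (simp add: field_simps)
  have "w x y z + q\<^sub>1 * (\<tau> * a) + q\<^sub>2 * (\<tau> * b) - \<kappa> * ((\<tau> * a)\<^sup>2 + (\<tau> * b)\<^sup>2) \<le> A"
    using q[of "\<tau> * a" "\<tau> * b"] P P_le by (simp add: e)
  moreover have "w x y z + q\<^sub>1 * (- \<sigma> * a) + q\<^sub>2 * (- \<sigma> * b) - \<kappa> * ((- \<sigma> * a)\<^sup>2 + (- \<sigma> * b)\<^sup>2) \<le> B"
    using q[of "- \<sigma> * a" "- \<sigma> * b"] M M_le by (simp only: e) simp
  ultimately have "\<sigma> * (w x y z + q\<^sub>1 * (\<tau> * a) + q\<^sub>2 * (\<tau> * b) - \<kappa> * ((\<tau> * a)\<^sup>2 + (\<tau> * b)\<^sup>2))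
      + \<tau> * (w x y z + q\<^sub>1 * (- \<sigma> * a) + q\<^sub>2 * (- \<sigma> * b) - \<kappa> * ((- \<sigma> * a)\<^sup>2 + (- \<sigma> * b)\<^sup>2)) \<le> \<sigma> * A + \<tau> * B"
    using st by (intro add_mono mult_left_mono)
  then show ?thesis by (simp add: power2_eq_square algebra_simps)
qed

lemma segment_le:
  assumes "\<bar>x\<bar> \<le> 4" "\<bar>y\<bar> \<le> 4" "\<bar>z\<bar> \<le> 4"
    and st: "0 \<le> \<sigma>" "0 \<le> \<tau>" "0 < \<sigma> + \<tau>"
    and P: "\<bar>x + \<tau> * a\<bar> \<le> 4" "\<bar>y + \<tau> * b\<bar> \<le> 4" "\<bar>z + \<tau> * ((x * b - y * a) / 2)\<bar> \<le> 4"
    and M: "\<bar>x - \<sigma> * a\<bar> \<le> 4" "\<bar>y - \<sigma> * b\<bar> \<le> 4" "\<bar>z - \<sigma> * ((x * b - y * a) / 2)\<bar> \<le> 4"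
    and P_le: "w (x + \<tau> * a) (y + \<tau> * b) (z + \<tau> * ((x * b - y * a) / 2)) \<le> A"
    and M_le: "w (x - \<sigma> * a) (y - \<sigma> * b) (z - \<sigma> * ((x * b - y * a) / 2)) \<le> A"
    and C: "(a\<^sup>2 + b\<^sup>2) * (\<sigma> * \<tau>) \<le> C"
  shows "w x y z \<le> A + \<kappa> * C"
proof -
  have "(\<sigma> + \<tau>) * w x y z \<le> \<sigma> * A + \<tau> * A + \<kappa> * (a\<^sup>2 + b\<^sup>2) * (\<sigma> * \<tau>) * (\<sigma> + \<tau>)"
    by (rule segment[OF assms(1-3) st(1,2) P M P_le M_le])
  also have "\<dots> = (\<sigma> + \<tau>) * (A + \<kappa> * ((a\<^sup>2 + b\<^sup>2) * (\<sigma> * \<tau>)))" by (simp add: algebra_simps)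
  also have "\<dots> \<le> (\<sigma> + \<tau>) * (A + \<kappa> * C)"
    using st kappa C by (intro mult_left_mono add_left_mono) auto
  finally show ?thesis using st by simp
qed

text \<open>Three generations of horizontal segments, starting from eight points, fill a neighbourhood of the
  origin. The line \<open>(1, s, s/2)\<close> in direction \<open>y\<close> is horizontal, and its point with parameter \<open>s\<close> is joined by a
  horizontal segment to exactly one point of the line \<open>(-1, s, -s/2)\<close>, namely that with parameter \<open>-s\<close>.
  These segments sweep out the surface \<open>(\<nu>, \<nu>t, t/2)\<close>, which is transversal to the \<open>y\<close>-direction at the origin.
  Its left translates by \<open>(0, \<beta>, 0)\<close> with \<open>\<beta> = 1\<close> and \<open>\<beta> = -1\<close> are therefore hit, on opposite sides, by the
  horizontal \<open>y\<close>-line through any point near the origin.\<close>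
lemma bounded_above:
  obtains M where "\<And>x y z. \<bar>x\<bar> \<le> 1/4 \<Longrightarrow> \<bar>y\<bar> \<le> 1/4 \<Longrightarrow> \<bar>z\<bar> \<le> 1/4 \<Longrightarrow> w x y z \<le> M"
proof -
  define F where "F = (\<lambda>(\<beta>, \<delta>, s). w \<delta> (s + \<beta>) (\<delta> * (s - \<beta>) / 2)) ` ({1, -1} \<times> {1, -1} \<times> {3, -3::real})"
  define M0 where "M0 = Max F"
  have "finite F" by (simp add: F_def)
  then have M0: "w \<delta> (s + \<beta>) (\<delta> * (s - \<beta>) / 2) \<le> M0" if "\<beta> \<in> {1, -1}" "\<delta> \<in> {1, -1}" "s \<in> {3, -3}" for \<beta> \<delta> s
    unfolding M0_def using that by (intro Max_ge) (auto simp: F_def)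
  \<comment> \<open>First generation: the translates of the lines \<open>(\<delta>, s, \<delta>s/2)\<close>, between the points with \<open>s = 3\<close> and \<open>s = -3\<close>.\<close>
  define M1 where "M1 = M0 + \<kappa> * 9"
  have L1: "w \<delta> (s + \<beta>) (\<delta> * (s - \<beta>) / 2) \<le> M1" if \<beta>: "\<beta> \<in> {1, -1}" and \<delta>: "\<delta> \<in> {1, -1}" and s: "\<bar>s\<bar> \<le> 2" for \<beta> \<delta> s :: real
    unfolding M1_def
  proof (rule segment_le[where a = 0 and b = 1 and \<tau> = "3 - s" and \<sigma> = "3 + s"])
    have e1: "\<delta> * (s - \<beta>) / 2 + (3 - s) * ((\<delta> * 1 - (s + \<beta>) * 0) / 2) = \<delta> * (3 - \<beta>) / 2" by (simp add: field_simps)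
    show "w (\<delta> + (3 - s) * 0) (s + \<beta> + (3 - s) * 1) (\<delta> * (s - \<beta>) / 2 + (3 - s) * ((\<delta> * 1 - (s + \<beta>) * 0) / 2)) \<le> M0"
      unfolding e1 using M0[OF \<beta> \<delta>, of 3] by (simp add: add.commute)
    have e2: "\<delta> * (s - \<beta>) / 2 - (3 + s) * ((\<delta> * 1 - (s + \<beta>) * 0) / 2) = \<delta> * (-3 - \<beta>) / 2" by (simp add: field_simps)
    show "w (\<delta> - (3 + s) * 0) (s + \<beta> - (3 + s) * 1) (\<delta> * (s - \<beta>) / 2 - (3 + s) * ((\<delta> * 1 - (s + \<beta>) * 0) / 2)) \<le> M0"
      unfolding e2 using M0[OF \<beta> \<delta>, of "-3"] by (simp add: add.commute)
    have "0 \<le> s * s" by simp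
    then show "(0\<^sup>2 + 1\<^sup>2) * ((3 + s) * (3 - s)) \<le> 9" by (simp add: algebra_simps)
  qed (use \<beta> \<delta> s in \<open>auto simp: abs_le_iff field_simps\<close>)
  \<comment> \<open>Second generation: the translates of the surface, between the points with \<open>\<delta> = 1\<close> and \<open>\<delta> = -1\<close>.\<close>
  define M2 where "M2 = M1 + \<kappa> * 5"
  have L2: "w \<nu> (\<nu> * t + \<beta>) (t / 2 - \<beta> * \<nu> / 2) \<le> M2" if \<beta>: "\<beta> \<in> {1, -1}" and \<nu>: "\<bar>\<nu>\<bar> \<le> 1" and t: "\<bar>t\<bar> \<le> 2" for \<beta> \<nu> t :: real
    unfolding M2_def
  proof (rule segment_le[where a = 1 and b = t and \<tau> = "1 - \<nu>" and \<sigma> = "1 + \<nu>"])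
    have lt: "\<bar>\<nu> * t\<bar> \<le> 2" using mult_mono[OF \<nu> t] by (simp add: abs_mult)
    show "\<bar>\<nu> * t + \<beta>\<bar> \<le> 4" using lt \<beta> by auto
    have bl: "\<bar>\<beta> * \<nu>\<bar> \<le> 1" using \<nu> \<beta> by auto
    show "\<bar>t / 2 - \<beta> * \<nu> / 2\<bar> \<le> 4" using t bl by (auto simp: abs_le_iff)
    have y1: "\<nu> * t + \<beta> + (1 - \<nu>) * t = t + \<beta>" by (simp add: algebra_simps)
    have z1: "t / 2 - \<beta> * \<nu> / 2 + (1 - \<nu>) * ((\<nu> * t - (\<nu> * t + \<beta>) * 1) / 2) = 1 * (t - \<beta>) / 2"
      by (simp add: field_simps)
    show "w (\<nu> + (1 - \<nu>) * 1) (\<nu> * t + \<beta> + (1 - \<nu>) * t) (t / 2 - \<beta> * \<nu> / 2 + (1 - \<nu>) * ((\<nu> * t - (\<nu> * t + \<beta>) * 1) / 2)) \<le> M1"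
      unfolding y1 z1 using L1[OF \<beta>, of 1 t] t by simp
    show "\<bar>\<nu> * t + \<beta> + (1 - \<nu>) * t\<bar> \<le> 4" "\<bar>t / 2 - \<beta> * \<nu> / 2 + (1 - \<nu>) * ((\<nu> * t - (\<nu> * t + \<beta>) * 1) / 2)\<bar> \<le> 4"
      unfolding y1 z1 using t \<beta> by auto
    have y2: "\<nu> * t + \<beta> - (1 + \<nu>) * t = - t + \<beta>" by (simp add: algebra_simps)
    have z2: "t / 2 - \<beta> * \<nu> / 2 - (1 + \<nu>) * ((\<nu> * t - (\<nu> * t + \<beta>) * 1) / 2) = - 1 * (- t - \<beta>) / 2"
      by (simp add: field_simps)
    show "w (\<nu> - (1 + \<nu>) * 1) (\<nu> * t + \<beta> - (1 + \<nu>) * t) (t / 2 - \<beta> * \<nu> / 2 - (1 + \<nu>) * ((\<nu> * t - (\<nu> * t + \<beta>) * 1) / 2)) \<le> M1"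
      unfolding y2 z2 using L1[OF \<beta>, of "-1" "-t"] t by simp
    show "\<bar>\<nu> * t + \<beta> - (1 + \<nu>) * t\<bar> \<le> 4" "\<bar>t / 2 - \<beta> * \<nu> / 2 - (1 + \<nu>) * ((\<nu> * t - (\<nu> * t + \<beta>) * 1) / 2)\<bar> \<le> 4"
      unfolding y2 z2 using t \<beta> by auto
    have "t\<^sup>2 \<le> 2\<^sup>2" using t by (metis abs_ge_zero power2_abs power_mono)
    moreover have "(1 + \<nu>) * (1 - \<nu>) \<le> 1" using zero_le_square[of \<nu>] by (simp add: algebra_simps)
    moreover have "0 \<le> (1 + \<nu>) * (1 - \<nu>)" using \<nu> by (intro mult_nonneg_nonneg) auto
    ultimately have "(1\<^sup>2 + t\<^sup>2) * ((1 + \<nu>) * (1 - \<nu>)) \<le> 5 * 1"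
      by (intro mult_mono) auto
    then show "(1\<^sup>2 + t\<^sup>2) * ((1 + \<nu>) * (1 - \<nu>)) \<le> 5" by simp
  qed (use \<nu> in auto)
  have L3: "w x y z \<le> M2 + \<kappa> * 4" if x: "\<bar>x\<bar> \<le> 1/4" and y: "\<bar>y\<bar> \<le> 1/4" and z: "\<bar>z\<bar> \<le> 1/4" for x y z
  proof -
    have xx: "x * x \<le> 1/16" "0 \<le> x * x" using mult_mono[OF x x] by auto
    have xz: "\<bar>x * z\<bar> \<le> 1/16" using mult_mono[OF x z] by (simp add: abs_mult)
    \<comment> \<open>The \<open>y\<close>-line through \<open>(x, y, z)\<close> meets the surfaces translated by \<open>\<beta> = 1\<close> and \<open>\<beta> = -1\<close> at the
      parameters \<open>\<tau>\<close> and \<open>- \<sigma>\<close>, at their points with \<open>\<nu> = x\<close> and \<open>t = t1\<close>, respectively \<open>t = t2\<close>.\<close>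
    define \<tau> where "\<tau> = (1 + x * x + 2 * (x * z) - y) / (1 - x * x)"
    define \<sigma> where "\<sigma> = (1 + x * x - 2 * (x * z) + y) / (1 - x * x)"
    have te: "\<tau> * (1 - x * x) = 1 + x * x + 2 * (x * z) - y" using xx by (simp add: \<tau>_def)
    have se: "\<sigma> * (1 - x * x) = 1 + x * x - 2 * (x * z) + y" using xx by (simp add: \<sigma>_def)
    have den: "0 < 1 - x * x" using xx by linarith
    have num: "0 < 1 + x * x + 2 * (x * z) - y" "1 + x * x + 2 * (x * z) - y \<le> 2 * (1 - x * x)"
      "0 < 1 + x * x - 2 * (x * z) + y" "1 + x * x - 2 * (x * z) + y \<le> 2 * (1 - x * x)"
    proof -
      have gen: "0 < 1 + p + 2 * q - v" "1 + p + 2 * q - v \<le> 2 * (1 - p)"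
        if "p \<le> 1/16" "0 \<le> p" "\<bar>q\<bar> \<le> 1/16" "\<bar>v\<bar> \<le> 1/4" for p q v :: real
        using that by (auto simp: abs_le_iff)
      show "0 < 1 + x * x + 2 * (x * z) - y" "1 + x * x + 2 * (x * z) - y \<le> 2 * (1 - x * x)"
        using gen[OF xx xz y] by auto
      show "0 < 1 + x * x - 2 * (x * z) + y" "1 + x * x - 2 * (x * z) + y \<le> 2 * (1 - x * x)"
        using gen[OF xx, of "- (x * z)" "- y"] xz y by auto
    qed
    have t: "0 < \<tau>" "\<tau> \<le> 2" unfolding \<tau>_def
      using num den by (simp_all add: divide_pos_pos pos_divide_le_eq)
    have s: "0 < \<sigma>" "\<sigma> \<le> 2" unfolding \<sigma>_def
      using num den by (simp_all add: divide_pos_pos pos_divide_le_eq)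
    define t1 where "t1 = 2 * z + (\<tau> + 1) * x"
    define t2 where "t2 = 2 * z - (\<sigma> + 1) * x"
    have "\<bar>(\<tau> + 1) * x\<bar> \<le> 3 * (1/4)" unfolding abs_mult using t x by (intro mult_mono) auto
    then have t1: "\<bar>t1\<bar> \<le> 2" unfolding t1_def using z by (auto simp: abs_le_iff)
    have "\<bar>(\<sigma> + 1) * x\<bar> \<le> 3 * (1/4)" unfolding abs_mult using s x by (intro mult_mono) auto
    then have t2: "\<bar>t2\<bar> \<le> 2" unfolding t2_def using z by (auto simp: abs_le_iff)
    have tx: "\<bar>\<tau> * x\<bar> \<le> 2 * (1/4)" unfolding abs_mult using t x by (intro mult_mono) auto
    have sx: "\<bar>\<sigma> * x\<bar> \<le> 2 * (1/4)" unfolding abs_mult using s x by (intro mult_mono) auto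
    have y1: "y + \<tau> * 1 = x * t1 + 1" using te by (simp add: t1_def algebra_simps)
    have z1: "z + \<tau> * ((x * 1 - y * 0) / 2) = t1 / 2 - 1 * x / 2" by (simp add: t1_def field_simps)
    have y2: "y - \<sigma> * 1 = x * t2 + (- 1)" using se by (simp add: t2_def algebra_simps)
    have z2: "z - \<sigma> * ((x * 1 - y * 0) / 2) = t2 / 2 - (- 1) * x / 2" by (simp add: t2_def field_simps)
    show ?thesis
    proof (rule segment_le[where a = 0 and b = 1 and \<tau> = \<tau> and \<sigma> = \<sigma>])
      show "w (x + \<tau> * 0) (y + \<tau> * 1) (z + \<tau> * ((x * 1 - y * 0) / 2)) \<le> M2"
        unfolding y1 z1 using L2[of 1 x t1] x t1 by simp
      show "w (x - \<sigma> * 0) (y - \<sigma> * 1) (z - \<sigma> * ((x * 1 - y * 0) / 2)) \<le> M2"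
        unfolding y2 z2 using L2[of "-1" x t2] x t2 by simp
      show "0 < \<sigma> + \<tau>" using s t by simp
      have "\<sigma> * \<tau> \<le> 2 * 2" using s t by (intro mult_mono) auto
      then show "(0\<^sup>2 + 1\<^sup>2) * (\<sigma> * \<tau>) \<le> 4" by simp
    qed (use x y z t s tx sx in \<open>auto simp: abs_le_iff\<close>)
  qed
  show ?thesis using L3 by (rule that)
qed

text \<open>Prolong the step from \<open>(px, py, pz)\<close> by the fixed length \<open>r\<close> on either side, where \<open>w\<close> is bounded above.
  Convexity on the two longer segments bounds the value after the step from above and from below by
  quantities that tend to \<open>l\<close> as the length \<open>s\<close> of the step tends to \<open>0\<close>.\<close>
lemma horizontal_step:
  assumes P: "(px \<longlongrightarrow> 0) (at_right 0)" "(py \<longlongrightarrow> 0) (at_right 0)" "(pz \<longlongrightarrow> 0) (at_right 0)"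
    and lim: "((\<lambda>s. w (px s) (py s) (pz s)) \<longlongrightarrow> l) (at_right 0)"
    and ab: "\<bar>a\<bar> \<le> 1" "\<bar>b\<bar> \<le> 1"
  shows "((\<lambda>s. w (px s + s * a) (py s + s * b) (pz s + s * ((px s * b - py s * a) / 2))) \<longlongrightarrow> l) (at_right 0)"
proof -
  obtain M where M: "\<And>x y z. \<bar>x\<bar> \<le> 1/4 \<Longrightarrow> \<bar>y\<bar> \<le> 1/4 \<Longrightarrow> \<bar>z\<bar> \<le> 1/4 \<Longrightarrow> w x y z \<le> M"
    using bounded_above by blast
  define r :: real where "r = 1/16"
  define K where "K = \<kappa> * (a\<^sup>2 + b\<^sup>2)"
  define w0 where "w0 s = w (px s) (py s) (pz s)" for s
  define w1 where "w1 s = w (px s + s * a) (py s + s * b) (pz s + s * ((px s * b - py s * a) / 2))" for s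
  have id: "((\<lambda>s::real. s) \<longlongrightarrow> 0) (at_right 0)" by (rule tendsto_ident_at)
  have small: "eventually (\<lambda>s. \<bar>f s\<bar> < 1/16) (at_right 0)" if "(f \<longlongrightarrow> 0) (at_right (0::real))" for f :: "real \<Rightarrow> real"
    using tendstoD[OF that, of "1/16"] by simp
  have ev: "eventually (\<lambda>s. 0 < s \<and> \<bar>s\<bar> < 1/16 \<and> \<bar>px s\<bar> < 1/16 \<and> \<bar>py s\<bar> < 1/16 \<and> \<bar>pz s\<bar> < 1/16) (at_right 0)"
    by (intro eventually_conj small P id) (simp add: eventually_at_right_less)
  have bounds: "(s + r) * w1 s \<le> s * M + r * w0 s + K * (s * r) * (s + r) \<and>
      (s + r) * w0 s \<le> r * w1 s + s * M + K * (s * r) * (s + r)"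
    if s: "0 < s \<and> \<bar>s\<bar> < 1/16 \<and> \<bar>px s\<bar> < 1/16 \<and> \<bar>py s\<bar> < 1/16 \<and> \<bar>pz s\<bar> < 1/16" for s
  proof -
    let ?c = "(px s * b - py s * a) / 2"
    have e: "\<bar>u * a\<bar> \<le> \<bar>u\<bar>" "\<bar>u * b\<bar> \<le> \<bar>u\<bar>" for u
      unfolding abs_mult using mult_left_mono[OF ab(1), of "\<bar>u\<bar>"] mult_left_mono[OF ab(2), of "\<bar>u\<bar>"] by auto
    have s': "\<bar>px s\<bar> < 1/16" "\<bar>py s\<bar> < 1/16" "\<bar>pz s\<bar> < 1/16" using s by auto
    have "\<bar>px s * b - py s * a\<bar> \<le> 1/8"
      using abs_triangle_ineq4[of "px s * b" "py s * a"] e(2)[of "px s"] e(1)[of "py s"] s' by linarith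
    then have c: "\<bar>?c\<bar> \<le> 1/16" by simp
    have uc: "\<bar>u * ?c\<bar> \<le> 1/16" if "\<bar>u\<bar> \<le> 1" for u
      using mult_mono[OF that c] by (simp add: abs_mult)
    have in4: "\<bar>px s + u * a\<bar> \<le> 1/4" "\<bar>py s + u * b\<bar> \<le> 1/4" "\<bar>pz s + u * ?c\<bar> \<le> 1/4" if "\<bar>u\<bar> \<le> 1/8" for u
    proof -
      have "\<bar>u\<bar> \<le> 1" using that by linarith
      note uc[OF this]
      then show "\<bar>px s + u * a\<bar> \<le> 1/4" "\<bar>py s + u * b\<bar> \<le> 1/4" "\<bar>pz s + u * ?c\<bar> \<le> 1/4"
        using abs_triangle_ineq[of "px s" "u * a"] abs_triangle_ineq[of "py s" "u * b"]
          abs_triangle_ineq[of "pz s" "u * ?c"] e[of u] that s' by linarith+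
    qed
    have c': "((px s + s * a) * b - (py s + s * b) * a) / 2 = ?c" by (simp add: algebra_simps)
    have m: "x - u * y = x + (- u) * y" for x u y :: real by simp
    note mr = m[of "px s" r a] m[of "py s" r b] m[of "pz s" r ?c]
    have ru: "\<bar>s + r\<bar> \<le> 1/8" "\<bar>- r\<bar> \<le> 1/8" "\<bar>s\<bar> \<le> 1/8" "\<bar>0\<bar> \<le> (1/8::real)" using s by (auto simp: r_def abs_less_iff)
    have "(s + r) * w (px s + s * a) (py s + s * b) (pz s + s * ?c) \<le> s * M + r * w0 s + \<kappa> * (a\<^sup>2 + b\<^sup>2) * (s * r) * (s + r)"
    proof (rule segment[where a = a and b = b and \<sigma> = s and \<tau> = r], unfold c')
      have q: "px s + s * a + r * a = px s + (s + r) * a" "py s + s * b + r * b = py s + (s + r) * b"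
        "pz s + s * ?c + r * ?c = pz s + (s + r) * ?c" by (simp_all only: distrib_right add.assoc)
      show "w (px s + s * a + r * a) (py s + s * b + r * b) (pz s + s * ?c + r * ?c) \<le> M"
        unfolding q by (intro M in4 ru)
      show "\<bar>px s + s * a + r * a\<bar> \<le> 4" "\<bar>py s + s * b + r * b\<bar> \<le> 4" "\<bar>pz s + s * ?c + r * ?c\<bar> \<le> 4"
        unfolding q using in4[OF ru(1)] by linarith+
      show "w (px s + s * a - s * a) (py s + s * b - s * b) (pz s + s * ?c - s * ?c) \<le> w0 s"
        by (simp add: w0_def)
      show "\<bar>px s + s * a\<bar> \<le> 4" "\<bar>py s + s * b\<bar> \<le> 4" "\<bar>pz s + s * ?c\<bar> \<le> 4"
        using in4[OF ru(3)] by linarith+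
    qed (use s in \<open>auto simp: r_def\<close>)
    moreover have "(r + s) * w (px s) (py s) (pz s) \<le> r * w1 s + s * M + \<kappa> * (a\<^sup>2 + b\<^sup>2) * (r * s) * (r + s)"
    proof (rule segment[where a = a and b = b and \<sigma> = r and \<tau> = s])
      show "w (px s - r * a) (py s - r * b) (pz s - r * ?c) \<le> M"
        unfolding mr by (intro M in4 ru)
      show "\<bar>px s - r * a\<bar> \<le> 4" "\<bar>py s - r * b\<bar> \<le> 4" "\<bar>pz s - r * ?c\<bar> \<le> 4"
        unfolding mr using in4[OF ru(2)] by linarith+
      show "w (px s + s * a) (py s + s * b) (pz s + s * ?c) \<le> w1 s"
        by (simp add: w1_def)
      show "\<bar>px s + s * a\<bar> \<le> 4" "\<bar>py s + s * b\<bar> \<le> 4" "\<bar>pz s + s * ?c\<bar> \<le> 4"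
        using in4[OF ru(3)] by linarith+
    qed (use s in \<open>auto simp: r_def\<close>)
    ultimately show ?thesis by (simp add: w1_def w0_def K_def algebra_simps)
  qed
  have r: "r > 0" by (simp add: r_def)
  have lim0: "(w0 \<longlongrightarrow> l) (at_right 0)" using lim by (simp add: w0_def[abs_def])
  have "(w1 \<longlongrightarrow> l) (at_right 0)"
  proof (rule tendsto_sandwich)
    show "eventually (\<lambda>s. w1 s \<le> (s * M + r * w0 s + K * (s * r) * (s + r)) / (s + r)) (at_right 0)"
    proof (rule eventually_mono[OF ev])
      fix s :: real assume s: "0 < s \<and> \<bar>s\<bar> < 1/16 \<and> \<bar>px s\<bar> < 1/16 \<and> \<bar>py s\<bar> < 1/16 \<and> \<bar>pz s\<bar> < 1/16"
      then have "0 < s + r" using r by simp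
      then show "w1 s \<le> (s * M + r * w0 s + K * (s * r) * (s + r)) / (s + r)"
        using bounds[OF s] by (simp add: pos_le_divide_eq mult.commute)
    qed
    show "eventually (\<lambda>s. ((s + r) * w0 s - s * M - K * (s * r) * (s + r)) / r \<le> w1 s) (at_right 0)"
    proof (rule eventually_mono[OF ev])
      fix s :: real assume s: "0 < s \<and> \<bar>s\<bar> < 1/16 \<and> \<bar>px s\<bar> < 1/16 \<and> \<bar>py s\<bar> < 1/16 \<and> \<bar>pz s\<bar> < 1/16"
      then show "((s + r) * w0 s - s * M - K * (s * r) * (s + r)) / r \<le> w1 s"
        using bounds[OF s] r by (simp add: pos_divide_le_eq mult.commute)
    qed
    have "((\<lambda>s. (s * M + r * w0 s + K * (s * r) * (s + r)) / (s + r)) \<longlongrightarrow> (0 * M + r * l + K * (0 * r) * (0 + r)) / (0 + r)) (at_right 0)"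
      using r by (intro tendsto_intros id lim0) auto
    then show "((\<lambda>s. (s * M + r * w0 s + K * (s * r) * (s + r)) / (s + r)) \<longlongrightarrow> l) (at_right 0)" using r by simp
    have "((\<lambda>s. ((s + r) * w0 s - s * M - K * (s * r) * (s + r)) / r) \<longlongrightarrow> ((0 + r) * l - 0 * M - K * (0 * r) * (0 + r)) / r) (at_right 0)"
      using r by (intro tendsto_intros id lim0) auto
    then show "((\<lambda>s. ((s + r) * w0 s - s * M - K * (s * r) * (s + r)) / r) \<longlongrightarrow> l) (at_right 0)" using r by simp
  qed
  then show ?thesis by (simp add: w1_def[abs_def])
qed

text \<open>The endpoint \<open>(0, 0, \<plusminus>s\<^sup>2)\<close> is reached from the origin by four horizontal steps of length \<open>s\<close>.\<close>
lemma vertical_continuous: "((\<lambda>t. w 0 0 t) \<longlongrightarrow> w 0 0 0) (at 0)"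
proof -
  have id: "((\<lambda>s::real. s) \<longlongrightarrow> 0) (at_right 0)" by (rule tendsto_ident_at)
  have sq: "((\<lambda>s::real. c * s\<^sup>2) \<longlongrightarrow> 0) (at_right 0)" for c
    using tendsto_mult[OF tendsto_const tendsto_power[OF id, of 2], of c] by simp
  have sq1: "((\<lambda>s::real. s\<^sup>2) \<longlongrightarrow> 0) (at_right 0)" using sq[of 1] by simp
  have lims: "((\<lambda>s. w 0 0 (e * s\<^sup>2)) \<longlongrightarrow> w 0 0 0) (at_right 0)" if e: "e \<in> {1, -1}" for e
  proof -
    consider "e = 1" | "e = -1" using e by auto
    then show ?thesis
    proof cases
      case 1
      have "((\<lambda>s. w s 0 0) \<longlongrightarrow> w 0 0 0) (at_right 0)"
        using horizontal_step[of "\<lambda>_. 0" "\<lambda>_. 0" "\<lambda>_. 0" "w 0 0 0" 1 0] by simp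
      then have "((\<lambda>s. w s s (1/2 * s\<^sup>2)) \<longlongrightarrow> w 0 0 0) (at_right 0)"
        using horizontal_step[of "\<lambda>s. s" "\<lambda>_. 0" "\<lambda>_. 0" "w 0 0 0" 0 1] id by (simp add: power2_eq_square)
      then have "((\<lambda>s. w 0 s (s\<^sup>2)) \<longlongrightarrow> w 0 0 0) (at_right 0)"
        using horizontal_step[of "\<lambda>s. s" "\<lambda>s. s" "\<lambda>s. 1/2 * s\<^sup>2" "w 0 0 0" "-1" 0] id sq[of "1/2"] by (simp add: power2_eq_square)
      then have "((\<lambda>s. w 0 0 (s\<^sup>2)) \<longlongrightarrow> w 0 0 0) (at_right 0)"
        using horizontal_step[of "\<lambda>s. 0" "\<lambda>s. s" "\<lambda>s. s\<^sup>2" "w 0 0 0" 0 "-1"] id sq1 by simp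
      then show ?thesis by (simp add: 1)
    next
      case 2
      have "((\<lambda>s. w 0 s 0) \<longlongrightarrow> w 0 0 0) (at_right 0)"
        using horizontal_step[of "\<lambda>_. 0" "\<lambda>_. 0" "\<lambda>_. 0" "w 0 0 0" 0 1] by simp
      then have "((\<lambda>s. w s s ((-1/2) * s\<^sup>2)) \<longlongrightarrow> w 0 0 0) (at_right 0)"
        using horizontal_step[of "\<lambda>_. 0" "\<lambda>s. s" "\<lambda>_. 0" "w 0 0 0" 1 0] id by (simp add: power2_eq_square)
      then have "((\<lambda>s. w s 0 (- (s\<^sup>2))) \<longlongrightarrow> w 0 0 0) (at_right 0)"
        using horizontal_step[of "\<lambda>s. s" "\<lambda>s. s" "\<lambda>s. (-1/2) * s\<^sup>2" "w 0 0 0" 0 "-1"] id sq[of "-1/2"] by (simp add: power2_eq_square)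
      then have "((\<lambda>s. w 0 0 (- (s\<^sup>2))) \<longlongrightarrow> w 0 0 0) (at_right 0)"
        using horizontal_step[of "\<lambda>s. s" "\<lambda>s. 0" "\<lambda>s. - (s\<^sup>2)" "w 0 0 0" "-1" 0] id sq[of "-1"] by simp
      then show ?thesis by (simp add: 2)
    qed
  qed
  have sqrt: "filterlim sqrt (at_right 0) (at_right 0)"
    unfolding filterlim_at
    by (auto simp: eventually_at_right_less intro: tendsto_eq_intros eventually_mono[OF eventually_at_right_less[of 0]])
  have half: "((\<lambda>t. w 0 0 (e * t)) \<longlongrightarrow> w 0 0 0) (at_right 0)" if "e \<in> {1, -1}" for e
  proof -
    have "((\<lambda>t. w 0 0 (e * (sqrt t)\<^sup>2)) \<longlongrightarrow> w 0 0 0) (at_right 0)"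
      by (rule filterlim_compose[OF lims[OF that] sqrt])
    then show ?thesis
      by (rule Lim_transform_eventually) (rule eventually_mono[OF eventually_at_right_less[of 0]], simp)
  qed
  have "((\<lambda>t. w 0 0 t) \<longlongrightarrow> w 0 0 0) (at_right 0)" using half[of 1] by simp
  moreover have "((\<lambda>t. w 0 0 t) \<longlongrightarrow> w 0 0 0) (at_left 0)"
    using half[of "-1"] by (simp add: filterlim_at_left_to_right)
  ultimately show ?thesis by (simp add: filterlim_split_at)
qed

end

section \<open>Measurability from continuity along flows\<close>

text \<open>Lebesgue's discretisation argument for separately continuous functions. The flow of index \<open>i\<close> may change
  the coordinates after \<open>i\<close> arbitrarily, so coordinates are freed in decreasing order: when the first \<open>k\<close>
  are fixed, a point is moved along the flow of index \<open>k\<close> to the nearest smaller value of the \<open>k\<close>-th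
  coordinate in a grid, where measurability is known, and the mesh of the grid tends to \<open>0\<close>.\<close>
lemma measurable_of_continuous_along_flows:
  fixes f :: "'a::topological_space \<Rightarrow> real" and \<theta> :: "nat \<Rightarrow> real \<Rightarrow> 'a \<Rightarrow> 'a" and x :: "nat \<Rightarrow> 'a \<Rightarrow> real"
  assumes x: "\<And>i. i < N \<Longrightarrow> x i \<in> borel_measurable borel"
    and \<theta>: "\<And>i \<tau>. i < N \<Longrightarrow> \<tau> \<in> borel_measurable borel \<Longrightarrow> (\<lambda>g. \<theta> i (\<tau> g) g) \<in> measurable borel borel"
    and coords: "\<And>i j t g. i < N \<Longrightarrow> j \<le> i \<Longrightarrow> x j (\<theta> i t g) = x j g + (if j = i then t else 0)"
    and inj: "\<And>g h. (\<And>i. i < N \<Longrightarrow> x i g = x i h) \<Longrightarrow> g = h"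
    and \<Omega>: "\<Omega> \<in> sets borel" "\<And>g. g \<notin> \<Omega> \<Longrightarrow> f g = 0"
    and cont: "\<And>i g. i < N \<Longrightarrow> g \<in> \<Omega> \<Longrightarrow> \<theta> i 0 g = g \<and> ((\<lambda>t. f (\<theta> i t g)) \<longlongrightarrow> f g) (at 0)"
  shows "f \<in> borel_measurable borel"
proof -
  have xc: "Measurable.pred borel (\<lambda>g. x j g = b)" if "j < N" for j b
    using borel_measurable_eq[OF x[OF that] borel_measurable_const[of b]] by (simp add: pred_def)
  have "\<forall>c. (\<lambda>g. if \<forall>j<k. x j g = c j then f g else 0) \<in> borel_measurable borel" if "k \<le> N" for k
    using that
  proof (induction k rule: inc_induct)
    case base
    \<comment> \<open>All coordinates fixed: at most one point remains.\<close>
    show ?case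
    proof
      fix c :: "nat \<Rightarrow> real"
      define a where "a = f (SOME g. \<forall>j<N. x j g = c j)"
      have "f g = a" if "\<forall>j<N. x j g = c j" for g
      proof -
        have "\<forall>j<N. x j (SOME g. \<forall>j<N. x j g = c j) = c j" using that by (rule someI)
        then have "g = (SOME g. \<forall>j<N. x j g = c j)" using that by (intro inj) simp
        then show ?thesis by (simp add: a_def)
      qed
      then have e: "(\<lambda>g. if \<forall>j<N. x j g = c j then f g else 0) = (\<lambda>g. if \<forall>j\<in>{..<N}. x j g = c j then a else 0)"
        by (auto simp: fun_eq_iff)
      have [measurable]: "Measurable.pred borel (\<lambda>g. \<forall>j\<in>{..<N}. x j g = c j)"
        by (intro pred_intros_finite xc) auto
      show "(\<lambda>g. if \<forall>j<N. x j g = c j then f g else 0) \<in> borel_measurable borel"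
        unfolding e by measurable
    qed
  next
    case (step k)
    then have k: "k < N" by simp
    show ?case
    proof
      fix c :: "nat \<Rightarrow> real"
      define F where "F v g = (if \<forall>j<Suc k. x j g = (c(k := v)) j then f g else 0)" for v g
      have F: "F v \<in> borel_measurable borel" for v
        unfolding F_def[abs_def] using step.IH by blast
      define V where "V n (i::int) = real_of_int i / real (Suc n)" for n i
      define I where "I n g = \<lfloor>real (Suc n) * x k g\<rfloor>" for n g
      define h where "h n g = (if g \<in> \<Omega> \<and> (\<forall>j\<in>{..<k}. x j g = c j) then F (V n (I n g)) (\<theta> k (V n (I n g) - x k g) g) else 0)" for n g
      have xk[measurable]: "x k \<in> borel_measurable borel" by (rule x[OF k])
      have hm: "h n \<in> borel_measurable borel" for n
      proof -
        have "(\<lambda>g. F (V n i) (\<theta> k (V n i - x k g) g)) \<in> borel_measurable borel" for i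
          by (rule measurable_compose[OF \<theta>[OF k] F]) measurable
        moreover have "I n \<in> measurable borel (count_space UNIV)"
          unfolding I_def[abs_def] by measurable
        ultimately have m[measurable]: "(\<lambda>g. F (V n (I n g)) (\<theta> k (V n (I n g) - x k g) g)) \<in> borel_measurable borel"
          by (rule measurable_compose_countable)
        have [measurable]: "Measurable.pred borel (\<lambda>g. \<forall>j\<in>{..<k}. x j g = c j)"
          using k by (intro pred_intros_finite xc) auto
        have [measurable]: "Measurable.pred borel (\<lambda>g. g \<in> \<Omega>)" using \<Omega>(1) by simp
        show ?thesis unfolding h_def[abs_def] by measurable
      qed
      show "(\<lambda>g. if \<forall>j<k. x j g = c j then f g else 0) \<in> borel_measurable borel"
      proof (rule borel_measurable_LIMSEQ_real[OF _ hm])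
        fix g :: 'a
        show "(\<lambda>n. h n g) \<longlonglongrightarrow> (if \<forall>j<k. x j g = c j then f g else 0)"
        proof (cases "g \<in> \<Omega> \<and> (\<forall>j<k. x j g = c j)")
          case True
          define \<tau> where "\<tau> n = V n (I n g) - x k g" for n
          have "h n g = f (\<theta> k (\<tau> n) g)" for n
          proof -
            have "x k (\<theta> k (\<tau> n) g) = V n (I n g)" using coords[OF k, of k] by (simp add: \<tau>_def)
            moreover have "x j (\<theta> k (\<tau> n) g) = c j" if "j < k" for j
              using coords[OF k, of j] that True by simp
            ultimately have "\<forall>j<Suc k. x j (\<theta> k (\<tau> n) g) = (c(k := V n (I n g))) j"
              by (simp add: less_Suc_eq)
            then show ?thesis using True by (simp add: h_def F_def \<tau>_def)
          qed
          moreover have "(\<lambda>n. f (\<theta> k (\<tau> n) g)) \<longlonglongrightarrow> f g"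
          proof -
            have "\<tau> \<longlonglongrightarrow> 0"
            proof (rule Lim_null_comparison[OF always_eventually])
              show "(\<lambda>n. 1 / real (Suc n)) \<longlonglongrightarrow> 0" using LIMSEQ_inverse_real_of_nat by (simp add: inverse_eq_divide)
              show "\<forall>n. norm (\<tau> n) \<le> 1 / real (Suc n)"
              proof
                fix n
                have "\<tau> n = (real_of_int (I n g) - real (Suc n) * x k g) / real (Suc n)"
                  by (simp add: \<tau>_def V_def field_simps)
                moreover have "\<bar>real_of_int (I n g) - real (Suc n) * x k g\<bar> \<le> 1"
                  unfolding I_def by linarith
                ultimately show "norm (\<tau> n) \<le> 1 / real (Suc n)"
                  by (simp only: real_norm_def abs_divide abs_of_nat) (intro divide_right_mono, auto)
              qed
            qed
            moreover have "isCont (\<lambda>t. f (\<theta> k t g)) 0"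
              using cont[OF k, of g] True by (simp add: isCont_def)
            ultimately show ?thesis
              using isCont_tendsto_compose[of 0 "\<lambda>t. f (\<theta> k t g)" \<tau>] cont[OF k, of g] True by simp
          qed
          ultimately show ?thesis using True by simp
        next
          case False
          then have "h n g = 0" for n by (auto simp: h_def)
          moreover have "(if \<forall>j<k. x j g = c j then f g else 0) = 0" using False \<Omega>(2) by auto
          ultimately show ?thesis by simp
        qed
      qed
    qed
  qed
  from this[of 0] show ?thesis by simp
qed

section \<open>The gauge\<close>

context carnot_group
begin

lemma xi_eqI:
  assumes "\<And>i. i \<in> {1..step G} \<Longrightarrow> x i \<in> layer G i" "\<And>i. i \<notin> {1..step G} \<Longrightarrow> x i = 0"
    and "Log g = (\<Sum>i=1..step G. x i)"
  shows "xi G j g = x j"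
  unfolding xi_def using assms direct_sum[of "Log g"] by (subst the1_equality[of _ x]) auto

lemma xi_props:
  "i \<in> {1..step G} \<Longrightarrow> xi G i g \<in> layer G i" "i \<notin> {1..step G} \<Longrightarrow> xi G i g = 0"
  "Log g = (\<Sum>i=1..step G. xi G i g)"
proof -
  obtain x where x: "\<forall>j\<in>{1..step G}. x j \<in> layer G j" "\<forall>j. j \<notin> {1..step G} \<longrightarrow> x j = 0"
    "Log g = (\<Sum>j=1..step G. x j)"
    using direct_sum[of "Log g"] by blast
  then have e: "xi G i g = x i" for i by (intro xi_eqI) auto
  show "i \<in> {1..step G} \<Longrightarrow> xi G i g \<in> layer G i" "i \<notin> {1..step G} \<Longrightarrow> xi G i g = 0"
    "Log g = (\<Sum>i=1..step G. xi G i g)"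
    using x by (simp_all add: e)
qed

lemma linear_xi_Exp: "linear (\<lambda>v. xi G j (Exp v))"
proof (rule linearI)
  have sub: "subspace (layer G i)" if "i \<in> {1..step G}" for i using layer_subspace[OF that] by simp
  show "xi G j (Exp (v + w)) = xi G j (Exp v) + xi G j (Exp w)" for v w
    by (rule xi_eqI[where x = "\<lambda>j. xi G j (Exp v) + xi G j (Exp w)"])
       (use xi_props(1,2) sub xi_props(3)[of "Exp v"] xi_props(3)[of "Exp w"] in \<open>auto simp: sum.distrib subspace_add\<close>)
  show "xi G j (Exp (a *\<^sub>R v)) = a *\<^sub>R xi G j (Exp v)" for a v
    by (rule xi_eqI[where x = "\<lambda>j. a *\<^sub>R xi G j (Exp v)"])
       (use xi_props(1,2) sub xi_props(3)[of "Exp v"] in \<open>auto simp: subspace_scale simp flip: scaleR_sum_right\<close>)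
qed

lemma continuous_xi: "continuous_on S (xi G j)"
proof -
  have "continuous_on UNIV (\<lambda>v. xi G j (Exp v))"
    using linear_xi_Exp linear_continuous_on linear_conv_bounded_linear by blast
  from continuous_on_compose2[OF this continuous_Log[of S]] show ?thesis by simp
qed

lemma xi_Exp_V1: "X \<in> layer G 1 \<Longrightarrow> xi G j (Exp X) = (if j = 1 then X else 0)"
  using step_pos layer_subspace by (intro xi_eqI) (auto simp: subspace_0)

lemma gauge_Exp_V1:
  assumes "X \<in> layer G 1" shows "gauge G (Exp X) = norm X"
proof -
  define p where "p = 2 * fact (step G) / (1::real)"
  have p: "p > 0" by (simp add: p_def)
  have "(\<Sum>i=1..step G. norm (xi G i (Exp X)) powr (2 * fact (step G) / real i))
    = (\<Sum>i=1..step G. if i = 1 then norm X powr p else 0)"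
    by (rule sum.cong) (auto simp: xi_Exp_V1[OF assms] p_def)
  also have "\<dots> = norm X powr p" using step_pos by simp
  finally show ?thesis using p by (simp add: gauge_def powr_powr p_def)
qed

lemma inv_mult_left_cancel: "inv (g \<otimes> a) \<otimes> (g \<otimes> b) = inv a \<otimes> b"
  by (simp add: inv_mult_group m_assoc) (simp add: m_assoc[symmetric])

lemma Exp_diff: "inv (Exp (s *\<^sub>R X)) \<otimes> Exp (t *\<^sub>R X) = Exp ((t - s) *\<^sub>R X)"
  using Exp_add[of "-s" t X] by (simp add: inv_Exp)

lemma gdist_line:
  assumes "X \<in> layer G 1"
  shows "gdist G (g \<otimes> Exp (s *\<^sub>R X)) (g \<otimes> Exp (t *\<^sub>R X)) = \<bar>t - s\<bar> * norm X"
proof -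
  have "(t - s) *\<^sub>R X \<in> layer G 1" using assms layer_subspace[of 1] step_pos by (simp add: subspace_scale)
  then show ?thesis by (simp add: gdist_def inv_mult_left_cancel Exp_diff gauge_Exp_V1)
qed

lemma gauge_nonneg: "0 \<le> gauge G g" by (simp add: gauge_def)

text \<open>Comparing one summand with the sum bounds the norm by the \<open>i\<close>-th power of the gauge, which is
  at most the gauge when that is at most one.\<close>
lemma norm_xi_le_gauge:
  assumes "gauge G g \<le> 1" shows "norm (xi G i g) \<le> gauge G g"
proof (cases "i \<in> {1..step G}")
  case True
  define p :: real where "p = 2 * fact (step G)"
  define S where "S = (\<Sum>i=1..step G. norm (xi G i g) powr (p / real i))"
  have p: "p > 0" by (simp add: p_def)
  have i: "real i \<ge> 1" using True by simp
  have gS: "gauge G g = S powr (1 / p)" by (simp add: gauge_def S_def p_def)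
  have "norm (xi G i g) powr (p / real i) \<le> S"
    unfolding S_def by (rule member_le_sum) (use True in auto)
  then have "(norm (xi G i g) powr (p / real i)) powr (real i / p) \<le> S powr (real i / p)"
    using p i by (intro powr_mono2) auto
  moreover have "(norm (xi G i g) powr (p / real i)) powr (real i / p) = norm (xi G i g)"
    using p i by (simp add: powr_powr)
  moreover have "S powr (real i / p) = gauge G g powr real i" by (simp add: gS powr_powr)
  moreover have "gauge G g powr real i \<le> gauge G g powr 1"
    using powr_mono'[of 1 "real i" "gauge G g"] assms gauge_nonneg[of g] i by simp
  ultimately show ?thesis using gauge_nonneg[of g] by simp
qed (simp add: xi_props gauge_nonneg)

lemma continuous_gauge: "continuous_on S (gauge G)"
  unfolding gauge_def[abs_def]
proof (intro continuous_on_powr' continuous_on_sum continuous_on_norm continuous_xi continuous_on_const ballI conjI impI)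
  show "0 \<le> (\<Sum>i=1..step G. norm (xi G i x) powr (2 * fact (step G) / real i))" for x
    by (intro sum_nonneg) auto
qed auto

lemma continuous_left: "continuous_on S (\<lambda>x. g \<otimes> x)"
  by (intro continuous_mult continuous_on_const continuous_on_id)

lemma open_gball: "open (gball G g \<rho>)"
proof -
  have "continuous_on UNIV (\<lambda>h. gdist G g h)"
    unfolding gdist_def using continuous_on_compose2[OF continuous_gauge continuous_left] by blast
  then show ?thesis unfolding gball_def by (intro open_Collect_less continuous_on_const)
qed

lemma gauge_one: "gauge G \<one> = 0"
  using gauge_Exp_V1[of 0] layer_subspace[of 1] step_pos by (simp add: subspace_0)

lemma gball_center: "0 < \<rho> \<Longrightarrow> g \<in> gball G g \<rho>"
  by (simp add: gball_def gdist_def gauge_one)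

lemma gball_subset_open:
  assumes "open \<Omega>" "g \<in> \<Omega>" obtains \<rho> where "\<rho> > 0" "gball G g \<rho> \<subseteq> \<Omega>"
proof -
  have "continuous_on UNIV (\<lambda>v. g \<otimes> Exp v)"
    by (intro continuous_mult continuous_on_const continuous_Exp)
  then have "open ((\<lambda>v. g \<otimes> Exp v) -` \<Omega>)" using assms(1) by (simp add: continuous_on_open_vimage)
  moreover have "0 \<in> (\<lambda>v. g \<otimes> Exp v) -` \<Omega>" using assms(2) by simp
  ultimately obtain e where e: "e > 0" "ball 0 e \<subseteq> (\<lambda>v. g \<otimes> Exp v) -` \<Omega>"
    using open_contains_ball by blast
  define \<rho> where "\<rho> = min 1 (e / real (step G))"
  have \<rho>: "\<rho> > 0" "\<rho> \<le> 1" using e(1) step_pos by (auto simp: \<rho>_def)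
  have "h \<in> \<Omega>" if h: "h \<in> gball G g \<rho>" for h
  proof -
    define k where "k = inv g \<otimes> h"
    have gk: "gauge G k < \<rho>" using h by (simp add: gball_def gdist_def k_def)
    have "norm (Log k) \<le> (\<Sum>i=1..step G. norm (xi G i k))"
      by (subst xi_props(3)) (rule norm_sum)
    also have "\<dots> \<le> (\<Sum>i=1..step G. gauge G k)"
      using gk \<rho> by (intro sum_mono norm_xi_le_gauge) simp
    also have "\<dots> < real (step G) * \<rho>" using gk step_pos by simp
    also have "\<dots> \<le> e" using step_pos by (simp add: \<rho>_def min_def field_simps)
    finally have "Log k \<in> ball 0 e" by simp
    then have "g \<otimes> Exp (Log k) \<in> \<Omega>" using e(2) by auto
    moreover have "g \<otimes> Exp (Log k) = h" by (simp add: k_def m_assoc[symmetric])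
    ultimately show ?thesis by simp
  qed
  then show ?thesis using \<rho> that by blast
qed

lemma line_continuous: "continuous_on S (\<lambda>t::real. g \<otimes> Exp (t *\<^sub>R X))"
  by (intro continuous_mult continuous_on_const continuous_on_compose2[OF continuous_Exp[of UNIV]] continuous_intros) auto

lemma line_near:
  assumes "open \<Omega>" "g \<in> \<Omega>"
  obtains \<delta> where "\<delta> > 0" "\<And>t. \<bar>t\<bar> < \<delta> \<Longrightarrow> g \<otimes> Exp (t *\<^sub>R X) \<in> \<Omega>"
proof -
  have "open ((\<lambda>t::real. g \<otimes> Exp (t *\<^sub>R X)) -` \<Omega>)"
    using assms line_continuous[of UNIV] by (simp add: continuous_on_open_vimage)
  moreover have "0 \<in> (\<lambda>t::real. g \<otimes> Exp (t *\<^sub>R X)) -` \<Omega>" using assms by simp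
  ultimately obtain \<delta> where \<delta>: "\<delta> > 0" "ball 0 \<delta> \<subseteq> (\<lambda>t::real. g \<otimes> Exp (t *\<^sub>R X)) -` \<Omega>"
    using open_contains_ball by blast
  then have "g \<otimes> Exp (t *\<^sub>R X) \<in> \<Omega>" if "\<bar>t\<bar> < \<delta>" for t
    using that by (auto simp: subset_iff dist_real_def)
  with \<delta>(1) show ?thesis using that by blast
qed

lemma inv_eq_Exp: "inv g = Exp (- Log g)"
  using inv_Exp[of "Log g"] by simp

lemma continuous_inv:
  assumes "continuous_on S h" shows "continuous_on S (\<lambda>x. inv (h x))"
proof -
  have "continuous_on S (\<lambda>x. Log (h x))"
    by (rule continuous_on_compose2[OF continuous_Log[of UNIV] assms]) simp
  then have "continuous_on S (\<lambda>x. Exp (- Log (h x)))"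
    by (intro continuous_on_compose2[OF continuous_Exp[of UNIV] continuous_on_minus]) simp_all
  then show ?thesis by (simp add: inv_eq_Exp)
qed

end

section \<open>Null sets of Haar measure\<close>

locale carnot_haar = carnot_group G
  for G :: "('g::{t2_space, second_countable_topology}, 'v::euclidean_space) stratified_struct" (structure) +
  fixes \<mu> :: "'g measure"
  assumes haar: "haar_measure G \<mu>"
begin

lemma sets_mu [measurable_cong, simp]: "sets \<mu> = sets borel"
  and emeasure_compact: "compact K \<Longrightarrow> emeasure \<mu> K < \<infinity>"
  and emeasure_left: "A \<in> sets borel \<Longrightarrow> emeasure \<mu> ((\<lambda>x. g \<otimes> x) ` A) = emeasure \<mu> A"
  using haar by (auto simp: haar_measure_def)

lemma space_mu [simp]: "space \<mu> = UNIV"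
  using sets_eq_imp_space_eq[OF sets_mu] by simp

lemma emeasure_UNIV: "emeasure \<mu> UNIV \<noteq> 0"
  using haar by (auto simp: haar_measure_def)

sublocale sigma_finite_measure \<mu>
proof
  have "compact (Exp ` cball 0 (real n))" for n
    by (intro compact_continuous_image continuous_Exp compact_cball)
  note c = this
  have "(\<Union>n. Exp ` cball 0 (real n)) = UNIV"
  proof -
    have "g \<in> (\<Union>n. Exp ` cball 0 (real n))" for g
    proof -
      obtain n where "norm (Log g) \<le> real n" using real_arch_simple by blast
      then have "Exp (Log g) \<in> Exp ` cball 0 (real n)" by (intro imageI) simp
      then show ?thesis by auto
    qed
    then show ?thesis by auto
  qed
  then show "\<exists>A. countable A \<and> A \<subseteq> sets \<mu> \<and> \<Union> A = space \<mu> \<and> (\<forall>a\<in>A. emeasure \<mu> a \<noteq> \<infinity>)"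
    using emeasure_compact[OF c] compact_imp_closed[OF c]
    by (intro exI[of _ "range (\<lambda>n. Exp ` cball 0 (real n))"]) (auto simp: less_top)
qed

lemma null_left:
  assumes "N \<in> null_sets \<mu>" shows "{x. g \<otimes> x \<in> N} \<in> null_sets \<mu>"
proof -
  have N: "N \<in> sets borel" using assms by (auto simp: null_sets_def)
  have e: "{x. g \<otimes> x \<in> N} = (\<lambda>x. inv g \<otimes> x) ` N"
  proof safe
    fix x assume "g \<otimes> x \<in> N"
    then have "inv g \<otimes> (g \<otimes> x) \<in> (\<lambda>x. inv g \<otimes> x) ` N" by (rule imageI)
    then show "x \<in> (\<lambda>x. inv g \<otimes> x) ` N" by (simp add: m_assoc[symmetric])
  qed (simp add: m_assoc[symmetric])
  have "(\<lambda>x. g \<otimes> x) -` N \<in> sets borel"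
    using measurable_sets[OF borel_measurable_continuous_onI[OF continuous_left] N] by simp
  moreover have "{x. g \<otimes> x \<in> N} = (\<lambda>x. g \<otimes> x) -` N" by auto
  moreover have "emeasure \<mu> {x. g \<otimes> x \<in> N} = 0"
    unfolding e using emeasure_left[OF N] assms by (auto simp: null_sets_def)
  ultimately show ?thesis by (simp add: null_sets_def)
qed

lemma AE_ex: "AE x in \<mu>. P x \<Longrightarrow> \<exists>x. P x"
  by (rule eventually_happens'[of "ae_filter \<mu>"]) (simp_all add: ae_filter_eq_bot_iff emeasure_UNIV)

lemma measurable_pair_preimage:
  fixes F :: "'g \<times> 'c::second_countable_topology \<Rightarrow> 'g"
  assumes "continuous_on UNIV F" "N \<in> sets borel" "sets M = sets borel"
  shows "{p \<in> space (\<mu> \<Otimes>\<^sub>M M). F p \<notin> N} \<in> sets (\<mu> \<Otimes>\<^sub>M M)"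
proof -
  have s: "sets (\<mu> \<Otimes>\<^sub>M M) = sets borel"
    using sets_pair_measure_cong[OF sets_mu assms(3)] by (rule trans) (rule arg_cong[OF borel_prod])
  then have sp: "space (\<mu> \<Otimes>\<^sub>M M) = UNIV" using sets_eq_imp_space_eq[OF s] by simp
  have "F -` (- N) \<in> sets borel"
    using measurable_sets[OF borel_measurable_continuous_onI[OF assms(1)], of "- N"] assms(2) by auto
  moreover have "{p \<in> space (\<mu> \<Otimes>\<^sub>M M). F p \<notin> N} = F -` (- N)" by (auto simp: sp)
  ultimately show ?thesis unfolding s by (simp only:)
qed

text \<open>By Fubini's theorem and left invariance the pairs \<open>(a, b)\<close> with \<open>b\<^sup>-\<^sup>1a \<in> N\<close> form a null set. Hence for some \<open>a\<close> almost
  no \<open>b\<close> satisfies \<open>b\<^sup>-\<^sup>1a \<in> N\<close>, and left translation by \<open>a\<close> moves this set of \<open>b\<close> to the inverse of \<open>N\<close>.\<close>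
lemma null_inverse:
  assumes N: "N \<in> null_sets \<mu>" shows "{x. inv x \<in> N} \<in> null_sets \<mu>"
proof -
  interpret pair_sigma_finite \<mu> \<mu> ..
  have NB: "N \<in> sets borel" using N by (auto simp: null_sets_def)
  have "AE b in \<mu>. AE a in \<mu>. inv b \<otimes> a \<notin> N"
  proof (rule AE_I2)
    fix b show "AE a in \<mu>. inv b \<otimes> a \<notin> N"
      using AE_not_in[OF null_left[OF N, of "inv b"]] by simp
  qed
  moreover have "continuous_on UNIV (\<lambda>p. inv (snd p) \<otimes> fst p)"
    by (intro continuous_mult continuous_inv continuous_on_fst continuous_on_snd continuous_on_id)
  ultimately have "AE a in \<mu>. AE b in \<mu>. inv b \<otimes> a \<notin> N"
    using AE_commute[of "\<lambda>a b. inv b \<otimes> a \<notin> N"] measurable_pair_preimage[OF _ NB sets_mu] by simp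
  then obtain a where a: "AE b in \<mu>. inv b \<otimes> a \<notin> N" using AE_ex by blast
  have "{b. inv b \<otimes> a \<in> N} \<in> null_sets \<mu>"
  proof -
    have "continuous_on UNIV (\<lambda>b. inv b \<otimes> a)"
      by (intro continuous_mult continuous_inv continuous_on_const continuous_on_id)
    from measurable_sets[OF borel_measurable_continuous_onI[OF this] NB]
    have "{b. inv b \<otimes> a \<in> N} \<in> sets \<mu>" by (simp add: vimage_def)
    then show ?thesis using a AE_iff_null_sets[of "{b. inv b \<otimes> a \<in> N}" \<mu>] by simp
  qed
  from null_left[OF this, of a] show ?thesis
    by (simp add: inv_mult_group m_assoc)
qed

lemma null_right:
  assumes N: "N \<in> null_sets \<mu>" shows "{g. g \<otimes> z \<in> N} \<in> null_sets \<mu>"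
  using null_inverse[OF null_left[OF null_inverse[OF N], of "inv z"]] by (simp add: inv_mult_group)

text \<open>By Fubini's theorem some right translate of \<open>N\<close> by \<open>exp(tX)\<close> is null, and translating back keeps it null.\<close>
lemma null_of_countable_line_sections:
  assumes N: "N \<in> sets borel" and c: "\<And>g. countable {t. g \<otimes> Exp (t *\<^sub>R X) \<in> N}"
  shows "N \<in> null_sets \<mu>"
proof -
  interpret pair_sigma_finite \<mu> "lborel :: real measure" ..
  have "AE g in \<mu>. AE t in lborel. g \<otimes> Exp (t *\<^sub>R X) \<notin> N"
  proof (rule AE_I2)
    fix g show "AE t in lborel. g \<otimes> Exp (t *\<^sub>R X) \<notin> N"
      using AE_not_in[OF countable_imp_null_set_lborel[OF c[of g]]] by simp
  qed
  moreover have "continuous_on UNIV (\<lambda>p::'g \<times> real. fst p \<otimes> Exp (snd p *\<^sub>R X))"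
    by (intro continuous_mult continuous_on_fst continuous_on_id continuous_on_compose2[OF continuous_Exp, of UNIV] continuous_intros) auto
  note AE_commute[of "\<lambda>g t. g \<otimes> Exp (t *\<^sub>R X) \<notin> N", OF measurable_pair_preimage[OF this N sets_lborel]]
  ultimately have "AE t in lborel. AE g in \<mu>. g \<otimes> Exp (t *\<^sub>R X) \<notin> N"
    by simp
  then obtain t where t: "AE g in \<mu>. g \<otimes> Exp (t *\<^sub>R X) \<notin> N"
    using eventually_happens'[of "ae_filter lborel"] by (auto simp: ae_filter_eq_bot_iff)
  have "continuous_on UNIV (\<lambda>g. g \<otimes> Exp (t *\<^sub>R X))"
    by (intro continuous_mult continuous_on_const continuous_on_id)
  from measurable_sets[OF borel_measurable_continuous_onI[OF this] N]
  have "{g. g \<otimes> Exp (t *\<^sub>R X) \<in> N} \<in> sets \<mu>" by (simp add: vimage_def)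
  then have "{g. g \<otimes> Exp (t *\<^sub>R X) \<in> N} \<in> null_sets \<mu>"
    using t AE_iff_null_sets[of "{g. g \<otimes> Exp (t *\<^sub>R X) \<in> N}" \<mu>] by simp
  from null_right[OF this, of "Exp (- (t *\<^sub>R X))"] show ?thesis
    by (simp add: m_assoc)
qed

end

section \<open>Differentiability as a Borel condition\<close>

text \<open>Countably many quantifiers only, so that the condition defines a Borel set when \<open>Q\<close> depends on a
  parameter in a Borel way. For \<open>Q\<close> continuous off \<open>0\<close> it is the existence of a limit at \<open>0\<close>.\<close>
definition rat_Cauchy_at_0 :: "(real \<Rightarrow> real) \<Rightarrow> bool" where
  "rat_Cauchy_at_0 Q \<longleftrightarrow> (\<forall>n::nat. \<exists>m::nat. \<forall>q q'::rat. q \<noteq> 0 \<longrightarrow> q' \<noteq> 0 \<longrightarrow>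
     \<bar>real_of_rat q\<bar> < 1 / real (Suc m) \<longrightarrow> \<bar>real_of_rat q'\<bar> < 1 / real (Suc m) \<longrightarrow>
     \<bar>Q (real_of_rat q) - Q (real_of_rat q')\<bar> \<le> 1 / real (Suc n))"

lemma rat_Cauchy_at_0_iff:
  fixes Q Q' :: "real \<Rightarrow> real"
  assumes \<delta>: "\<delta> > 0" and cont: "\<And>t. t \<noteq> 0 \<Longrightarrow> \<bar>t\<bar> < \<delta> \<Longrightarrow> isCont Q t"
    and eq: "\<And>q. \<bar>real_of_rat q\<bar> < \<delta> \<Longrightarrow> Q' (real_of_rat q) = Q (real_of_rat q)"
  shows "rat_Cauchy_at_0 Q' \<longleftrightarrow> (\<exists>D. (Q \<longlongrightarrow> D) (at 0))"
proof
  have arch: "\<exists>m. 1 / real (Suc m) < e" if "e > 0" for e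
    using reals_Archimedean[OF that] by (simp add: inverse_eq_divide)
  {
    assume "\<exists>D. (Q \<longlongrightarrow> D) (at 0)"
    then obtain D where D: "(Q \<longlongrightarrow> D) (at 0)" by blast
    show "rat_Cauchy_at_0 Q'"
      unfolding rat_Cauchy_at_0_def
    proof
      fix n
      define E where "E = 1 / real (Suc n)"
      have "E / 2 > 0" by (simp add: E_def)
      from LIM_D[OF D this] obtain d where "d > 0"
        and d': "\<forall>t. t \<noteq> 0 \<and> norm (t - 0) < d \<longrightarrow> norm (Q t - D) < E / 2" by blast
      then have d: "d > 0" "\<And>t. t \<noteq> 0 \<Longrightarrow> \<bar>t\<bar> < d \<Longrightarrow> \<bar>Q t - D\<bar> < E / 2" by auto
      obtain m where m: "1 / real (Suc m) < min d \<delta>" using arch[of "min d \<delta>"] d \<delta> by auto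
      show "\<exists>m. \<forall>q q'. q \<noteq> 0 \<longrightarrow> q' \<noteq> 0 \<longrightarrow> \<bar>real_of_rat q\<bar> < 1 / real (Suc m) \<longrightarrow>
         \<bar>real_of_rat q'\<bar> < 1 / real (Suc m) \<longrightarrow> \<bar>Q' (real_of_rat q) - Q' (real_of_rat q')\<bar> \<le> 1 / real (Suc n)"
      proof (intro exI[of _ m] allI impI)
        fix q q' :: rat
        assume q: "q \<noteq> 0" "q' \<noteq> 0" "\<bar>real_of_rat q\<bar> < 1 / real (Suc m)" "\<bar>real_of_rat q'\<bar> < 1 / real (Suc m)"
        then have "\<bar>Q (real_of_rat q) - D\<bar> < E / 2" "\<bar>Q (real_of_rat q') - D\<bar> < E / 2"
          using m by (intro d(2); simp)+
        then have "\<bar>Q (real_of_rat q) - Q (real_of_rat q')\<bar> \<le> E" by linarith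
        moreover have "1 / real (Suc m) < \<delta>" using m by simp
        then have "\<bar>real_of_rat q\<bar> < \<delta>" "\<bar>real_of_rat q'\<bar> < \<delta>" using q(3,4) by linarith+
        note eq[OF this(1)] eq[OF this(2)]
        ultimately show "\<bar>Q' (real_of_rat q) - Q' (real_of_rat q')\<bar> \<le> 1 / real (Suc n)"
          unfolding E_def by (simp only:)
      qed
    qed
  }
  assume C: "rat_Cauchy_at_0 Q'"
  \<comment> \<open>By continuity the Cauchy condition passes from rational to real arguments.\<close>
  have CR: "\<exists>d>0. \<forall>s t. s \<noteq> 0 \<longrightarrow> t \<noteq> 0 \<longrightarrow> \<bar>s\<bar> < d \<longrightarrow> \<bar>t\<bar> < d \<longrightarrow> \<bar>Q s - Q t\<bar> \<le> e" if e: "e > 0" for e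
  proof -
    obtain n where n: "1 / real (Suc n) < e" using arch[OF e] by blast
    obtain m0 where m0: "\<And>q q'. q \<noteq> 0 \<Longrightarrow> q' \<noteq> 0 \<Longrightarrow> \<bar>real_of_rat q\<bar> < 1 / real (Suc m0) \<Longrightarrow> \<bar>real_of_rat q'\<bar> < 1 / real (Suc m0) \<Longrightarrow>
       \<bar>Q' (real_of_rat q) - Q' (real_of_rat q')\<bar> \<le> 1 / real (Suc n)"
      using C unfolding rat_Cauchy_at_0_def by blast
    define d where "d = min (1 / real (Suc m0)) \<delta>"
    have d: "d > 0" using \<delta> by (simp add: d_def)
    have rat: "\<exists>q. q \<noteq> 0 \<and> \<bar>real_of_rat q\<bar> < d \<and> \<bar>Q (real_of_rat q) - Q t\<bar> < \<eta>"
      if t: "t \<noteq> 0" "\<bar>t\<bar> < d" and \<eta>: "\<eta> > 0" for t \<eta>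
    proof -
      obtain r where r: "r > 0" "\<And>s. \<bar>s - t\<bar> < r \<Longrightarrow> \<bar>Q s - Q t\<bar> < \<eta>"
        using cont[of t] t \<eta> unfolding continuous_at_eps_delta by (auto simp: d_def dist_real_def)
      define r' where "r' = min r (min \<bar>t\<bar> (d - \<bar>t\<bar>))"
      have r': "r' > 0" using r t by (simp add: r'_def)
      then obtain q where q: "t - r' < real_of_rat q" "real_of_rat q < t + r'"
        using of_rat_dense[of "t - r'" "t + r'"] by auto
      then have "\<bar>real_of_rat q - t\<bar> < r'" by (simp add: abs_less_iff)
      then have "\<bar>real_of_rat q - t\<bar> < r" "\<bar>real_of_rat q - t\<bar> < \<bar>t\<bar>" "\<bar>real_of_rat q - t\<bar> < d - \<bar>t\<bar>"
        by (simp_all add: r'_def)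
      note qt = this
      have "q \<noteq> 0" using qt(2) by auto
      moreover have "\<bar>real_of_rat q\<bar> < d" using qt(3) by linarith
      ultimately show ?thesis using r(2)[OF qt(1)] by blast
    qed
    have "\<bar>Q s - Q t\<bar> \<le> e" if s: "s \<noteq> 0" "\<bar>s\<bar> < d" and t: "t \<noteq> 0" "\<bar>t\<bar> < d" for s t
    proof -
      define \<eta> where "\<eta> = (e - 1 / real (Suc n)) / 2"
      have \<eta>: "\<eta> > 0" using n by (simp add: \<eta>_def)
      obtain q where q: "q \<noteq> 0" "\<bar>real_of_rat q\<bar> < d" "\<bar>Q (real_of_rat q) - Q s\<bar> < \<eta>" using rat[OF s \<eta>] by blast
      obtain q' where q': "q' \<noteq> 0" "\<bar>real_of_rat q'\<bar> < d" "\<bar>Q (real_of_rat q') - Q t\<bar> < \<eta>" using rat[OF t \<eta>] by blast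
      have "\<bar>Q (real_of_rat q) - Q (real_of_rat q')\<bar> \<le> 1 / real (Suc n)"
        using m0[of q q'] q q' by (simp add: d_def eq)
      moreover have "2 * \<eta> = e - 1 / real (Suc n)" by (simp add: \<eta>_def)
      ultimately show ?thesis using q(3) q'(3) by linarith
    qed
    then show ?thesis using d by blast
  qed
  have "Cauchy (\<lambda>k. Q (1 / real (Suc k)))"
  proof (rule metric_CauchyI)
    fix e :: real assume "e > 0"
    then obtain d where d: "d > 0" "\<And>s t. s \<noteq> 0 \<Longrightarrow> t \<noteq> 0 \<Longrightarrow> \<bar>s\<bar> < d \<Longrightarrow> \<bar>t\<bar> < d \<Longrightarrow> \<bar>Q s - Q t\<bar> \<le> e / 2"
      using CR[of "e / 2"] by auto
    obtain m where m: "1 / real (Suc m) < d" using arch[OF d(1)] by blast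
    have small: "1 / real (Suc k) < d" if "m \<le> k" for k
      using m that frac_le[of 1 1 "real (Suc m)" "real (Suc k)"] by simp
    have "dist (Q (1 / real (Suc k))) (Q (1 / real (Suc l))) < e" if "m \<le> k" "m \<le> l" for k l
      using d(2)[of "1 / real (Suc k)" "1 / real (Suc l)"] small[OF that(1)] small[OF that(2)] \<open>e > 0\<close>
      by (simp add: dist_real_def)
    then show "\<exists>M. \<forall>k\<ge>M. \<forall>l\<ge>M. dist (Q (1 / real (Suc k))) (Q (1 / real (Suc l))) < e" by blast
  qed
  then obtain D where D: "(\<lambda>k. Q (1 / real (Suc k))) \<longlonglongrightarrow> D"
    using Cauchy_convergent_iff convergent_def by blast
  have "(Q \<longlongrightarrow> D) (at 0)"
  proof (rule LIM_I)
    fix e :: real assume "e > 0"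
    then obtain d where d: "d > 0" "\<And>s t. s \<noteq> 0 \<Longrightarrow> t \<noteq> 0 \<Longrightarrow> \<bar>s\<bar> < d \<Longrightarrow> \<bar>t\<bar> < d \<Longrightarrow> \<bar>Q s - Q t\<bar> \<le> e / 2"
      using CR[of "e / 2"] by auto
    have "norm (Q t - D) < e" if t: "t \<noteq> 0" "norm (t - 0) < d" for t
    proof -
      have "\<bar>Q t - D\<bar> \<le> e / 2"
      proof (rule LIMSEQ_le_const2)
        show "(\<lambda>k. \<bar>Q t - Q (1 / real (Suc k))\<bar>) \<longlonglongrightarrow> \<bar>Q t - D\<bar>"
          by (intro tendsto_intros D)
        obtain m where m: "1 / real (Suc m) < d" using arch[OF d(1)] by blast
        have "\<bar>Q t - Q (1 / real (Suc k))\<bar> \<le> e / 2" if "m \<le> k" for k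
          using d(2)[of t "1 / real (Suc k)"] t m that frac_le[of 1 1 "real (Suc m)" "real (Suc k)"] by simp
        then show "\<exists>N. \<forall>k\<ge>N. \<bar>Q t - Q (1 / real (Suc k))\<bar> \<le> e / 2" by blast
      qed
      then show ?thesis using \<open>e > 0\<close> by simp
    qed
    then show "\<exists>d>0. \<forall>t. t \<noteq> 0 \<and> norm (t - 0) < d \<longrightarrow> norm (Q t - D) < e" using d(1) by blast
  qed
  then show "\<exists>D. (Q \<longlongrightarrow> D) (at 0)" by blast
qed

context carnot_haar
begin

text \<open>Off the null set \<open>Z'\<close> the functions \<open>u\<close> and \<open>u'\<close> agree at \<open>g\<close> and at all points \<open>g exp(qX)\<close> of \<open>\<Omega>\<close> with rational \<open>q\<close>, and
  by continuity of \<open>u\<close> on the line these points decide differentiability. This replaces the exceptional set by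
  a Borel set.\<close>
lemma AE_has_hderiv:
  assumes \<Omega>: "open \<Omega>" and u': "u' \<in> borel_measurable borel" and Z: "Z \<in> null_sets \<mu>"
    and eq: "\<And>g. g \<in> \<Omega> \<Longrightarrow> g \<notin> Z \<Longrightarrow> u g = u' g"
    and cont: "\<And>g. g \<in> \<Omega> \<Longrightarrow> isCont (\<lambda>t. u (g \<otimes> Exp (t *\<^sub>R X))) 0"
    and count: "\<And>g. countable {t. g \<otimes> Exp (t *\<^sub>R X) \<in> \<Omega> \<and> \<not> (\<exists>D. has_hderiv G X u (g \<otimes> Exp (t *\<^sub>R X)) D)}"
  shows "AE g in \<mu>. g \<in> \<Omega> \<longrightarrow> (\<exists>D. has_hderiv G X u g D)"
proof -
  define Z' where "Z' = (\<Union>q::rat. {g. g \<otimes> Exp (real_of_rat q *\<^sub>R X) \<in> Z})"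
  have Z': "Z' \<in> null_sets \<mu>"
    unfolding Z'_def by (intro null_sets_UN' null_right Z) (rule countableI_type)
  define Q where "Q f g t = (f (g \<otimes> Exp (t *\<^sub>R X)) - f g) / t" for f :: "'g \<Rightarrow> real" and g t
  have iff: "rat_Cauchy_at_0 (Q u' g) \<longleftrightarrow> (\<exists>D. has_hderiv G X u g D)"
    if g: "g \<in> \<Omega>" "g \<notin> Z'" for g
  proof -
    obtain \<delta> where \<delta>: "\<delta> > 0" "\<And>t. \<bar>t\<bar> < \<delta> \<Longrightarrow> g \<otimes> Exp (t *\<^sub>R X) \<in> \<Omega>"
      by (rule line_near[OF \<Omega> g(1), where X = X]) blast
    have nZ: "g \<otimes> Exp (real_of_rat q *\<^sub>R X) \<notin> Z" for q using g by (auto simp: Z'_def)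
    have "rat_Cauchy_at_0 (Q u' g) \<longleftrightarrow> (\<exists>D. (Q u g \<longlongrightarrow> D) (at 0))"
    proof (rule rat_Cauchy_at_0_iff[OF \<delta>(1)])
      fix t :: real assume t: "t \<noteq> 0" "\<bar>t\<bar> < \<delta>"
      have "isCont (\<lambda>s. u (g \<otimes> Exp (t *\<^sub>R X) \<otimes> Exp (s *\<^sub>R X))) 0" by (rule cont[OF \<delta>(2)[OF t(2)]])
      then have "isCont (\<lambda>s. u (g \<otimes> Exp ((t + s) *\<^sub>R X))) 0" by (simp add: Exp_add m_assoc)
      then have "isCont (\<lambda>t. u (g \<otimes> Exp (t *\<^sub>R X))) t"
        unfolding isCont_iff by simp
      then show "isCont (Q u g) t"
        unfolding Q_def[abs_def] using t(1) by (intro continuous_intros) auto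
    next
      fix q assume q: "\<bar>real_of_rat q\<bar> < \<delta>"
      show "Q u' g (real_of_rat q) = Q u g (real_of_rat q)"
        using eq[OF \<delta>(2)[OF q] nZ] eq[OF g(1)] nZ[of 0] by (simp add: Q_def)
    qed
    then show ?thesis by (simp add: has_hderiv_def Q_def[abs_def])
  qed
  define N where "N = {g \<in> \<Omega>. \<not> rat_Cauchy_at_0 (Q u' g)} - Z'"
  have "N \<in> null_sets \<mu>"
  proof (rule null_of_countable_line_sections)
    have [measurable]: "(\<lambda>g. u' (g \<otimes> Exp (t *\<^sub>R X))) \<in> borel_measurable borel" for t
      by (rule measurable_compose[OF borel_measurable_continuous_onI u'])
         (intro continuous_mult continuous_on_const continuous_on_id)
    note u'[measurable]
    have "{g \<in> space borel. \<not> rat_Cauchy_at_0 (Q u' g)} \<in> sets borel"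
      unfolding rat_Cauchy_at_0_def Q_def by measurable
    moreover have "Z' \<in> sets borel" using Z' by (auto simp: null_sets_def)
    moreover have "N = \<Omega> \<inter> {g \<in> space borel. \<not> rat_Cauchy_at_0 (Q u' g)} - Z'"
      by (auto simp: N_def)
    ultimately show "N \<in> sets borel" using \<Omega> by auto
    show "countable {t. g \<otimes> Exp (t *\<^sub>R X) \<in> N}" for g
      by (rule countable_subset[OF _ count[of g]]) (auto simp: N_def iff)
  qed
  from AE_not_in[OF this] AE_not_in[OF Z'] show ?thesis
  proof eventually_elim
    case (elim g)
    then show ?case using iff[of g] by (auto simp: N_def)
  qed
qed

end

section \<open>Subdifferentials along horizontal lines\<close>

lemma THE_has_hderiv: "has_hderiv G X u g D \<Longrightarrow> hderiv G X u g = D"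
  unfolding hderiv_def has_hderiv_def
  by (rule the_equality) (auto dest: tendsto_unique[rotated])

context carnot_group
begin

lemma has_hderiv_line:
  "has_hderiv G X u (g \<otimes> Exp (t *\<^sub>R X)) D \<longleftrightarrow> ((\<lambda>s. u (g \<otimes> Exp (s *\<^sub>R X))) has_real_derivative D) (at t)"
  by (simp add: has_hderiv_def DERIV_def Exp_add m_assoc)

lemma in_hplane: "v \<in> layer G 1 \<Longrightarrow> g \<otimes> Exp v \<in> hplane G g"
  by (auto simp: hplane_def)

end

locale cost_setting = carnot_group G
  for G :: "('g::{t2_space, second_countable_topology}, 'v::euclidean_space) stratified_struct" (structure) +
  fixes B :: "'v set" and \<Omega> :: "'g set" and c :: "'g \<Rightarrow> 'v \<Rightarrow> real" and u :: "'g \<Rightarrow> real"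
  assumes basis: "horizontal_basis G B"
    and open_Omega: "open \<Omega>"
    and c_cont: "\<forall>g\<in>\<Omega>. continuous_on (layer G 1) (c g)"
    and c1: "\<forall>v\<in>layer G 1. (\<lambda>g. c g v) \<in> Gamma11_loc G B"
      "\<forall>g\<^sub>0. \<forall>\<rho>>0. gball G g\<^sub>0 \<rho> \<subseteq> \<Omega> \<longrightarrow>
         (\<exists>K>0. \<forall>g\<in>gball G g\<^sub>0 \<rho>. \<forall>g'\<in>gball G g\<^sub>0 \<rho>. \<forall>v\<in>layer G 1.
            norm (hgrad G B (\<lambda>h. c h v) g' - hgrad G B (\<lambda>h. c h v) g) \<le> 2 * K * gdist G g' g)"
    and c2: "\<forall>g\<in>\<Omega>. \<forall>v :: nat \<Rightarrow> 'v. range v \<subseteq> layer G 1 \<longrightarrow>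
         filterlim (\<lambda>n. norm (v n)) at_top sequentially \<longrightarrow>
         (\<exists>g'\<in>hplane G g \<inter> \<Omega>. limsup (\<lambda>n. ereal (c g' (v n) - c g (v n))) = \<infinity>)"
    and u_convex: "cH_convex G c \<Omega> (\<lambda>g. ereal (u g))"
begin

abbreviation subdiff :: "'g \<Rightarrow> 'v set" where
  "subdiff g \<equiv> cH_subdiff G c \<Omega> (\<lambda>g. ereal (u g)) g"

lemma subdiff_iff: "p \<in> subdiff g \<longleftrightarrow> p \<in> layer G 1 \<and> (\<forall>g'\<in>hplane G g \<inter> \<Omega>. u g + c g' p - c g p \<le> u g')"
  by (simp add: cH_subdiff_def)

text \<open>A maximising sequence of minorants at \<open>g\<close> has bounded slopes by (c2), and every limit of its slopes
  belongs to the subdifferential.\<close>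
lemma subdiff_nonempty:
  assumes g: "g \<in> \<Omega>" shows "subdiff g \<noteq> {}"
proof -
  have sup: "ereal (u g) = (SUP (v, \<alpha>)\<in>cH_minorants G c \<Omega> (\<lambda>g. ereal (u g)) g. ereal (c g v + \<alpha>))"
    using u_convex g by (simp add: cH_convex_def)
  have "\<exists>v \<alpha>. (v, \<alpha>) \<in> cH_minorants G c \<Omega> (\<lambda>g. ereal (u g)) g \<and> u g - 1 / real (Suc n) < c g v + \<alpha>" for n
  proof -
    have "ereal (u g - 1 / real (Suc n)) < (SUP (v, \<alpha>)\<in>cH_minorants G c \<Omega> (\<lambda>g. ereal (u g)) g. ereal (c g v + \<alpha>))"
      unfolding sup[symmetric] by simp
    then show ?thesis unfolding less_SUP_iff by fastforce
  qed
  then obtain v \<alpha> where va: "\<And>n. (v n, \<alpha> n) \<in> cH_minorants G c \<Omega> (\<lambda>g. ereal (u g)) g"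
    "\<And>n. u g - 1 / real (Suc n) < c g (v n) + \<alpha> n" by metis
  have vL: "v n \<in> layer G 1" for n using va(1) by (auto simp: cH_minorants_def)
  have le: "c g' (v n) - c g (v n) \<le> u g' - u g + 1 / real (Suc n)" if "g' \<in> hplane G g \<inter> \<Omega>" for g' n
  proof -
    have "c g' (v n) + \<alpha> n \<le> u g'" using va(1)[of n] that by (auto simp: cH_minorants_def)
    then show ?thesis using va(2)[of n] by linarith
  qed
  have "\<not> filterlim (\<lambda>n. norm (v n)) at_top sequentially"
  proof
    assume "filterlim (\<lambda>n. norm (v n)) at_top sequentially"
    then obtain g' where g': "g' \<in> hplane G g \<inter> \<Omega>" "limsup (\<lambda>n. ereal (c g' (v n) - c g (v n))) = \<infinity>"
      using c2 g vL by blast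
    have "limsup (\<lambda>n. ereal (c g' (v n) - c g (v n))) \<le> ereal (u g' - u g + 1)"
    proof (rule Limsup_bounded[OF always_eventually], rule allI)
      fix n
      have "1 / real (Suc n) \<le> 1" by simp
      then have "c g' (v n) - c g (v n) \<le> u g' - u g + 1"
        using le[OF g'(1), of n] by linarith
      then show "ereal (c g' (v n) - c g (v n)) \<le> ereal (u g' - u g + 1)" by simp
    qed
    then show False using g'(2) by simp
  qed
  then obtain R where "\<not> eventually (\<lambda>n. R \<le> norm (v n)) sequentially"
    by (auto simp: filterlim_at_top)
  then have "infinite {n. norm (v n) < R}"
    by (simp add: eventually_sequentially infinite_nat_iff_unbounded_le not_le)
  then obtain r :: "nat \<Rightarrow> nat" where r: "strict_mono r" "\<And>n. norm (v (r n)) < R"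
    using infinite_enumerate[of "{n. norm (v n) < R}"] by auto
  have "compact (cball 0 R \<inter> layer G 1)"
    using closed_subspace[OF subspace_V1] by (intro compact_Int_closed compact_cball)
  moreover have "(v \<circ> r) n \<in> cball 0 R \<inter> layer G 1" for n
    using r(2)[of n] vL[of "r n"] by simp
  ultimately obtain p s where p: "p \<in> cball 0 R \<inter> layer G 1" "strict_mono s" "((v \<circ> r) \<circ> s) \<longlonglongrightarrow> p"
    unfolding compact_def by metis
  define k where "k n = r (s n)" for n
  have k: "strict_mono k" unfolding k_def[abs_def] using strict_mono_o[OF r(1) p(2)] by (simp add: o_def)
  have vk: "(\<lambda>n. v (k n)) \<longlonglongrightarrow> p" using p(3) by (simp add: o_def k_def)
  have cl: "(\<lambda>n. c h (v (k n))) \<longlonglongrightarrow> c h p" if "h \<in> \<Omega>" for h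
    using c_cont that vk p(1) vL by (auto intro!: continuous_on_tendsto_compose[of "layer G 1" "c h"])
  have "u g + c g' p - c g p \<le> u g'" if g': "g' \<in> hplane G g \<inter> \<Omega>" for g'
  proof -
    have "(\<lambda>n. 1 / real (Suc n)) \<longlonglongrightarrow> 0" using LIMSEQ_inverse_real_of_nat by (simp add: inverse_eq_divide)
    then have "(\<lambda>n. 1 / real (Suc (k n))) \<longlonglongrightarrow> 0" using LIMSEQ_subseq_LIMSEQ[OF _ k] by (simp add: o_def)
    then have "(\<lambda>n. u g' - u g + 1 / real (Suc (k n))) \<longlonglongrightarrow> u g' - u g + 0" by (intro tendsto_intros)
    moreover have "(\<lambda>n. c g' (v (k n)) - c g (v (k n))) \<longlonglongrightarrow> c g' p - c g p"
      using g' g by (intro tendsto_diff cl) auto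
    ultimately have "c g' p - c g p \<le> u g' - u g + 0"
      using le[OF g'] by (intro LIMSEQ_le[of "\<lambda>n. c g' (v (k n)) - c g (v (k n))"]) auto
    then show ?thesis by simp
  qed
  then have "p \<in> subdiff g" using p(1) by (simp add: subdiff_iff)
  then show ?thesis by auto
qed

lemma B_V1: "X \<in> B \<Longrightarrow> X \<in> layer G 1" and B_norm: "X \<in> B \<Longrightarrow> norm X = 1"
  using basis by (auto simp: horizontal_basis_def)

lemma B_indep: "independent B"
proof (rule pairwise_orthogonal_independent)
  show "pairwise orthogonal B" using basis by (simp add: horizontal_basis_def)
  show "0 \<notin> B" using B_norm[of 0] by auto
qed

lemma finite_B: "finite B" using B_indep by (rule independent_imp_finite)

lemma B_inner: "X \<in> B \<Longrightarrow> Y \<in> B \<Longrightarrow> X \<bullet> Y = (if X = Y then 1 else 0)"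
  using basis B_norm[of X] by (auto simp: horizontal_basis_def pairwise_def orthogonal_def dot_square_norm)

lemma hgrad_inner: "X \<in> B \<Longrightarrow> hgrad G B f g \<bullet> X = hderiv G X f g"
proof -
  assume X: "X \<in> B"
  have "hgrad G B f g \<bullet> X = (\<Sum>Y\<in>B. if Y = X then hderiv G X f g else 0)"
    unfolding hgrad_def inner_sum_left by (rule sum.cong) (use X in \<open>auto simp: B_inner\<close>)
  then show ?thesis using X finite_B by simp
qed

lemma c_hderiv: "X \<in> B \<Longrightarrow> v \<in> layer G 1 \<Longrightarrow> has_hderiv G X (\<lambda>h. c h v) g (hderiv G X (\<lambda>h. c h v) g)"
proof -
  assume "X \<in> B" "v \<in> layer G 1"
  then obtain D where "has_hderiv G X (\<lambda>h. c h v) g D" using c1(1) by (fastforce simp: Gamma11_loc_def Gamma1_def)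
  then show ?thesis using THE_has_hderiv by metis
qed

text \<open>Along the line in direction \<open>X\<close> the function \<open>u - c(\<cdot>, p)\<close> has a local minimum at \<open>g\<close>.\<close>
lemma subdiff_hderiv:
  assumes g: "g \<in> \<Omega>" and p: "p \<in> subdiff g" and X: "X \<in> B" and D: "has_hderiv G X u g D"
  shows "D = hderiv G X (\<lambda>h. c h p) g"
proof -
  define F where "F t = u (g \<otimes> Exp (t *\<^sub>R X)) - c (g \<otimes> Exp (t *\<^sub>R X)) p" for t
  have pL: "p \<in> layer G 1" using p by (simp add: subdiff_iff)
  have "(F has_real_derivative D - hderiv G X (\<lambda>h. c h p) g) (at 0)"
    unfolding F_def using D c_hderiv[OF X pL, of g]
      has_hderiv_line[of X u g 0] has_hderiv_line[of X "\<lambda>h. c h p" g 0] by (intro DERIV_diff) auto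
  moreover obtain \<delta> where \<delta>: "\<delta> > 0" "\<And>t. \<bar>t\<bar> < \<delta> \<Longrightarrow> g \<otimes> Exp (t *\<^sub>R X) \<in> \<Omega>"
    by (rule line_near[OF open_Omega g, where X = X]) blast
  have "F 0 \<le> F t" if "\<bar>0 - t\<bar> < \<delta>" for t
  proof -
    have "g \<otimes> Exp (t *\<^sub>R X) \<in> hplane G g \<inter> \<Omega>"
      using that \<delta>(2) in_hplane B_V1[OF X] subspace_V1 by (auto simp: subspace_scale)
    then show ?thesis using p by (force simp: subdiff_iff F_def)
  qed
  ultimately have "D - hderiv G X (\<lambda>h. c h p) g = 0"
    using \<delta>(1) by (intro DERIV_local_min[of F _ 0 \<delta>]) auto
  then show ?thesis by simp
qed

text \<open>On a small neighbourhood the horizontal derivatives of all cost functions are Lipschitz along the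
  lines of \<open>B\<close> with one constant, so each of them is approximated quadratically, uniformly in the slope.\<close>
lemma local_cost_bounds:
  assumes "g\<^sub>0 \<in> \<Omega>"
  obtains U \<kappa> where "open U" "g\<^sub>0 \<in> U" "U \<subseteq> \<Omega>" "0 \<le> \<kappa>"
    "\<And>h s X Y v. h \<in> U \<Longrightarrow> h \<otimes> Exp (s *\<^sub>R X) \<in> U \<Longrightarrow> X \<in> B \<Longrightarrow> Y \<in> B \<Longrightarrow> v \<in> layer G 1 \<Longrightarrow>
      \<bar>hderiv G Y (\<lambda>h. c h v) (h \<otimes> Exp (s *\<^sub>R X)) - hderiv G Y (\<lambda>h. c h v) h\<bar> \<le> \<kappa> * \<bar>s\<bar>"
    "\<And>h s X v. (\<And>\<sigma>. \<sigma> \<in> closed_segment 0 s \<Longrightarrow> h \<otimes> Exp (\<sigma> *\<^sub>R X) \<in> U) \<Longrightarrow> X \<in> B \<Longrightarrow> v \<in> layer G 1 \<Longrightarrow>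
      s * hderiv G X (\<lambda>h. c h v) h - \<kappa> * s\<^sup>2 \<le> c (h \<otimes> Exp (s *\<^sub>R X)) v - c h v"
proof -
  obtain \<rho> where \<rho>: "\<rho> > 0" "gball G g\<^sub>0 \<rho> \<subseteq> \<Omega>" by (rule gball_subset_open[OF open_Omega assms])
  define U where "U = gball G g\<^sub>0 \<rho>"
  have "\<exists>K>0. \<forall>g\<in>gball G g\<^sub>0 \<rho>. \<forall>g'\<in>gball G g\<^sub>0 \<rho>. \<forall>v\<in>layer G 1.
            norm (hgrad G B (\<lambda>h. c h v) g' - hgrad G B (\<lambda>h. c h v) g) \<le> 2 * K * gdist G g' g"
    using c1(2) \<rho> by blast
  then obtain K where K: "K > 0" "\<And>g g' v. g \<in> U \<Longrightarrow> g' \<in> U \<Longrightarrow> v \<in> layer G 1 \<Longrightarrow>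
            norm (hgrad G B (\<lambda>h. c h v) g' - hgrad G B (\<lambda>h. c h v) g) \<le> 2 * K * gdist G g' g"
    unfolding U_def by blast
  define \<kappa> where "\<kappa> = 2 * K"
  have lip: "\<bar>hderiv G Y (\<lambda>h. c h v) (h \<otimes> Exp (s *\<^sub>R X)) - hderiv G Y (\<lambda>h. c h v) h\<bar> \<le> \<kappa> * \<bar>s\<bar>"
    if h: "h \<in> U" "h \<otimes> Exp (s *\<^sub>R X) \<in> U" "X \<in> B" "Y \<in> B" "v \<in> layer G 1" for h s X Y v
  proof -
    let ?g = "hgrad G B (\<lambda>h. c h v)"
    have "\<bar>hderiv G Y (\<lambda>h. c h v) (h \<otimes> Exp (s *\<^sub>R X)) - hderiv G Y (\<lambda>h. c h v) h\<bar> = \<bar>(?g (h \<otimes> Exp (s *\<^sub>R X)) - ?g h) \<bullet> Y\<bar>"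
      using hgrad_inner[OF h(4)] by (simp add: inner_diff_left)
    also have "\<dots> \<le> norm (?g (h \<otimes> Exp (s *\<^sub>R X)) - ?g h)"
      using Cauchy_Schwarz_ineq2[of "?g (h \<otimes> Exp (s *\<^sub>R X)) - ?g h" Y] B_norm[OF h(4)] by simp
    also have "\<dots> \<le> 2 * K * gdist G (h \<otimes> Exp (s *\<^sub>R X)) h" using K(2) h by blast
    also have "gdist G (h \<otimes> Exp (s *\<^sub>R X)) h = \<bar>s\<bar>"
      using gdist_line[OF B_V1[OF h(3)], of h s 0] B_norm[OF h(3)] by simp
    finally show ?thesis by (simp add: \<kappa>_def)
  qed
  have quad: "s * hderiv G X (\<lambda>h. c h v) h - \<kappa> * s\<^sup>2 \<le> c (h \<otimes> Exp (s *\<^sub>R X)) v - c h v"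
    if seg: "\<And>\<sigma>. \<sigma> \<in> closed_segment 0 s \<Longrightarrow> h \<otimes> Exp (\<sigma> *\<^sub>R X) \<in> U" and X: "X \<in> B" and v: "v \<in> layer G 1" for h s X v
  proof -
    define d where "d \<sigma> = hderiv G X (\<lambda>h. c h v) (h \<otimes> Exp (\<sigma> *\<^sub>R X))" for \<sigma>
    define \<phi> where "\<phi> \<sigma> = c (h \<otimes> Exp (\<sigma> *\<^sub>R X)) v" for \<sigma>
    have der: "(\<phi> has_real_derivative d \<sigma>) (at \<sigma>)" for \<sigma>
      unfolding \<phi>_def d_def by (rule has_hderiv_line[THEN iffD1, OF c_hderiv[OF X v]])
    obtain \<sigma> where \<sigma>: "\<sigma> \<in> closed_segment 0 s" "\<phi> s - \<phi> 0 = s * d \<sigma>"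
    proof (cases s "0::real" rule: linorder_cases)
      case less
      from MVT2[OF less der] obtain z where "s < z" "z < 0" "\<phi> 0 - \<phi> s = (0 - s) * d z" by blast
      then show ?thesis using less by (intro that[of z]) (auto simp: closed_segment_eq_real_ivl)
    next
      case equal
      then show ?thesis by (intro that[of 0]) auto
    next
      case greater
      from MVT2[OF greater der] obtain z where "0 < z" "z < s" "\<phi> s - \<phi> 0 = (s - 0) * d z" by blast
      then show ?thesis using greater by (intro that[of z]) (auto simp: closed_segment_eq_real_ivl)
    qed
    have hU: "h \<in> U" using seg[of 0] by simp
    have "\<bar>d \<sigma> - d 0\<bar> \<le> \<kappa> * \<bar>\<sigma>\<bar>" unfolding d_def using lip[OF hU seg[OF \<sigma>(1)] X X v] by simp
    also have "\<dots> \<le> \<kappa> * \<bar>s\<bar>"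
      using \<sigma>(1) K(1) by (intro mult_left_mono) (auto simp: closed_segment_eq_real_ivl \<kappa>_def split: if_splits)
    finally have "\<bar>s\<bar> * \<bar>d \<sigma> - d 0\<bar> \<le> \<bar>s\<bar> * (\<kappa> * \<bar>s\<bar>)" by (intro mult_left_mono) auto
    then have "\<bar>s * d \<sigma> - s * d 0\<bar> \<le> \<kappa> * s\<^sup>2"
      by (simp add: abs_mult[symmetric] right_diff_distrib power2_eq_square mult.left_commute)
    then show ?thesis using \<sigma>(2) by (simp add: \<phi>_def d_def abs_le_iff)
  qed
  show ?thesis
    using that[of U \<kappa>] open_gball gball_center \<rho> K(1) lip quad by (simp add: U_def \<kappa>_def)
qed

text \<open>The slope at parameter \<open>s\<close> is the horizontal derivative of \<open>c(\<cdot>, p)\<close> for a chosen subgradient \<open>p\<close> at that point.\<close>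
lemma line_support:
  assumes g: "g \<in> \<Omega>" and X: "X \<in> B"
  obtains \<delta> \<kappa> m where "\<delta> > 0" "\<And>t. t \<in> ball 0 \<delta> \<Longrightarrow> g \<otimes> Exp (t *\<^sub>R X) \<in> \<Omega>"
    "\<And>s t. s \<in> ball 0 \<delta> \<Longrightarrow> t \<in> ball 0 \<delta> \<Longrightarrow>
      u (g \<otimes> Exp (t *\<^sub>R X)) \<ge> u (g \<otimes> Exp (s *\<^sub>R X)) + m s * (t - s) - \<kappa> * (t - s)\<^sup>2"
proof -
  obtain U \<kappa> where U: "open U" "g \<in> U" "U \<subseteq> \<Omega>"
    and quad: "\<And>h s X v. (\<And>\<sigma>. \<sigma> \<in> closed_segment 0 s \<Longrightarrow> h \<otimes> Exp (\<sigma> *\<^sub>R X) \<in> U) \<Longrightarrow> X \<in> B \<Longrightarrow> v \<in> layer G 1 \<Longrightarrow>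
      s * hderiv G X (\<lambda>h. c h v) h - \<kappa> * s\<^sup>2 \<le> c (h \<otimes> Exp (s *\<^sub>R X)) v - c h v"
    using local_cost_bounds[OF g] by metis
  obtain \<delta> where \<delta>: "\<delta> > 0" "\<And>t. \<bar>t\<bar> < \<delta> \<Longrightarrow> g \<otimes> Exp (t *\<^sub>R X) \<in> U"
    by (rule line_near[OF U(1,2), where X = X]) blast
  define P where "P s = (SOME p. p \<in> subdiff (g \<otimes> Exp (s *\<^sub>R X)))" for s
  define m where "m s = hderiv G X (\<lambda>h. c h (P s)) (g \<otimes> Exp (s *\<^sub>R X))" for s
  have "u (g \<otimes> Exp (t *\<^sub>R X)) \<ge> u (g \<otimes> Exp (s *\<^sub>R X)) + m s * (t - s) - \<kappa> * (t - s)\<^sup>2"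
    if st: "s \<in> ball 0 \<delta>" "t \<in> ball 0 \<delta>" for s t
  proof -
    define h where "h = g \<otimes> Exp (s *\<^sub>R X)"
    have hl: "h \<otimes> Exp (\<sigma> *\<^sub>R X) = g \<otimes> Exp ((s + \<sigma>) *\<^sub>R X)" for \<sigma>
      by (simp add: h_def Exp_add m_assoc)
    have "h \<in> \<Omega>" using \<delta>(2)[of s] st U by (auto simp: h_def dist_real_def)
    then have P: "P s \<in> subdiff h" unfolding P_def h_def using subdiff_nonempty some_in_eq by blast
    then have PL: "P s \<in> layer G 1" by (simp add: subdiff_iff)
    have seg: "h \<otimes> Exp (\<sigma> *\<^sub>R X) \<in> U" if "\<sigma> \<in> closed_segment 0 (t - s)" for \<sigma>
      unfolding hl using that st by (intro \<delta>(2)) (auto simp: closed_segment_eq_real_ivl dist_real_def split: if_splits)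
    have "h \<otimes> Exp ((t - s) *\<^sub>R X) \<in> hplane G h \<inter> \<Omega>"
      using seg[of "t - s"] U in_hplane B_V1[OF X] subspace_V1 by (auto simp: subspace_scale)
    then have "u h + c (h \<otimes> Exp ((t - s) *\<^sub>R X)) (P s) - c h (P s) \<le> u (h \<otimes> Exp ((t - s) *\<^sub>R X))"
      using P unfolding subdiff_iff by blast
    moreover have "(t - s) * m s - \<kappa> * (t - s)\<^sup>2 \<le> c (h \<otimes> Exp ((t - s) *\<^sub>R X)) (P s) - c h (P s)"
      unfolding m_def h_def[symmetric] by (rule quad[OF seg X PL])
    ultimately show ?thesis by (simp add: hl h_def[symmetric] mult.commute)
  qed
  moreover have "g \<otimes> Exp (t *\<^sub>R X) \<in> \<Omega>" if "t \<in> ball 0 \<delta>" for t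
    using \<delta>(2)[of t] that U by (auto simp: dist_real_def)
  ultimately show ?thesis using that \<delta>(1) by blast
qed

lemma isCont_line:
  assumes g: "g \<in> \<Omega>" and X: "X \<in> B"
  shows "isCont (\<lambda>t. u (g \<otimes> Exp (t *\<^sub>R X))) 0"
proof -
  obtain \<delta> \<kappa> m where "\<delta> > 0" and sp: "\<And>s t. s \<in> ball 0 \<delta> \<Longrightarrow> t \<in> ball 0 \<delta> \<Longrightarrow>
      u (g \<otimes> Exp (t *\<^sub>R X)) \<ge> u (g \<otimes> Exp (s *\<^sub>R X)) + m s * (t - s) - \<kappa> * (t - s)\<^sup>2"
    using line_support[OF g X] by metis
  then show ?thesis
    by (intro supporting_parabola_continuous[of "ball 0 \<delta>" 0 "\<lambda>t. u (g \<otimes> Exp (t *\<^sub>R X))" m \<kappa>]) auto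
qed

text \<open>Countability holds near each parameter of the line in \<open>\<Omega>\<close> and passes to all of them by Lindeloef's theorem.\<close>
lemma countable_nondifferentiable_line:
  assumes X: "X \<in> B"
  shows "countable {t. g \<otimes> Exp (t *\<^sub>R X) \<in> \<Omega> \<and> \<not> (\<exists>D. has_hderiv G X u (g \<otimes> Exp (t *\<^sub>R X)) D)}"
proof -
  define bad where "bad = {t. g \<otimes> Exp (t *\<^sub>R X) \<in> \<Omega> \<and> \<not> (\<exists>D. has_hderiv G X u (g \<otimes> Exp (t *\<^sub>R X)) D)}"
  define F where "F = {S. open S \<and> countable (bad \<inter> S)}"
  have cover: "t \<in> \<Union>F" if t: "g \<otimes> Exp (t *\<^sub>R X) \<in> \<Omega>" for t
  proof -
    obtain \<delta> \<kappa> m where \<delta>: "\<delta> > 0" and sp: "\<And>r s. r \<in> ball 0 \<delta> \<Longrightarrow> s \<in> ball 0 \<delta> \<Longrightarrow>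
      u (g \<otimes> Exp (t *\<^sub>R X) \<otimes> Exp (s *\<^sub>R X)) \<ge> u (g \<otimes> Exp (t *\<^sub>R X) \<otimes> Exp (r *\<^sub>R X)) + m r * (s - r) - \<kappa> * (s - r)\<^sup>2"
      using line_support[OF t X] by metis
    have "countable {s \<in> ball 0 \<delta>. \<not> (\<exists>D. ((\<lambda>s. u (g \<otimes> Exp (t *\<^sub>R X) \<otimes> Exp (s *\<^sub>R X))) has_real_derivative D) (at s))}"
      by (rule supporting_parabola_differentiable[OF open_ball sp])
    then have "countable ((\<lambda>s. t + s) ` {s \<in> ball 0 \<delta>. \<not> (\<exists>D. has_hderiv G X u (g \<otimes> Exp (t *\<^sub>R X) \<otimes> Exp (s *\<^sub>R X)) D)})"
      unfolding has_hderiv_line by (rule countable_image)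
    moreover have "bad \<inter> ball t \<delta> \<subseteq> (\<lambda>s. t + s) ` {s \<in> ball 0 \<delta>. \<not> (\<exists>D. has_hderiv G X u (g \<otimes> Exp (t *\<^sub>R X) \<otimes> Exp (s *\<^sub>R X)) D)}"
    proof
      fix r assume r: "r \<in> bad \<inter> ball t \<delta>"
      have "g \<otimes> Exp (t *\<^sub>R X) \<otimes> Exp ((r - t) *\<^sub>R X) = g \<otimes> Exp (r *\<^sub>R X)"
        using Exp_add[of t "r - t" X] by (simp add: m_assoc)
      then show "r \<in> (\<lambda>s. t + s) ` {s \<in> ball 0 \<delta>. \<not> (\<exists>D. has_hderiv G X u (g \<otimes> Exp (t *\<^sub>R X) \<otimes> Exp (s *\<^sub>R X)) D)}"
        using r by (intro image_eqI[of _ _ "r - t"]) (auto simp: bad_def dist_real_def)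
    qed
    ultimately have "countable (bad \<inter> ball t \<delta>)" using countable_subset by blast
    then show ?thesis using \<delta> by (auto simp: F_def intro!: exI[of _ "ball t \<delta>"])
  qed
  obtain F' where F': "F' \<subseteq> F" "countable F'" "\<Union>F' = \<Union>F"
    by (rule Lindelof[of F]) (auto simp: F_def)
  have "bad \<subseteq> (\<Union>S\<in>F'. bad \<inter> S)"
    using cover F'(3) by (auto simp: bad_def)
  moreover have "countable (\<Union>S\<in>F'. bad \<inter> S)"
    using F' by (intro countable_UN) (auto simp: F_def)
  ultimately show ?thesis unfolding bad_def[symmetric] by (rule countable_subset)
qed

end

section \<open>Measurability in step at most two\<close>

locale cost_setting_step_le_2 = cost_setting G B \<Omega> c u + carnot_group_step_le_2 G
  for G :: "('g::{t2_space, second_countable_topology}, 'v::euclidean_space) stratified_struct" (structure)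
    and B \<Omega> c u
begin

text \<open>In the coordinates \<open>exp(xX + yY + z[X, Y])\<close> the group generated by \<open>X\<close> and \<open>Y\<close> has the multiplication of the
  Heisenberg group.\<close>
lemma Exp_mult_heisenberg:
  assumes X: "X \<in> layer G 1" and Y: "Y \<in> layer G 1"
  shows "Exp (x *\<^sub>R X + y *\<^sub>R Y + z *\<^sub>R ad X Y) \<otimes> Exp (a *\<^sub>R X + b *\<^sub>R Y)
    = Exp ((x + a) *\<^sub>R X + (y + b) *\<^sub>R Y + (z + (x * b - y * a) / 2) *\<^sub>R ad X Y)"
proof -
  have "ad (x *\<^sub>R X + y *\<^sub>R Y) (a *\<^sub>R X + b *\<^sub>R Y) = (x * b - y * a) *\<^sub>R ad X Y"
    using ad_skew[of Y X]
    by (simp add: linear_add[OF linear_ad] linear_add[OF linear_ad_left] ad_scale algebra_simps)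
  moreover have "x *\<^sub>R X + y *\<^sub>R Y \<in> layer G 1" "a *\<^sub>R X + b *\<^sub>R Y \<in> layer G 1" "z *\<^sub>R ad X Y \<in> V2"
    by (intro V1_add V1_scale V2_scale ad_V2 X Y)+
  note Exp_mult[OF this subspace_0[OF subspace_V2]]
  ultimately have "Exp (x *\<^sub>R X + y *\<^sub>R Y + z *\<^sub>R ad X Y) \<otimes> Exp ((a *\<^sub>R X + b *\<^sub>R Y) + 0)
    = Exp (x *\<^sub>R X + y *\<^sub>R Y + (a *\<^sub>R X + b *\<^sub>R Y) + (z *\<^sub>R ad X Y + 0 + (1/2) *\<^sub>R ((x * b - y * a) *\<^sub>R ad X Y)))"
    by (simp only:)
  also have "x *\<^sub>R X + y *\<^sub>R Y + (a *\<^sub>R X + b *\<^sub>R Y) + (z *\<^sub>R ad X Y + 0 + (1/2) *\<^sub>R ((x * b - y * a) *\<^sub>R ad X Y))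
    = (x + a) *\<^sub>R X + (y + b) *\<^sub>R Y + (z + (x * b - y * a) / 2) *\<^sub>R ad X Y"
    by (simp add: algebra_simps diff_divide_distrib)
  finally show ?thesis by simp
qed

text \<open>Along \<open>aX + bY\<close> the cost is estimated on the three-segment path
  \<open>exp(aX + bY) = exp(aX/2) exp(bY) exp(aX/2)\<close>, and the resulting quadratic support turns
  \<open>u\<close>, restricted to a coset of the subgroup generated by \<open>X\<close> and \<open>Y\<close>, into a semiconvex function on the
  Heisenberg group.\<close>
lemma vertical_tendsto:
  assumes g\<^sub>0: "g\<^sub>0 \<in> \<Omega>" and X: "X \<in> B" and Y: "Y \<in> B"
  shows "((\<lambda>t. u (g\<^sub>0 \<otimes> Exp (t *\<^sub>R ad X Y))) \<longlongrightarrow> u g\<^sub>0) (at 0)"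
proof -
  note XL = B_V1[OF X] and YL = B_V1[OF Y]
  obtain U \<kappa> where U: "open U" "g\<^sub>0 \<in> U" "U \<subseteq> \<Omega>" and \<kappa>: "0 \<le> \<kappa>"
    and lip: "\<And>h s X Y v. h \<in> U \<Longrightarrow> h \<otimes> Exp (s *\<^sub>R X) \<in> U \<Longrightarrow> X \<in> B \<Longrightarrow> Y \<in> B \<Longrightarrow> v \<in> layer G 1 \<Longrightarrow>
      \<bar>hderiv G Y (\<lambda>h. c h v) (h \<otimes> Exp (s *\<^sub>R X)) - hderiv G Y (\<lambda>h. c h v) h\<bar> \<le> \<kappa> * \<bar>s\<bar>"
    and quad: "\<And>h s X v. (\<And>\<sigma>. \<sigma> \<in> closed_segment 0 s \<Longrightarrow> h \<otimes> Exp (\<sigma> *\<^sub>R X) \<in> U) \<Longrightarrow> X \<in> B \<Longrightarrow> v \<in> layer G 1 \<Longrightarrow>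
      s * hderiv G X (\<lambda>h. c h v) h - \<kappa> * s\<^sup>2 \<le> c (h \<otimes> Exp (s *\<^sub>R X)) v - c h v"
    by (rule local_cost_bounds[OF g\<^sub>0]) blast
  define W where "W p = g\<^sub>0 \<otimes> Exp (fst p *\<^sub>R X + fst (snd p) *\<^sub>R Y + snd (snd p) *\<^sub>R ad X Y)"
    for p :: "real \<times> real \<times> real"
  have "continuous_on UNIV W" unfolding W_def
    by (intro continuous_mult continuous_on_const continuous_on_compose2[OF continuous_Exp[of UNIV]] continuous_intros) auto
  then have "open (W -` U)" using U(1) by (simp add: continuous_on_open_vimage)
  moreover have "0 \<in> W -` U" using U(2) by (simp add: W_def)
  ultimately obtain \<eta> where \<eta>: "\<eta> > 0" "ball 0 \<eta> \<subseteq> W -` U" using open_contains_ball by blast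
  \<comment> \<open>The dilation by \<open>\<delta>\<close> moves the box of size 100 into \<open>U\<close>. The paths between points of the box of size 4 used
    below stay in the box of size 100.\<close>
  define \<delta> where "\<delta> = min 1 (\<eta> / 400)"
  have \<delta>: "0 < \<delta>" "\<delta> \<le> 1" "\<delta> * 100 \<le> \<eta> / 4" using \<eta>(1) by (auto simp: \<delta>_def)
  define pos where "pos x y z = W (\<delta> * x, \<delta> * y, \<delta>\<^sup>2 * z)" for x y z
  have posU: "pos x y z \<in> U" if "\<bar>x\<bar> \<le> 100" "\<bar>y\<bar> \<le> 100" "\<bar>z\<bar> \<le> 100" for x y z
  proof -
    have 1: "\<delta> * \<bar>t\<bar> \<le> \<eta> / 4" if "\<bar>t\<bar> \<le> 100" for t
      using mult_left_mono[OF that, of \<delta>] \<delta> by linarith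
    have "\<delta>\<^sup>2 * \<bar>z\<bar> \<le> \<delta> * \<bar>z\<bar>" using \<delta> by (intro mult_right_mono) (auto simp: power2_eq_square mult_le_cancel_left1)
    then have 2: "\<delta>\<^sup>2 * \<bar>z\<bar> \<le> \<eta> / 4" using 1[OF that(3)] by linarith
    have "norm (\<delta> * x, \<delta> * y, \<delta>\<^sup>2 * z) \<le> norm (\<delta> * x) + (norm (\<delta> * y) + norm (\<delta>\<^sup>2 * z))"
      using norm_Pair_le[of "\<delta> * x" "(\<delta> * y, \<delta>\<^sup>2 * z)"] norm_Pair_le[of "\<delta> * y" "\<delta>\<^sup>2 * z"] by linarith
    also have "\<dots> = \<delta> * \<bar>x\<bar> + (\<delta> * \<bar>y\<bar> + \<delta>\<^sup>2 * \<bar>z\<bar>)" using \<delta> by (simp add: abs_mult)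
    also have "\<dots> < \<eta>" using 1[OF that(1)] 1[OF that(2)] 2 \<eta>(1) by linarith
    finally show ?thesis using \<eta>(2) by (auto simp: pos_def)
  qed
  have posm: "pos x y z \<otimes> Exp ((\<delta> * a) *\<^sub>R X + (\<delta> * b) *\<^sub>R Y) = pos (x + a) (y + b) (z + (x * b - y * a) / 2)" for x y z a b
  proof -
    have e: "\<delta> * x + \<delta> * a = \<delta> * (x + a)" "\<delta> * y + \<delta> * b = \<delta> * (y + b)"
      "\<delta>\<^sup>2 * z + (\<delta> * x * (\<delta> * b) - \<delta> * y * (\<delta> * a)) / 2 = \<delta>\<^sup>2 * (z + (x * b - y * a) / 2)"
      by (simp_all add: power2_eq_square field_simps)
    show ?thesis unfolding pos_def W_def fst_conv snd_conv m_assoc[OF carrier carrier carrier]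
        Exp_mult_heisenberg[OF XL YL] e ..
  qed
  have posX: "pos x y z \<otimes> Exp ((\<delta> * a) *\<^sub>R X) = pos (x + a) y (z - y * a / 2)"
    and posY: "pos x y z \<otimes> Exp ((\<delta> * b) *\<^sub>R Y) = pos x (y + b) (z + x * b / 2)" for x y z a b
    using posm[of x y z a 0] posm[of x y z 0 b] by simp_all
  define w where "w x y z = u (pos x y z)" for x y z
  have "heisenberg_semiconvex w (2 * \<kappa>)"
  proof
    show "0 \<le> 2 * \<kappa>" using \<kappa> by simp
    fix x y z :: real assume xyz: "\<bar>x\<bar> \<le> 4" "\<bar>y\<bar> \<le> 4" "\<bar>z\<bar> \<le> 4"
    define h where "h = pos x y z"
    have hU: "h \<in> U" unfolding h_def using xyz by (intro posU) auto
    then obtain p where p: "p \<in> subdiff h" using subdiff_nonempty U(3) by blast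
    then have pL: "p \<in> layer G 1" by (simp add: subdiff_iff)
    define dX where "dX g = hderiv G X (\<lambda>h. c h p) g" for g
    define dY where "dY g = hderiv G Y (\<lambda>h. c h p) g" for g
    have "w x y z + \<delta> * dX h * a + \<delta> * dY h * b - 2 * \<kappa> * (a\<^sup>2 + b\<^sup>2) \<le> w (x + a) (y + b) (z + (x * b - y * a) / 2)"
      if ab: "\<bar>x + a\<bar> \<le> 4" "\<bar>y + b\<bar> \<le> 4" "\<bar>z + (x * b - y * a) / 2\<bar> \<le> 4" for a b
    proof -
      define s where "s = \<delta> * (a / 2)"
      define t where "t = \<delta> * b"
      define z\<^sub>1 where "z\<^sub>1 = z - y * (a / 2) / 2"
      define z\<^sub>2 where "z\<^sub>2 = z\<^sub>1 + (x + a / 2) * b / 2"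
      have a8: "\<bar>a\<bar> \<le> 8" and b8: "\<bar>b\<bar> \<le> 8" using xyz ab by linarith+
      have half: "\<bar>r * (a / 2)\<bar> \<le> 4" if "0 \<le> r" "r \<le> 1" for r
        using mult_mono[of "\<bar>r\<bar>" 1 "\<bar>a / 2\<bar>" 4] a8 that by (simp add: abs_mult)
      have full: "\<bar>r * b\<bar> \<le> 8" if "0 \<le> r" "r \<le> 1" for r
        using mult_mono[of "\<bar>r\<bar>" 1 "\<bar>b\<bar>" 8] b8 that by (simp add: abs_mult)
      have prod: "\<bar>k * l\<bar> \<le> K * L" if "\<bar>k\<bar> \<le> K" "\<bar>l\<bar> \<le> L" for k l K L :: real
        unfolding abs_mult using that by (intro mult_mono) auto
      have z1: "\<bar>z\<^sub>1\<bar> \<le> 12" using prod[OF xyz(2) half[of 1]] xyz(3) by (simp add: z\<^sub>1_def)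
      have xa: "\<bar>x + a / 2\<bar> \<le> 8" using xyz(1) a8 by linarith
      have z2: "\<bar>z\<^sub>2\<bar> \<le> 44" using prod[OF xa full[of 1]] z1 by (simp add: z\<^sub>2_def)
      \<comment> \<open>The three-segment path from \<open>h\<close> to \<open>h\<^sub>3\<close>; on each segment the cost is compared with its derivative at \<open>h\<close>.\<close>
      define h\<^sub>1 where "h\<^sub>1 = h \<otimes> Exp (s *\<^sub>R X)"
      define h\<^sub>2 where "h\<^sub>2 = h\<^sub>1 \<otimes> Exp (t *\<^sub>R Y)"
      define h\<^sub>3 where "h\<^sub>3 = h\<^sub>2 \<otimes> Exp (s *\<^sub>R X)"
      have h1: "h\<^sub>1 = pos (x + a / 2) y z\<^sub>1" by (simp only: h\<^sub>1_def h_def s_def posX z\<^sub>1_def)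
      have h2: "h\<^sub>2 = pos (x + a / 2) (y + b) z\<^sub>2" by (simp only: h\<^sub>2_def h1 t_def posY z\<^sub>2_def)
      have seg: "\<exists>r. 0 \<le> r \<and> r \<le> 1 \<and> \<sigma> = \<delta> * (r * q)" if "\<sigma> \<in> closed_segment 0 (\<delta> * q)" for \<sigma> q
        using that by (auto simp: closed_segment_def mult_ac)
      have seg1: "h \<otimes> Exp (\<sigma> *\<^sub>R X) \<in> U" if \<sigma>: "\<sigma> \<in> closed_segment 0 s" for \<sigma>
      proof -
        obtain r where r: "0 \<le> r" "r \<le> 1" "\<sigma> = \<delta> * (r * (a / 2))" using seg \<sigma> s_def by blast
        show ?thesis unfolding r(3) h_def posX
          using half[OF r(1,2)] prod[OF xyz(2) half[OF r(1,2)]] xyz by (intro posU; linarith)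
      qed
      have seg2: "h\<^sub>1 \<otimes> Exp (\<sigma> *\<^sub>R Y) \<in> U" if \<sigma>: "\<sigma> \<in> closed_segment 0 t" for \<sigma>
      proof -
        obtain r where r: "0 \<le> r" "r \<le> 1" "\<sigma> = \<delta> * (r * b)" using seg \<sigma> t_def by blast
        define q where "q = (x + a / 2) * (r * b)"
        have "\<bar>q\<bar> \<le> 8 * 8" unfolding q_def by (rule prod[OF xa full[OF r(1,2)]])
        then show ?thesis unfolding r(3) h1 posY q_def[symmetric]
          using full[OF r(1,2)] xyz xa z1 by (intro posU; linarith)
      qed
      have seg3: "h\<^sub>2 \<otimes> Exp (\<sigma> *\<^sub>R X) \<in> U" if \<sigma>: "\<sigma> \<in> closed_segment 0 s" for \<sigma>
      proof -
        obtain r where r: "0 \<le> r" "r \<le> 1" "\<sigma> = \<delta> * (r * (a / 2))" using seg \<sigma> s_def by blast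
        define q where "q = (y + b) * (r * (a / 2))"
        have "\<bar>q\<bar> \<le> 4 * 4" unfolding q_def by (rule prod[OF ab(2) half[OF r(1,2)]])
        then show ?thesis unfolding r(3) h2 posX q_def[symmetric]
          using half[OF r(1,2)] xyz(1) ab(2) xa z2 by (intro posU; linarith)
      qed
      have inU: "h\<^sub>1 \<in> U" "h\<^sub>2 \<in> U" "h\<^sub>3 \<in> U"
        unfolding h\<^sub>1_def h\<^sub>2_def h\<^sub>3_def using seg1[of s] seg2[of t] seg3[of s] by (simp_all add: h\<^sub>1_def h\<^sub>2_def)
      have c1: "s * dX h - \<kappa> * s\<^sup>2 \<le> c h\<^sub>1 p - c h p"
        unfolding h\<^sub>1_def dX_def by (rule quad[OF seg1 X pL])
      have c2: "t * dY h\<^sub>1 - \<kappa> * t\<^sup>2 \<le> c h\<^sub>2 p - c h\<^sub>1 p"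
        unfolding h\<^sub>2_def dY_def by (rule quad[OF seg2 Y pL])
      have c3: "s * dX h\<^sub>2 - \<kappa> * s\<^sup>2 \<le> c h\<^sub>3 p - c h\<^sub>2 p"
        unfolding h\<^sub>3_def dX_def by (rule quad[OF seg3 X pL])
      have dY1: "\<bar>dY h\<^sub>1 - dY h\<bar> \<le> \<kappa> * \<bar>s\<bar>" and dX1: "\<bar>dX h\<^sub>1 - dX h\<bar> \<le> \<kappa> * \<bar>s\<bar>"
        using lip[OF hU _ X _ pL, of s] inU(1) X Y unfolding h\<^sub>1_def dX_def dY_def by auto
      have dX2: "\<bar>dX h\<^sub>2 - dX h\<^sub>1\<bar> \<le> \<kappa> * \<bar>t\<bar>"
        using lip[OF inU(1) _ Y X pL, of t] inU(2) unfolding h\<^sub>2_def dX_def by auto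
      have "\<bar>t * (dY h\<^sub>1 - dY h)\<bar> \<le> \<bar>t\<bar> * (\<kappa> * \<bar>s\<bar>)"
        unfolding abs_mult using dY1 by (intro mult_left_mono) auto
      then have e2: "t * dY h - \<kappa> * (\<bar>s\<bar> * \<bar>t\<bar>) \<le> t * dY h\<^sub>1"
        by (simp add: abs_le_iff algebra_simps)
      have "\<bar>s * (dX h\<^sub>2 - dX h)\<bar> \<le> \<bar>s\<bar> * (\<kappa> * \<bar>s\<bar> + \<kappa> * \<bar>t\<bar>)"
        unfolding abs_mult using dX1 dX2 by (intro mult_left_mono) (auto simp: abs_le_iff)
      then have e3: "s * dX h - (\<kappa> * s\<^sup>2 + \<kappa> * (\<bar>s\<bar> * \<bar>t\<bar>)) \<le> s * dX h\<^sub>2"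
        by (simp add: abs_le_iff algebra_simps power2_eq_square)
      have "0 \<le> (\<bar>s\<bar> - \<bar>t\<bar>)\<^sup>2" by simp
      then have "2 * (\<bar>s\<bar> * \<bar>t\<bar>) \<le> s\<^sup>2 + t\<^sup>2" by (simp add: power2_diff)
      then have "\<kappa> * (2 * (\<bar>s\<bar> * \<bar>t\<bar>)) \<le> \<kappa> * (s\<^sup>2 + t\<^sup>2)" using \<kappa> by (rule mult_left_mono)
      then have "2 * (s * dX h) + t * dY h - \<kappa> * (4 * s\<^sup>2 + 2 * t\<^sup>2) \<le> c h\<^sub>3 p - c h p"
        using c1 c2 c3 e2 e3 by (simp add: algebra_simps)
      moreover have "4 * s\<^sup>2 + 2 * t\<^sup>2 \<le> 2 * (a\<^sup>2 + b\<^sup>2)"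
      proof -
        have d1: "\<delta>\<^sup>2 \<le> 1" using \<delta> by (simp add: power_le_one)
        have "4 * s\<^sup>2 + 2 * t\<^sup>2 = \<delta>\<^sup>2 * (a\<^sup>2 + 2 * b\<^sup>2)"
          by (simp add: s_def t_def power_mult_distrib power_divide algebra_simps)
        also have "\<dots> \<le> 1 * (a\<^sup>2 + 2 * b\<^sup>2)" using d1 by (intro mult_right_mono) auto
        also have "\<dots> \<le> 2 * (a\<^sup>2 + b\<^sup>2)" by simp
        finally show ?thesis .
      qed
      then have "\<kappa> * (4 * s\<^sup>2 + 2 * t\<^sup>2) \<le> \<kappa> * (2 * (a\<^sup>2 + b\<^sup>2))" using \<kappa> by (rule mult_left_mono)
      ultimately have c: "\<delta> * dX h * a + \<delta> * dY h * b - 2 * \<kappa> * (a\<^sup>2 + b\<^sup>2) \<le> c h\<^sub>3 p - c h p"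
        by (simp add: s_def t_def algebra_simps)
      have h3: "h\<^sub>3 = pos (x + a) (y + b) (z + (x * b - y * a) / 2)"
      proof -
        have "x + a / 2 + a / 2 = x + a" by simp
        moreover have "z\<^sub>2 - (y + b) * (a / 2) / 2 = z + (x * b - y * a) / 2"
          by (simp add: z\<^sub>2_def z\<^sub>1_def field_simps)
        ultimately show ?thesis by (simp only: h\<^sub>3_def h2 s_def posX)
      qed
      have "h\<^sub>3 = h \<otimes> Exp ((\<delta> * a) *\<^sub>R X + (\<delta> * b) *\<^sub>R Y)" by (simp add: h_def posm h3)
      moreover have "(\<delta> * a) *\<^sub>R X + (\<delta> * b) *\<^sub>R Y \<in> layer G 1" by (intro V1_add V1_scale XL YL)
      ultimately have "h\<^sub>3 \<in> hplane G h" using in_hplane by metis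
      then have "h\<^sub>3 \<in> hplane G h \<inter> \<Omega>" using inU(3) U(3) by blast
      then have "u h + c h\<^sub>3 p - c h p \<le> u h\<^sub>3" using p unfolding subdiff_iff by blast
      then show ?thesis using c by (simp add: w_def h_def[symmetric] h3[symmetric])
    qed
    then show "\<exists>q\<^sub>1 q\<^sub>2. \<forall>a b. \<bar>x + a\<bar> \<le> 4 \<longrightarrow> \<bar>y + b\<bar> \<le> 4 \<longrightarrow> \<bar>z + (x * b - y * a) / 2\<bar> \<le> 4 \<longrightarrow>
      w x y z + q\<^sub>1 * a + q\<^sub>2 * b - 2 * \<kappa> * (a\<^sup>2 + b\<^sup>2) \<le> w (x + a) (y + b) (z + (x * b - y * a) / 2)"
      by blast
  qed
  then have "isCont (\<lambda>t. w 0 0 t) 0"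
    using heisenberg_semiconvex.vertical_continuous by (auto simp: isCont_def)
  moreover have "isCont (\<lambda>t. t / \<delta>\<^sup>2) 0" using \<delta> by (intro continuous_intros) auto
  ultimately have "isCont (\<lambda>t. w 0 0 (t / \<delta>\<^sup>2)) 0"
    using isCont_o2[of 0 "\<lambda>t. t / \<delta>\<^sup>2" "\<lambda>t. w 0 0 t"] by simp
  then show ?thesis using \<delta> by (simp add: isCont_def w_def pos_def W_def)
qed

lemma span_brackets_B: "V2 = span {ad X Y | X Y. X \<in> B \<and> Y \<in> B}"
proof
  let ?S = "span {ad X Y | X Y. X \<in> B \<and> Y \<in> B}"
  have spB: "span B = layer G 1" using basis by (simp add: horizontal_basis_def)
  have 1: "ad x Y \<in> ?S" if x: "x \<in> layer G 1" and Y: "Y \<in> B" for x Y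
  proof -
    have "span B \<subseteq> (\<lambda>x. ad x Y) -` ?S"
    proof (rule span_minimal)
      show "B \<subseteq> (\<lambda>x. ad x Y) -` ?S" using Y by (auto intro!: span_base)
      show "subspace ((\<lambda>x. ad x Y) -` ?S)"
        by (rule linear_subspace_vimage[OF linear_ad_left subspace_span])
    qed
    then show ?thesis using x spB by auto
  qed
  have 2: "ad x y \<in> ?S" if x: "x \<in> layer G 1" and y: "y \<in> layer G 1" for x y
  proof -
    have "span B \<subseteq> ad x -` ?S"
    proof (rule span_minimal)
      show "B \<subseteq> ad x -` ?S" using 1[OF x] by auto
      show "subspace (ad x -` ?S)"
        by (rule linear_subspace_vimage[OF linear_ad subspace_span])
    qed
    then show ?thesis using y spB by auto
  qed
  show "V2 \<subseteq> ?S" unfolding V2_def by (rule span_minimal) (use 2 in auto)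
  show "?S \<subseteq> V2" by (rule span_minimal[OF _ subspace_V2]) (use ad_V2 B_V1 in auto)
qed

text \<open>Exponential coordinates with respect to \<open>B\<close> and a basis of \<open>V2\<close> made of brackets of elements of \<open>B\<close>
  are triangular for the corresponding flows, and \<open>u\<close> is continuous along each of these flows.\<close>
lemma borel_measurable_u: "(\<lambda>g. if g \<in> \<Omega> then u g else 0) \<in> borel_measurable borel"
proof -
  obtain C where C: "C \<subseteq> {ad X Y | X Y. X \<in> B \<and> Y \<in> B}" "independent C" "{ad X Y | X Y. X \<in> B \<and> Y \<in> B} \<subseteq> span C"
    by (rule maximal_independent_subset)
  have spC: "span C = V2"
    unfolding span_brackets_B using C(1,3) by (meson span_mono span_minimal subspace_span subset_antisym)
  have finC: "finite C" using C(2) by (rule independent_imp_finite)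
  obtain bs where bs: "set bs = B" "distinct bs" using finite_distinct_list[OF finite_B] by auto
  obtain cs where cs: "set cs = C" "distinct cs" using finite_distinct_list[OF finC] by auto
  define m where "m = length bs"
  define N where "N = m + length cs"
  define e where "e i = (bs @ cs) ! i" for i
  have eB: "e i \<in> B" if "i < m" for i using that bs(1) by (auto simp: e_def nth_append m_def)
  have eC: "e i \<in> C" if "m \<le> i" "i < N" for i using that cs(1) by (auto simp: e_def nth_append m_def N_def)
  have eC2: "e i \<in> V2" if "m \<le> i" "i < N" for i using eC[OF that] spC span_base by blast
  have einj: "e i = e j \<longleftrightarrow> i = j" if "i < m \<and> j < m \<or> m \<le> i \<and> i < N \<and> m \<le> j \<and> j < N" for i j
    using that bs(2) cs(2) by (auto simp: e_def nth_append m_def N_def nth_eq_iff_index_eq)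
  define P where "P v = v - (\<Sum>b\<in>B. (v \<bullet> b) *\<^sub>R b)" for v :: 'v
  have exp1: "(\<Sum>b\<in>B. (y \<bullet> b) *\<^sub>R b) = y" if "y \<in> layer G 1" for y
    using basis that by (intro orthonormal_basis_expand finite_B) (auto simp: horizontal_basis_def)
  have inner_B: "(y + z) \<bullet> b = y \<bullet> b" if "b \<in> B" "z \<in> V2" for y z b
    using V1_orth_V2[OF B_V1[OF that(1)] that(2)] by (simp add: inner_add_left inner_commute[of z b])
  have P: "P (y + z) = z" if "y \<in> layer G 1" "z \<in> V2" for y z
    using inner_B[OF _ that(2), of _ y] exp1[OF that(1)] by (simp add: P_def)
  have linP: "linear P" unfolding P_def
    by (intro linearI) (auto simp: inner_add_left scaleR_add_left sum.distrib scaleR_sum_right scaleR_diff_right)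
  define R where "R = representation C"
  have PC: "P v \<in> span C" for v
  proof -
    obtain y z where "y \<in> layer G 1" "z \<in> V2" "v = y + z" using decomp by blast
    then show ?thesis using P spC by simp
  qed
  have R_add: "R (y + z) b = R y b + R z b" if "y \<in> span C" "z \<in> span C" for y z b
    unfolding R_def using real_vector.representation_add[OF C(2) that(1,2)] real_vector.representation_add[OF C(2) that(2,1)] by simp
  have R_scale: "R (t *\<^sub>R z) b = t * R z b" if "z \<in> span C" for t z b
    unfolding R_def using real_vector.representation_scale[OF C(2) that] by simp
  define x where "x i g = (if i < m then Log g \<bullet> e i else R (P (Log g)) (e i))" for i g
  have flow1: "Log (Exp (y + z) \<otimes> Exp (t *\<^sub>R d)) = (y + t *\<^sub>R d) + (z + (1/2) *\<^sub>R ad y (t *\<^sub>R d))"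
    if "y \<in> layer G 1" "z \<in> V2" "d \<in> layer G 1" for y z t d
    using Exp_mult[OF that(1) V1_scale[OF that(3)] that(2) subspace_0[OF subspace_V2], of t] by simp
  have flow2: "Log (Exp (y + z) \<otimes> Exp (t *\<^sub>R d)) = y + (z + t *\<^sub>R d)"
    if "y \<in> layer G 1" "z \<in> V2" "d \<in> V2" for y z t d
    using Exp_mult[OF that(1) subspace_0[OF subspace_V1] that(2) V2_scale[OF that(3)], of t] linear_0[OF linear_ad] by simp
  show ?thesis
  proof (rule measurable_of_continuous_along_flows[where \<theta> = "\<lambda>i t g. g \<otimes> Exp (t *\<^sub>R e i)" and x = x and N = N and \<Omega> = \<Omega>])
    fix i assume i: "i < N"
    have "linear (\<lambda>v. if i < m then v \<bullet> e i else R (P v) (e i))"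
      by (cases "i < m") (auto intro!: linearI simp: inner_add_left linear_add[OF linP] linear_scale[OF linP] R_add R_scale PC)
    then have "continuous_on UNIV (\<lambda>v. if i < m then v \<bullet> e i else R (P v) (e i))"
      using linear_continuous_on linear_conv_bounded_linear by blast
    then have "continuous_on UNIV (x i)"
      unfolding x_def[abs_def] by (rule continuous_on_compose2[OF _ continuous_Log]) auto
    then show "x i \<in> borel_measurable borel" by (rule borel_measurable_continuous_onI)
  next
    fix i and \<tau> :: "'g \<Rightarrow> real" assume "i < N" "\<tau> \<in> borel_measurable borel"
    then show "(\<lambda>g. g \<otimes> Exp (\<tau> g *\<^sub>R e i)) \<in> measurable borel borel"
      by (intro borel_measurable_continuous_Pair[where H = "\<lambda>g t. g \<otimes> Exp (t *\<^sub>R e i)" and f = "\<lambda>g. g" and g = \<tau>]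
          continuous_mult continuous_on_fst continuous_on_id continuous_on_compose2[OF continuous_Exp[of UNIV]] continuous_intros) auto
  next
    fix i j t g assume i: "i < N" "j \<le> i"
    obtain y z where yz: "y \<in> layer G 1" "z \<in> V2" "Log g = y + z" using decomp by blast
    then have g: "g = Exp (y + z)" by (metis Exp_Log)
    show "x j (g \<otimes> Exp (t *\<^sub>R e i)) = x j g + (if j = i then t else 0)"
    proof (cases "i < m")
      case True
      have eL: "e i \<in> layer G 1" using B_V1[OF eB[OF True]] .
      have zz: "z + (1/2) *\<^sub>R ad y (t *\<^sub>R e i) \<in> V2"
        by (intro V2_add V2_scale ad_V2 V1_scale eL yz)
      show ?thesis
        using True i B_inner[OF eB[OF True] eB[of j]] einj[of i j] inner_B[OF eB[of j] zz, of "y + t *\<^sub>R e i"] inner_B[OF eB[of j] yz(2), of y]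
        by (simp add: x_def g flow1[OF yz(1,2) eL] inner_add_left)
    next
      case False
      have eL: "e i \<in> V2" using eC2[of i] False i by simp
      have zz: "z + t *\<^sub>R e i \<in> V2" by (intro V2_add V2_scale eL yz)
      show ?thesis
      proof (cases "j < m")
        case True
        then show ?thesis
          using False inner_B[OF eB[of j] zz, of y] inner_B[OF eB[of j] yz(2), of y]
          by (auto simp: x_def g flow2[OF yz(1,2) eL])
      next
        case j: False
        have "R (e i) (e j) = (if j = i then 1 else 0)"
          unfolding R_def using real_vector.representation_basis[OF C(2) eC[of i]] False i j einj[of j i] by simp
        then show ?thesis
          using False j yz eL spC
          by (simp add: x_def g flow2[OF yz(1,2) eL] P[OF yz(1) zz] P[OF yz(1,2)] R_add R_scale V2_scale)
      qed
    qed
  next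
    fix g h assume eq: "\<And>i. i < N \<Longrightarrow> x i g = x i h"
    obtain y z where yz: "y \<in> layer G 1" "z \<in> V2" "Log g = y + z" using decomp by blast
    obtain y' z' where yz': "y' \<in> layer G 1" "z' \<in> V2" "Log h = y' + z'" using decomp by blast
    have "y \<bullet> b = y' \<bullet> b" if b: "b \<in> B" for b
    proof -
      obtain i where i: "i < m" "b = e i" using b bs(1) by (auto simp: in_set_conv_nth e_def nth_append m_def)
      then show ?thesis using eq[of i] inner_B[OF b yz(2), of y] inner_B[OF b yz'(2), of y']
        by (simp add: x_def yz(3) yz'(3) N_def)
    qed
    then have y: "y = y'" using exp1[OF yz(1)] exp1[OF yz'(1)] by (metis (no_types, lifting) sum.cong)
    have "R z b = R z' b" if b: "b \<in> C" for b
    proof -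
      obtain k where k: "k < length cs" "b = cs ! k" using b cs(1) by (auto simp: in_set_conv_nth)
      then have "b = e (m + k)" "m + k < N" by (simp_all add: e_def nth_append m_def N_def)
      then show ?thesis using eq[of "m + k"] P[OF yz(1,2)] P[OF yz'(1,2)] by (simp add: x_def yz(3) yz'(3))
    qed
    moreover have "(\<Sum>b\<in>C. R z b *\<^sub>R b) = z" "(\<Sum>b\<in>C. R z' b *\<^sub>R b) = z'"
      unfolding R_def using spC yz yz' by (intro real_vector.sum_representation_eq[OF C(2) _ finC]; simp)+
    ultimately have "z = z'" by (metis (no_types, lifting) sum.cong)
    then have "Log g = Log h" using y yz yz' by simp
    then show "g = h" by (metis Exp_Log)
  next
    show "\<Omega> \<in> sets borel" using open_Omega by simp
    show "\<And>g. g \<notin> \<Omega> \<Longrightarrow> (if g \<in> \<Omega> then u g else 0) = 0" by simp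
  next
    fix i g assume i: "i < N" and g: "g \<in> \<Omega>"
    have "((\<lambda>t. u (g \<otimes> Exp (t *\<^sub>R e i))) \<longlongrightarrow> u g) (at 0)"
    proof (cases "i < m")
      case True
      then show ?thesis using isCont_line[OF g eB[OF True]] by (simp add: isCont_def)
    next
      case False
      then obtain X Y where "X \<in> B" "Y \<in> B" "e i = ad X Y" using eC[of i] C(1) i by auto
      then show ?thesis using vertical_tendsto[OF g] by simp
    qed
    moreover obtain \<delta> where \<delta>: "\<delta> > 0" "\<And>t. \<bar>t\<bar> < \<delta> \<Longrightarrow> g \<otimes> Exp (t *\<^sub>R e i) \<in> \<Omega>"
      by (rule line_near[OF open_Omega g, where X = "e i"]) blast
    have "eventually (\<lambda>t. u (g \<otimes> Exp (t *\<^sub>R e i)) = (if g \<otimes> Exp (t *\<^sub>R e i) \<in> \<Omega> then u (g \<otimes> Exp (t *\<^sub>R e i)) else 0)) (at 0)"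
      unfolding eventually_at using \<delta> by (intro exI[of _ \<delta>]) (auto simp: dist_real_def)
    ultimately have "((\<lambda>t. if g \<otimes> Exp (t *\<^sub>R e i) \<in> \<Omega> then u (g \<otimes> Exp (t *\<^sub>R e i)) else 0) \<longlongrightarrow> u g) (at 0)"
      by (rule Lim_transform_eventually)
    then show "g \<otimes> Exp (0 *\<^sub>R e i) = g \<and>
      ((\<lambda>t. if g \<otimes> Exp (t *\<^sub>R e i) \<in> \<Omega> then u (g \<otimes> Exp (t *\<^sub>R e i)) else 0) \<longlongrightarrow> (if g \<in> \<Omega> then u g else 0)) (at 0)"
      using g by simp
  qed
qed

end

section \<open>Almost everywhere uniqueness of the subgradient\<close>

theorem corollary5p2:
  fixes G :: "('g::{t2_space, second_countable_topology}, 'v::euclidean_space) stratified_struct"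
    and B :: "'v set" and \<mu> :: "'g measure" and \<Omega> :: "'g set"
    and c :: "'g \<Rightarrow> 'v \<Rightarrow> real" and u :: "'g \<Rightarrow> real"
  assumes carnot: "carnot_group G"
    and basis: "horizontal_basis G B"
    and haar: "haar_measure G \<mu>"
    and Omega: "open \<Omega>" "H_convex G \<Omega>"
    and c_cont: "\<forall>g\<in>\<Omega>. continuous_on (layer G 1) (c g)"
    and c1: "\<forall>v\<in>layer G 1. (\<lambda>g. c g v) \<in> Gamma11_loc G B"
      "\<forall>g\<^sub>0. \<forall>\<rho>>0. gball G g\<^sub>0 \<rho> \<subseteq> \<Omega> \<longrightarrow>
         (\<exists>K>0. \<forall>g\<in>gball G g\<^sub>0 \<rho>. \<forall>g'\<in>gball G g\<^sub>0 \<rho>. \<forall>v\<in>layer G 1.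
            norm (hgrad G B (\<lambda>h. c h v) g' - hgrad G B (\<lambda>h. c h v) g) \<le> 2 * K * gdist G g' g)"
    and c2: "\<forall>g\<in>\<Omega>. \<forall>v :: nat \<Rightarrow> 'v. range v \<subseteq> layer G 1 \<longrightarrow>
         filterlim (\<lambda>n. norm (v n)) at_top sequentially \<longrightarrow>
         (\<exists>g'\<in>hplane G g \<inter> \<Omega>. limsup (\<lambda>n. ereal (c g' (v n) - c g (v n))) = \<infinity>)"
    and c3: "\<forall>g\<in>\<Omega>. inj_on (\<lambda>v. hgrad G B (\<lambda>h. c h v) g) (layer G 1)"
    and u_convex: "cH_convex G c \<Omega> (\<lambda>g. ereal (u g))"
    and u_meas: "2 < step G \<Longrightarrow> u \<in> borel_measurable (restrict_space (completion \<mu>) \<Omega>)"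
  shows "AE g in \<mu>. g \<in> \<Omega> \<longrightarrow>
           is_singleton (cH_subdiff G c \<Omega> (\<lambda>g. ereal (u g)) g) \<and>
           (\<forall>X\<in>B. \<exists>D. has_hderiv G X u g D) \<and>
           hgrad G B u g \<in> (\<lambda>v. hgrad G B (\<lambda>h. c h v) g) ` layer G 1 \<and>
           cH_subdiff G c \<Omega> (\<lambda>g. ereal (u g)) g =
             {inv_into (layer G 1) (\<lambda>v. hgrad G B (\<lambda>h. c h v) g) (hgrad G B u g)}"
proof -
  interpret carnot_group G by (rule carnot)
  interpret carnot_haar G \<mu> by unfold_locales (rule haar)
  interpret cost_setting G B \<Omega> c u
    by unfold_locales (rule basis Omega(1) c_cont c1 c2 u_convex)+
  obtain u' Z where u': "u' \<in> borel_measurable borel" "Z \<in> null_sets \<mu>"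
    "\<And>g. g \<in> \<Omega> \<Longrightarrow> g \<notin> Z \<Longrightarrow> u g = u' g"
  proof (cases "step G \<le> 2")
    case True
    interpret cost_setting_step_le_2 G B \<Omega> c u by unfold_locales (rule True)
    show ?thesis by (rule that[OF borel_measurable_u, of "{}"]) auto
  next
    case False
    have "(\<lambda>g. if g \<in> \<Omega> then u g else 0) \<in> borel_measurable (completion \<mu>)"
      using u_meas False Omega(1)
      by (subst measurable_restrict_space_iff[symmetric]) (auto simp: sets_completionI_sets)
    then obtain u' where u': "u' \<in> borel_measurable \<mu>" "AE g in \<mu>. (if g \<in> \<Omega> then u g else 0) = u' g"
      using completion_ex_borel_measurable_real by blast
    from u'(2) obtain Z where "{g \<in> space \<mu>. \<not> (if g \<in> \<Omega> then u g else 0) = u' g} \<subseteq> Z" "Z \<in> null_sets \<mu>"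
      by (auto elim!: AE_E simp: null_sets_def)
    then have "u g = u' g" if "g \<in> \<Omega>" "g \<notin> Z" for g
    proof -
      have "g \<notin> {g \<in> space \<mu>. \<not> (if g \<in> \<Omega> then u g else 0) = u' g}"
        using that(2) \<open>_ \<subseteq> Z\<close> by blast
      then show ?thesis using that(1) by simp
    qed
    moreover have "u' \<in> borel_measurable borel"
      using u'(1) by (simp add: measurable_cong_sets[OF sets_mu refl])
    ultimately show ?thesis using \<open>Z \<in> null_sets \<mu>\<close> by (intro that[of u' Z])
  qed
  have "AE g in \<mu>. \<forall>X\<in>B. g \<in> \<Omega> \<longrightarrow> (\<exists>D. has_hderiv G X u g D)"
    unfolding AE_finite_all[OF finite_B]
    by (intro ballI AE_has_hderiv[OF Omega(1) u' isCont_line countable_nondifferentiable_line])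
  then show ?thesis
  proof eventually_elim
    case (elim g)
    show ?case
    proof
      assume g: "g \<in> \<Omega>"
      let ?H = "\<lambda>v. hgrad G B (\<lambda>h. c h v) g"
      have D: "\<forall>X\<in>B. \<exists>D. has_hderiv G X u g D" using elim g by blast
      have grad: "?H p = hgrad G B u g" if p: "p \<in> subdiff g" for p
        unfolding hgrad_def
      proof (rule sum.cong[OF refl])
        fix X assume X: "X \<in> B"
        then obtain d where d: "has_hderiv G X u g d" using D by blast
        show "hderiv G X (\<lambda>h. c h p) g *\<^sub>R X = hderiv G X u g *\<^sub>R X"
          using subdiff_hderiv[OF g p X d] THE_has_hderiv[OF d] by simp
      qed
      have L: "p \<in> layer G 1" if "p \<in> subdiff g" for p using that by (simp add: subdiff_iff)
      obtain p where p: "p \<in> subdiff g" using subdiff_nonempty[OF g] by auto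
      have inj: "inj_on ?H (layer G 1)" using c3 g by blast
      have "subdiff g = {p}"
        using p grad L inj_onD[OF inj] by fastforce
      moreover have "inv_into (layer G 1) ?H (hgrad G B u g) = p"
        using inv_into_f_f[OF inj L[OF p]] grad[OF p] by simp
      moreover have "hgrad G B u g \<in> ?H ` layer G 1"
        by (rule image_eqI[of _ _ p]) (simp_all add: grad[OF p] L[OF p, simplified])
      ultimately show "is_singleton (subdiff g) \<and> (\<forall>X\<in>B. \<exists>D. has_hderiv G X u g D) \<and>
        hgrad G B u g \<in> ?H ` layer G 1 \<and> subdiff g = {inv_into (layer G 1) ?H (hgrad G B u g)}"
        using D by (simp add: is_singleton_def)
    qed
  qed
qed

end
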